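(* There is an algorithm that, on input of a weighted undirected DAG compression $D=(V,A,E,w)$ of a weighted connected undirected graph $\mathbf{G}=(\mathbf{V},\mathbf{E},\mathbf{w})$, computes a minimum spanning tree of $\mathbf{G}$ in time $O\bigl((|A|+|E|)\cdot\alpha(|\mathbf{V}|)+t_{\mathrm{sort}}(|E|)\bigr)$, where $\alpha$ is the inverse Ackermann function and $t_{\mathrm{sort}}(m)$ is the time needed to sort an array of $m$ weights.
   Context: A weighted undirected graph is $\mathbf{G}=(\mathbf{V},\mathbf{E},\mathbf{w})$ with $\mathbf{E}\subseteq\{\{\mathbf{u},\mathbf{v}\}\mid \mathbf{u},\mathbf{v}\in\mathbf{V}\}$ and $\mathbf{w}\colon\mathbf{E}\to\mathbb{N}$. For sets $X,Y$ let $X\otimes Y=\{\{x,y\}\mid x\in X,y\in Y\}$. An undirected DAG compression of $(\mathbf{V},\mathbf{E})$ is a triple $(V,A,E)$ where $(V,A)$ is a directed acyclic graph (the cluster DAG; elements of $A$ are called arcs) whose set of sinks (vertices of out-degree $0$) is exactly $\mathbf{V}\subseteq V$; for $v\in V$ the cluster $\mathbf{C}(v)$ is the set of sinks reachable from $v$ in $(V,A)$ (so $\mathbf{C}(\mathbf{v})=\{\mathbf{v}\}$ for $\mathbf{v}\in\mathbf{V}$); and $E\subseteq V\otimes V$ is a set of undirected compression edges with $\mathbf{E}=\bigcup_{\{u,v\}\in E}\mathbf{C}(u)\otimes\mathbf{C}(v)$. A weighted undirected DAG compression of $\mathbf{G}$ is a quadruple $(V,A,E,w)$ such that $(V,A,E)$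 is an undirected DAG compression of $(\mathbf{V},\mathbf{E})$, $w\colon E\to\mathbb{N}$, and for every $\{\mathbf{x},\mathbf{y}\}\in\mathbf{E}$ we have $\mathbf{w}(\{\mathbf{x},\mathbf{y}\})=\min\{w(\{u,v\})\mid \{u,v\}\in E,\ \mathbf{x}\in\mathbf{C}(u),\ \mathbf{y}\in\mathbf{C}(v)\}$. A minimum spanning tree is a spanning tree of $\mathbf{G}$ of minimum total edge weight. *)

theory Defs
  imports Main
begin

section \<open>Weighted undirected graphs and spanning trees\<close>

text \<open>Edges are sets \<open>{x, y}\<close>; the case \<open>x = y\<close> (a loop) is allowed.\<close>

definition pairs :: "'v set \<Rightarrow> 'v set \<Rightarrow> 'v set set" where
  "pairs X Y = {{x, y} | x y. x \<in> X \<and> y \<in> Y}"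

text \<open>The weight function is total for technical reasons; only its values on \<open>edges\<close> matter.\<close>

record 'v wgraph =
  verts :: "'v set"
  edges :: "'v set set"
  weight :: "'v set \<Rightarrow> nat"

definition weighted_graph :: "'v wgraph \<Rightarrow> bool" where
  "weighted_graph G \<longleftrightarrow> finite (verts G) \<and> edges G \<subseteq> pairs (verts G) (verts G)"

definition graph_connected :: "'v set \<Rightarrow> 'v set set \<Rightarrow> bool" where
  "graph_connected V E \<longleftrightarrow>
     V \<noteq> {} \<and> (\<forall>u\<in>V. \<forall>v\<in>V. (u, v) \<in> {(x, y). {x, y} \<in> E}\<^sup>*)"

text \<open>A one-element list is a cycle iff there is a loop at its vertex. Length two is
  excluded because walking along one edge and back is not a cycle.\<close>

definition graph_cycle :: "'v set set \<Rightarrow> 'v list \<Rightarrow> bool" where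
  "graph_cycle E vs \<longleftrightarrow>
     vs \<noteq> [] \<and> length vs \<noteq> 2 \<and> distinct vs \<and>
     (\<forall>i < length vs. {vs ! i, vs ! (Suc i mod length vs)} \<in> E)"

definition spanning_tree :: "'v wgraph \<Rightarrow> 'v set set \<Rightarrow> bool" where
  "spanning_tree G T \<longleftrightarrow>
     T \<subseteq> edges G \<and> graph_connected (verts G) T \<and> (\<nexists>vs. graph_cycle T vs)"

definition minimum_spanning_tree :: "'v wgraph \<Rightarrow> 'v set set \<Rightarrow> bool" where
  "minimum_spanning_tree G T \<longleftrightarrow>
     spanning_tree G T \<and> (\<forall>T'. spanning_tree G T' \<longrightarrow> sum (weight G) T \<le> sum (weight G) T')"


section \<open>DAG compressions\<close>

record 'v wdag =
  dverts :: "'v set"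
  darcs :: "('v \<times> 'v) set"
  dedges :: "'v set set"
  dweight :: "'v set \<Rightarrow> nat"

definition sinks :: "'v wdag \<Rightarrow> 'v set" where
  "sinks D = {v \<in> dverts D. \<nexists>u. (v, u) \<in> darcs D}"

definition cluster :: "'v wdag \<Rightarrow> 'v \<Rightarrow> 'v set" where
  "cluster D v = {x \<in> sinks D. (v, x) \<in> (darcs D)\<^sup>*}"

definition undirected_dag_compression :: "'v wdag \<Rightarrow> 'v wgraph \<Rightarrow> bool" where
  "undirected_dag_compression D G \<longleftrightarrow>
     finite (dverts D) \<and>
     darcs D \<subseteq> dverts D \<times> dverts D \<and> acyclic (darcs D) \<and>
     sinks D = verts G \<and>
     dedges D \<subseteq> pairs (dverts D) (dverts D) \<and>
     edges G = \<Union> {pairs (cluster D u) (cluster D v) | u v. {u, v} \<in> dedges D}"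

definition weighted_dag_compression :: "'v wdag \<Rightarrow> 'v wgraph \<Rightarrow> bool" where
  "weighted_dag_compression D G \<longleftrightarrow>
     undirected_dag_compression D G \<and>
     (\<forall>x y. {x, y} \<in> edges G \<longrightarrow>
        weight G {x, y} =
        Min {dweight D {u, v} | u v. {u, v} \<in> dedges D \<and> x \<in> cluster D u \<and> y \<in> cluster D v})"


section \<open>The inverse Ackermann function\<close>

fun ack :: "nat \<Rightarrow> nat \<Rightarrow> nat" where
  "ack 0 n = Suc n"
| "ack (Suc m) 0 = ack m 1"
| "ack (Suc m) (Suc n) = ack m (ack (Suc m) n)"

text \<open>Starting at \<open>1\<close> keeps the function positive, as is needed when it is used as a factor
  in a running time.\<close>

definition inverse_ack :: "nat \<Rightarrow> nat" where
  "inverse_ack n = (LEAST k. 1 \<le> k \<and> n \<le> ack k k)"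


section \<open>Random access machines\<close>

text \<open>Programs of a unit-cost random access machine over the natural numbers with addition and
  truncated subtraction, in structured form. The memory is divided into named banks. A program
  mentions only finitely many of them, so interleaving them in a single memory
  costs a constant factor. A scalar \<open>x\<close> is the cell at address \<open>0\<close> of its bank.\<close>

type_synonym state = "string \<Rightarrow> nat \<Rightarrow> nat"

datatype aexp =
    Num nat
  | Load string aexp
  | Plus aexp aexp
  | Minus aexp aexp

datatype bexp =
    Less aexp aexp
  | Not bexp
  | And bexp bexp

datatype com =
    Skip
  | Store string aexp aexp
  | Seq com com
  | If bexp com com
  | While bexp com

fun aval :: "aexp \<Rightarrow> state \<Rightarrow> nat" where
  "aval (Num n) s = n"
| "aval (Load x a) s = s x (aval a s)"
| "aval (Plus a b) s = aval a s + aval b s"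
| "aval (Minus a b) s = aval a s - aval b s"

fun bval :: "bexp \<Rightarrow> state \<Rightarrow> bool" where
  "bval (Less a b) s \<longleftrightarrow> aval a s < aval b s"
| "bval (Not b) s \<longleftrightarrow> \<not> bval b s"
| "bval (And b c) s \<longleftrightarrow> bval b s \<and> bval c s"

fun acost :: "aexp \<Rightarrow> nat" where
  "acost (Num n) = 1"
| "acost (Load x a) = acost a + 1"
| "acost (Plus a b) = acost a + acost b + 1"
| "acost (Minus a b) = acost a + acost b + 1"

fun bcost :: "bexp \<Rightarrow> nat" where
  "bcost (Less a b) = acost a + acost b + 1"
| "bcost (Not b) = bcost b + 1"
| "bcost (And b c) = bcost b + bcost c + 1"

text \<open>\<open>exec c s k s'\<close>: started in \<open>s\<close>, the program \<open>c\<close> halts in \<open>s'\<close> after \<open>k\<close> steps.\<close>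

inductive exec :: "com \<Rightarrow> state \<Rightarrow> nat \<Rightarrow> state \<Rightarrow> bool" where
  Skip: "exec Skip s 1 s"
| Store: "exec (Store x i a) s (acost i + acost a + 1)
            (s(x := (s x)(aval i s := aval a s)))"
| Seq: "exec c1 s k s' \<Longrightarrow> exec c2 s' l s'' \<Longrightarrow> exec (Seq c1 c2) s (k + l) s''"
| IfTrue: "bval b s \<Longrightarrow> exec c1 s k s' \<Longrightarrow> exec (If b c1 c2) s (bcost b + k + 1) s'"
| IfFalse: "\<not> bval b s \<Longrightarrow> exec c2 s k s' \<Longrightarrow> exec (If b c1 c2) s (bcost b + k + 1) s'"
| WhileFalse: "\<not> bval b s \<Longrightarrow> exec (While b c) s (bcost b + 1) s"
| WhileTrue: "bval b s \<Longrightarrow> exec c s k s' \<Longrightarrow> exec (While b c) s' l s'' \<Longrightarrow>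
              exec (While b c) s (bcost b + k + l + 1) s''"

lemma exec_positive: "exec c s k s' \<Longrightarrow> 0 < k"
  by (induction rule: exec.induct) auto

inductive_cases exec_SkipE: "exec Skip s k s'"
inductive_cases exec_StoreE: "exec (Store x i a) s k s'"
inductive_cases exec_SeqE: "exec (Seq c1 c2) s k s'"
inductive_cases exec_IfE: "exec (If b c1 c2) s k s'"
inductive_cases exec_WhileE: "exec (While b c) s k s'"

lemma exec_deterministic:
  "exec c s k s' \<Longrightarrow> exec c s l s'' \<Longrightarrow> k = l \<and> s' = s''"
proof (induction arbitrary: l s'' rule: exec.induct)
  case (Skip s)
  then show ?case by (elim exec_SkipE) simp
next
  case (Store x i a s)
  then show ?case by (elim exec_StoreE) simp
next
  case (Seq c1 s k s' c2 k' t)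
  show ?case by (rule exec_SeqE[OF Seq.prems]) (auto dest: Seq.IH)
next
  case (IfTrue b s c1 k s' c2)
  show ?case by (rule exec_IfE[OF IfTrue.prems]) (auto simp: IfTrue.hyps(1) dest: IfTrue.IH)
next
  case (IfFalse b s c2 k s' c1)
  show ?case by (rule exec_IfE[OF IfFalse.prems]) (auto simp: IfFalse.hyps(1) dest: IfFalse.IH)
next
  case (WhileFalse b s c)
  show ?case by (rule exec_WhileE[OF WhileFalse.prems]) (auto simp: WhileFalse.hyps)
next
  case (WhileTrue b s c k s' k' t)
  show ?case by (rule exec_WhileE[OF WhileTrue.prems]) (auto simp: WhileTrue.hyps(1) dest: WhileTrue.IH)
qed


section \<open>Input and output\<close>

definition bank :: "nat list \<Rightarrow> nat \<Rightarrow> nat" where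
  "bank xs i = (if i < length xs then xs ! i else 0)"

definition sort_input :: "nat list \<Rightarrow> state" where
  "sort_input xs = (\<lambda>x i. 0)(''len'' := bank [length xs], ''data'' := bank xs)"

text \<open>\<open>S\<close> sorts every array of \<open>m\<close> weights in place in at most \<open>t m\<close> steps.\<close>

definition sorts_in_time :: "com \<Rightarrow> (nat \<Rightarrow> nat) \<Rightarrow> bool" where
  "sorts_in_time S t \<longleftrightarrow>
     (\<forall>xs. \<exists>k s. exec S (sort_input xs) k s \<and> k \<le> t (length xs) \<and>
        map (s ''data'') [0..<length xs] = sort xs)"

text \<open>A DAG compression is given to a program by the number \<open>n\<close> of its vertices, which are named
  \<open>0, \<dots>, n - 1\<close>, a list of its arcs, and a list of its compression edges with their weights.
  The lists are in arbitrary order and do not contain repetitions; the two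
  ends of a compression edge are given in arbitrary order, too.\<close>

definition represents ::
  "nat \<Rightarrow> (nat \<times> nat) list \<Rightarrow> (nat \<times> nat \<times> nat) list \<Rightarrow> nat wdag \<Rightarrow> bool" where
  "represents n as es D \<longleftrightarrow>
     dverts D = {..<n} \<and>
     distinct as \<and> set as = darcs D \<and>
     distinct (map (\<lambda>(u, v, k). {u, v}) es) \<and> set (map (\<lambda>(u, v, k). {u, v}) es) = dedges D \<and>
     (\<forall>(u, v, k) \<in> set es. dweight D {u, v} = k)"

definition dag_input :: "nat \<Rightarrow> (nat \<times> nat) list \<Rightarrow> (nat \<times> nat \<times> nat) list \<Rightarrow> state" where
  "dag_input n as es = (\<lambda>x i. 0)(
     ''num_verts'' := bank [n],
     ''num_arcs'' := bank [length as],
     ''num_edges'' := bank [length es],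
     ''arc_tail'' := bank (map fst as),
     ''arc_head'' := bank (map snd as),
     ''edge_fst'' := bank (map (\<lambda>(u, v, k). u) es),
     ''edge_snd'' := bank (map (\<lambda>(u, v, k). v) es),
     ''edge_weight'' := bank (map (\<lambda>(u, v, k). k) es))"

definition output_edges :: "state \<Rightarrow> nat set list" where
  "output_edges s = map (\<lambda>i. {s ''out_fst'' i, s ''out_snd'' i}) [0..<s ''out_len'' 0]"

end

theory Submission
  imports Defs
begin

text \<open>Kruskal's algorithm processes the compression edges in the order of their weights. Once an edge
  between \<open>u\<close> and \<open>v\<close> has been processed, the whole cluster of each vertex reachable from \<open>u\<close> or \<open>v\<close>
  lies in one component, so no vertex has to be explored twice. Choose a sink \<open>f x\<close> in the cluster of
  each vertex \<open>x\<close> such that \<open>f x = f y\<close> for some arc \<open>(x, y)\<close>. When the edge between \<open>u\<close> and \<open>v\<close> is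
  processed, the edges \<open>{f x, f v}\<close> suffice, where \<open>x\<close> is \<open>u\<close> or the head of an arc that is explored
  from \<open>u\<close> for the first time; likewise with \<open>u\<close> and \<open>v\<close> exchanged. These are \<open>2 |E| + |A|\<close> edges
  in total, and at each weight threshold they have the same components as the graph itself. They are
  passed to union-find with path compression, restricted to the sinks, which gives the factor
  \<open>\<alpha>(|V|)\<close>.

  The program \<open>S\<close> sorts weights but not edges. The edges are therefore put into linked lists
  addressed by their weights, and these lists are emptied in the order of the sorted weights.\<close>

section \<open>Weakest preconditions with a clock\<close>

text \<open>A sparse edge carries the weight of the half-edge that produced it, although a lighter
  compression edge may cover the same pair in \<open>G\<close>. This is harmless: minimality of a
  spanning tree is checked by counting its edges above each threshold, and for that the labels need
  only bound the weights from above and yield the right components.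

  A half-edge from \<open>u\<close> to \<open>v\<close> attaches the cluster of \<open>u\<close> to
  the single sink \<open>f v\<close>. Since \<open>f u\<close> is among the attached sinks, this
  half-edge and its reverse together join every pair between the two clusters.

  No summand for the number of vertices appears in the bound. Connectivity makes this possible:
  unless it is the only one, a vertex of \<open>G\<close> is the head of an arc or an end of a
  compression edge. In the exceptional case there may be neither arcs nor edges, and the work is
  charged to \<open>t_sort\<close>, which is at least 1 because every execution takes a step.

  Sorting is a given program with its own banks. Its banks are renamed so that it meets exactly the
  memory for which it is specified.\<close>

text \<open>The clock \<open>k\<close> counts up. A loop invariant bounds it, and since every iteration advances it,
  such a bound also proves termination.\<close>

definition wp :: "com \<Rightarrow> (nat \<Rightarrow> state \<Rightarrow> bool) \<Rightarrow> nat \<Rightarrow> state \<Rightarrow> bool" where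
  "wp c Q k s \<longleftrightarrow> (\<exists>j s'. exec c s j s' \<and> Q (k + j) s')"

lemma wp_Skip: "wp Skip Q k s \<longleftrightarrow> Q (k + 1) s"
  unfolding wp_def by (metis exec.Skip exec_SkipE)

lemma wp_Store:
  "wp (Store x i a) Q k s \<longleftrightarrow>
     Q (k + (acost i + acost a + 1)) (s(x := (s x)(aval i s := aval a s)))"
  unfolding wp_def by (metis exec.Store exec_StoreE)

lemma wp_Seq: "wp (Seq c1 c2) Q k s \<longleftrightarrow> wp c1 (wp c2 Q) k s"
  unfolding wp_def by (fastforce elim!: exec_SeqE intro: exec.Seq simp: add.assoc)

lemma wp_If:
  "wp (If b c1 c2) Q k s \<longleftrightarrow>
     (if bval b s then wp c1 Q (k + (bcost b + 1)) s else wp c2 Q (k + (bcost b + 1)) s)"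
proof (cases "bval b s")
  case True
  show ?thesis
  proof
    assume "wp (If b c1 c2) Q k s"
    then obtain j s' where e: "exec (If b c1 c2) s j s'" and Q: "Q (k + j) s'"
      unfolding wp_def by auto
    from e obtain i where "j = bcost b + i + 1" "exec c1 s i s'"
      by (rule exec_IfE) (use True in auto)
    then show "if bval b s then wp c1 Q (k + (bcost b + 1)) s else wp c2 Q (k + (bcost b + 1)) s"
      using True Q unfolding wp_def by (auto simp: algebra_simps)
  next
    assume "if bval b s then wp c1 Q (k + (bcost b + 1)) s else wp c2 Q (k + (bcost b + 1)) s"
    then obtain j s' where "exec c1 s j s'" "Q (k + (bcost b + 1) + j) s'"
      using True unfolding wp_def by auto
    then show "wp (If b c1 c2) Q k s"
      using exec.IfTrue[of b s c1 j s' c2] True unfolding wp_def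
      by (intro exI[of _ "bcost b + j + 1"] exI[of _ s']) (auto simp: algebra_simps)
  qed
next
  case False
  show ?thesis
  proof
    assume "wp (If b c1 c2) Q k s"
    then obtain j s' where e: "exec (If b c1 c2) s j s'" and Q: "Q (k + j) s'"
      unfolding wp_def by auto
    from e obtain i where "j = bcost b + i + 1" "exec c2 s i s'"
      by (rule exec_IfE) (use False in auto)
    then show "if bval b s then wp c1 Q (k + (bcost b + 1)) s else wp c2 Q (k + (bcost b + 1)) s"
      using False Q unfolding wp_def by (auto simp: algebra_simps)
  next
    assume "if bval b s then wp c1 Q (k + (bcost b + 1)) s else wp c2 Q (k + (bcost b + 1)) s"
    then obtain j s' where "exec c2 s j s'" "Q (k + (bcost b + 1) + j) s'"
      using False unfolding wp_def by auto
    then show "wp (If b c1 c2) Q k s"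
      using exec.IfFalse[of b s c2 j s' c1] False unfolding wp_def
      by (intro exI[of _ "bcost b + j + 1"] exI[of _ s']) (auto simp: algebra_simps)
  qed
qed

lemma wp_While:
  assumes "I k s"
    and bounded: "\<And>k s. I k s \<Longrightarrow> k \<le> B"
    and body: "\<And>k s. I k s \<Longrightarrow> bval b s \<Longrightarrow> wp c I (k + (bcost b + 1)) s"
    and exit: "\<And>k s. I k s \<Longrightarrow> \<not> bval b s \<Longrightarrow> Q (k + (bcost b + 1)) s"
  shows "wp (While b c) Q k s"
  using assms(1)
proof (induction "Suc B - k" arbitrary: k s rule: less_induct)
  case less
  show ?case
  proof (cases "bval b s")
    case True
    then obtain j s' where e: "exec c s j s'" and I: "I (k + (bcost b + 1) + j) s'"
      using body[OF less.prems] unfolding wp_def by auto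
    have "Suc B - (k + (bcost b + 1) + j) < Suc B - k"
      using bounded[OF less.prems] by simp
    from less.hyps[OF this I] obtain l s'' where
      "exec (While b c) s' l s''" "Q (k + (bcost b + 1) + j + l) s''"
      unfolding wp_def by auto
    with exec.WhileTrue[OF True e this(1)] show ?thesis
      unfolding wp_def
      by (intro exI[of _ "bcost b + j + l + 1"] exI[of _ s'']) (simp add: algebra_simps)
  next
    case False
    then show ?thesis
      unfolding wp_def using exit[OF less.prems False] exec.WhileFalse by blast
  qed
qed

section \<open>Banks that a program leaves unchanged\<close>

fun writes :: "com \<Rightarrow> string set" where
  "writes Skip = {}"
| "writes (Store x i a) = {x}"
| "writes (Seq c1 c2) = writes c1 \<union> writes c2"
| "writes (If b c1 c2) = writes c1 \<union> writes c2"
| "writes (While b c) = writes c"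

lemma exec_unwritten: "exec c s k s' \<Longrightarrow> x \<notin> writes c \<Longrightarrow> s' x = s x"
  by (induction rule: exec.induct) auto

text \<open>Builds the frame rule into consequence: specifications of program pieces mention only
  the banks they write, and all others are recovered here.\<close>

lemma wp_conseq:
  assumes "wp c Q k s"
    and "\<And>k' s'. Q k' s' \<Longrightarrow> \<forall>x. x \<notin> writes c \<longrightarrow> s' x = s x \<Longrightarrow> Q' k' s'"
  shows "wp c Q' k s"
  using assms exec_unwritten unfolding wp_def by metis

section \<open>Running a program on renamed banks\<close>

primrec rename_aexp :: "(string \<Rightarrow> string) \<Rightarrow> aexp \<Rightarrow> aexp" where
  "rename_aexp f (Num n) = Num n"
| "rename_aexp f (Load x a) = Load (f x) (rename_aexp f a)"
| "rename_aexp f (Plus a b) = Plus (rename_aexp f a) (rename_aexp f b)"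
| "rename_aexp f (Minus a b) = Minus (rename_aexp f a) (rename_aexp f b)"

primrec rename_bexp :: "(string \<Rightarrow> string) \<Rightarrow> bexp \<Rightarrow> bexp" where
  "rename_bexp f (Less a b) = Less (rename_aexp f a) (rename_aexp f b)"
| "rename_bexp f (Not b) = Not (rename_bexp f b)"
| "rename_bexp f (And b c) = And (rename_bexp f b) (rename_bexp f c)"

primrec rename :: "(string \<Rightarrow> string) \<Rightarrow> com \<Rightarrow> com" where
  "rename f Skip = Skip"
| "rename f (Store x i a) = Store (f x) (rename_aexp f i) (rename_aexp f a)"
| "rename f (Seq c1 c2) = Seq (rename f c1) (rename f c2)"
| "rename f (If b c1 c2) = If (rename_bexp f b) (rename f c1) (rename f c2)"
| "rename f (While b c) = While (rename_bexp f b) (rename f c)"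

lemma aval_rename [simp]: "aval (rename_aexp f a) s = aval a (\<lambda>x. s (f x))"
  by (induction a) auto

lemma bval_rename [simp]: "bval (rename_bexp f b) s = bval b (\<lambda>x. s (f x))"
  by (induction b) auto

lemma acost_rename [simp]: "acost (rename_aexp f a) = acost a"
  by (induction a) auto

lemma bcost_rename [simp]: "bcost (rename_bexp f b) = bcost b"
  by (induction b) auto

lemma writes_rename: "writes (rename f c) = f ` writes c"
  by (induction c) auto

text \<open>Since \<open>f\<close> is injective, a store to \<open>f x\<close> changes the view of
  memory through \<open>f\<close> only at \<open>x\<close>. The renamed program therefore simulates
  the original step by step, with the same cost, whatever \<open>r\<close> holds outside the range
  of \<open>f\<close>.\<close>

lemma exec_rename:
  assumes "inj f"
  shows "exec c s k s' \<Longrightarrow> (\<lambda>x. r (f x)) = s \<Longrightarrow> \<exists>r'. exec (rename f c) r k r' \<and> (\<lambda>x. r' (f x)) = s'"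
proof (induction arbitrary: r rule: exec.induct)
  case (Skip s)
  then show ?case by (metis exec.Skip rename.simps(1))
next
  case (Store x i a s)
  let ?r' = "r(f x := (r (f x))(aval i s := aval a s))"
  have "(\<lambda>y. ?r' (f y)) = s(x := (s x)(aval i s := aval a s))"
    using Store assms by (auto simp: fun_eq_iff inj_eq)
  moreover have "exec (rename f (Store x i a)) r (acost i + acost a + 1) ?r'"
    using exec.Store[of "f x" "rename_aexp f i" "rename_aexp f a" r] Store by simp
  ultimately show ?case by blast
next
  case (Seq c1 s k s' c2 l s'')
  then show ?case by (metis exec.Seq rename.simps(3))
next
  case (IfTrue b s c1 k s' c2)
  then show ?case by (metis bcost_rename bval_rename exec.IfTrue rename.simps(4))
next
  case (IfFalse b s c2 k s' c1)
  then show ?case by (metis bcost_rename bval_rename exec.IfFalse rename.simps(4))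
next
  case (WhileFalse b s c)
  then show ?case by (metis bcost_rename bval_rename exec.WhileFalse rename.simps(5))
next
  case (WhileTrue b s c k s' l s'')
  then show ?case by (metis bcost_rename bval_rename exec.WhileTrue rename.simps(5))
qed

section \<open>Union-find with path compression\<close>

text \<open>\<open>R\<close> assigns to every element the root of its tree; \<open>\<rho>\<close> increases towards the root.\<close>

definition trees :: "'v set \<Rightarrow> ('v \<Rightarrow> 'v) \<Rightarrow> ('v \<Rightarrow> nat) \<Rightarrow> ('v \<Rightarrow> 'v) \<Rightarrow> bool" where
  "trees V p \<rho> R \<longleftrightarrow> finite V \<and>
     (\<forall>x\<in>V. p x \<in> V \<and> R (p x) = R x \<and> (p x = x \<longrightarrow> R x = x) \<and> (p x \<noteq> x \<longrightarrow> \<rho> x < \<rho> (p x)))"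

definition root_path :: "('v \<Rightarrow> 'v) \<Rightarrow> 'v \<Rightarrow> nat \<Rightarrow> 'v \<Rightarrow> bool" where
  "root_path p x l r \<longleftrightarrow> (p ^^ l) x = r \<and> p r = r \<and> (\<forall>i<l. p ((p ^^ i) x) \<noteq> (p ^^ i) x)"

definition compress :: "('v \<Rightarrow> 'v) \<Rightarrow> 'v \<Rightarrow> nat \<Rightarrow> 'v \<Rightarrow> 'v \<Rightarrow> 'v" where
  "compress p x l r = (\<lambda>z. if z \<in> (\<lambda>i. (p ^^ i) x) ` {..<l} then r else p z)"

context
  fixes V :: "'v set" and p :: "'v \<Rightarrow> 'v" and \<rho> :: "'v \<Rightarrow> nat" and R :: "'v \<Rightarrow> 'v"
  assumes tr: "trees V p \<rho> R"
begin

lemma trees_funpow: "x \<in> V \<Longrightarrow> (p ^^ i) x \<in> V \<and> R ((p ^^ i) x) = R x \<and> \<rho> x \<le> \<rho> ((p ^^ i) x)"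
proof (induction i)
  case (Suc i)
  then have "\<rho> ((p ^^ i) x) \<le> \<rho> (p ((p ^^ i) x))"
    using tr unfolding trees_def by (metis less_imp_le order_refl)
  then show ?case using Suc tr by (auto simp: trees_def)
qed simp

text \<open>Each step towards the root raises \<open>\<rho>\<close>, which is bounded on the finite
  set \<open>V\<close>; the induction is on the remaining distance to its maximum.\<close>

lemma trees_root_path:
  assumes "x \<in> V"
  obtains l where "root_path p x l (R x)"
proof -
  have fin: "finite (\<rho> ` V)" using tr by (simp add: trees_def)
  have "\<exists>l. root_path p x l (R x)" using assms
  proof (induction "Max (\<rho> ` V) - \<rho> x" arbitrary: x rule: less_induct)
    case less
    show ?case
    proof (cases "p x = x")
      case True
      then show ?thesis using less.prems tr
        by (intro exI[of _ 0]) (auto simp: root_path_def trees_def)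
    next
      case False
      then have px: "p x \<in> V" "R (p x) = R x" "\<rho> x < \<rho> (p x)"
        using less.prems tr by (auto simp: trees_def)
      have "\<rho> (p x) \<le> Max (\<rho> ` V)" using px fin by auto
      then have "Max (\<rho> ` V) - \<rho> (p x) < Max (\<rho> ` V) - \<rho> x" using px by linarith
      then obtain l where l: "root_path p (p x) l (R x)"
        using less.hyps[of "p x"] px by auto
      have "root_path p x (Suc l) (R x)"
        unfolding root_path_def
      proof (intro conjI allI impI)
        fix i assume "i < Suc l"
        then show "p ((p ^^ i) x) \<noteq> (p ^^ i) x"
          using l False by (cases i) (auto simp: root_path_def funpow_swap1)
      qed (use l in \<open>auto simp: root_path_def funpow_swap1\<close>)
      then show ?thesis ..
    qed
  qed
  then show thesis using that by blast
qed

lemma trees_root: "x \<in> V \<Longrightarrow> R x \<in> V \<and> p (R x) = R x \<and> R (R x) = R x"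
  using trees_funpow tr unfolding trees_def
  by (metis root_path_def trees_root_path)

lemma trees_path_less:
  assumes "x \<in> V" "root_path p x l r" "i < j" "j \<le> l"
  shows "\<rho> ((p ^^ i) x) < \<rho> ((p ^^ j) x)"
  using assms(3,4)
proof (induction j)
  case (Suc j)
  have "\<rho> ((p ^^ j) x) < \<rho> ((p ^^ Suc j) x)"
    using assms(1,2) Suc.prems tr trees_funpow[of x j] by (simp add: trees_def root_path_def)
  then show ?case using Suc by (cases "i = j") auto
qed simp

lemma trees_path_inj:
  assumes "x \<in> V" "root_path p x l r"
  shows "inj_on (\<lambda>i. (p ^^ i) x) {..l}"
proof (rule inj_onI)
  fix i j assume "i \<in> {..l}" "j \<in> {..l}" "(p ^^ i) x = (p ^^ j) x"
  then show "i = j" using trees_path_less[OF assms, of i j] trees_path_less[OF assms, of j i]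
    by (cases i j rule: linorder_cases) auto
qed

lemma trees_path_rank_le:
  assumes "x \<in> V" "root_path p x l r" "i < j" "j \<le> l"
  shows "\<rho> (p ((p ^^ i) x)) \<le> \<rho> ((p ^^ j) x)"
proof (cases "j = Suc i")
  case False
  then show ?thesis using trees_path_less[OF assms(1,2), of "Suc i" j] assms by simp
qed simp

text \<open>The root outranks every vertex of the path, so redirecting them to it keeps
  \<open>\<rho>\<close> increasing and \<open>\<rho>\<close> itself need not change.\<close>

lemma trees_compress:
  assumes "x \<in> V" "root_path p x l (R x)"
  shows "trees V (compress p x l (R x)) \<rho> R"
  unfolding trees_def
proof (intro conjI ballI)
  show "finite V" using tr by (simp add: trees_def)
  fix z assume z: "z \<in> V"
  let ?P = "(\<lambda>i. (p ^^ i) x) ` {..<l}"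
  have P: "R z = R x \<and> z \<noteq> R x \<and> \<rho> z < \<rho> (R x)" if zP: "z \<in> ?P"
  proof -
    obtain i where i: "i < l" "z = (p ^^ i) x" using zP by auto
    then have "\<rho> z < \<rho> (R x)"
      using trees_path_less[OF assms, of i l] assms(2) by (simp add: root_path_def)
    then show ?thesis using i trees_funpow[OF assms(1), of i] by auto
  qed
  show "compress p x l (R x) z \<in> V" "R (compress p x l (R x) z) = R z"
    "compress p x l (R x) z = z \<longrightarrow> R z = z"
    "compress p x l (R x) z \<noteq> z \<longrightarrow> \<rho> z < \<rho> (compress p x l (R x) z)"
    using tr z P trees_root[OF assms(1)] by (auto simp: compress_def trees_def)
qed

text \<open>Amortised cost of compression in a fixed forest; the potential is the number of elements whose
  parent is not a root.\<close>

lemma compress_deep: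
  assumes "x \<in> V" "root_path p x l (R x)"
  defines "p' \<equiv> compress p x l (R x)"
  shows "l + card {z \<in> V. p' (p' z) \<noteq> p' z} \<le> card {z \<in> V. p (p z) \<noteq> p z} + 1"
proof -
  have fin: "finite V" using tr by (simp add: trees_def)
  \<comment> \<open>The last vertex before the root has a root as its parent already. Only the
    \<open>l - 1\<close> vertices before it stop counting, whence the \<open>+ 1\<close> in the
    bound.\<close>
  let ?P = "(\<lambda>i. (p ^^ i) x) ` {..<l - 1}"
  have root: "p (R x) = R x" using assms(2) by (simp add: root_path_def)
  have RnP: "R x \<notin> (\<lambda>i. (p ^^ i) x) ` {..<l}"
    using assms(2) by (auto simp: root_path_def)
  then have p'R: "p' (R x) = R x" using root by (simp add: p'_def compress_def)
  have sub: "?P \<subseteq> {z \<in> V. p (p z) \<noteq> p z}"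
  proof
    fix z assume "z \<in> ?P"
    then obtain i where i: "i < l - 1" "z = (p ^^ i) x" by auto
    then have "p ((p ^^ Suc i) x) \<noteq> (p ^^ Suc i) x"
      using assms(2) unfolding root_path_def by (metis less_diff_conv Suc_eq_plus1)
    then show "z \<in> {z \<in> V. p (p z) \<noteq> p z}" using i trees_funpow[OF assms(1)] by auto
  qed
  have "{z \<in> V. p' (p' z) \<noteq> p' z} \<subseteq> {z \<in> V. p (p z) \<noteq> p z} - ?P"
  proof
    fix z assume "z \<in> {z \<in> V. p' (p' z) \<noteq> p' z}"
    then have z: "z \<in> V" "p' (p' z) \<noteq> p' z" by auto
    have nP: "z \<notin> (\<lambda>i. (p ^^ i) x) ` {..<l}"
    proof
      assume "z \<in> (\<lambda>i. (p ^^ i) x) ` {..<l}"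
      then have "p' z = R x" by (simp add: p'_def compress_def)
      then show False using z p'R by simp
    qed
    then have "p' z = p z" by (simp add: p'_def compress_def)
    then have "p' (p z) \<noteq> p z" using z by simp
    then have "p (p z) \<noteq> p z"
      using assms(2) by (auto simp: p'_def compress_def root_path_def split: if_splits)
    then show "z \<in> {z \<in> V. p (p z) \<noteq> p z} - ?P" using z nP by auto
  qed
  then have "card {z \<in> V. p' (p' z) \<noteq> p' z} \<le> card ({z \<in> V. p (p z) \<noteq> p z} - ?P)"
    using fin by (intro card_mono) auto
  also have "\<dots> = card {z \<in> V. p (p z) \<noteq> p z} - card ?P"
    using sub by (intro card_Diff_subset) auto
  also have "card ?P = l - 1"
    by (subst card_image) (auto intro: inj_on_subset[OF trees_path_inj[OF assms(1,2)]])
  finally have "card {z \<in> V. p' (p' z) \<noteq> p' z} \<le> card {z \<in> V. p (p z) \<noteq> p z} - (l - 1)" .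
  moreover have "card ?P \<le> card {z \<in> V. p (p z) \<noteq> p z}" using fin by (intro card_mono sub) auto
  ultimately show ?thesis using \<open>card ?P = l - 1\<close> by linarith
qed

end

section \<open>The amortised cost of finding roots\<close>

text \<open>Tarjan's fast-growing functions from the analysis of union-find. Starting from
  \<open>r\<close>, the next level is reached after \<open>r + 1\<close> iterations, which matches
  the indices \<open>i \<le> r\<close> counted by \<open>pot\<close>.\<close>

primrec tarjan :: "nat \<Rightarrow> nat \<Rightarrow> nat" where
  "tarjan 0 = Suc"
| "tarjan (Suc k) = (\<lambda>j. (tarjan k ^^ Suc j) j)"

declare tarjan.simps(2) [simp del]

section \<open>Monotonicity of iterates and of the hierarchy\<close>

lemma funpow_increasing:
  fixes f :: "nat \<Rightarrow> nat"
  assumes "\<And>x. x < f x"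
  shows "x + i \<le> (f ^^ i) x"
proof (induction i)
  case (Suc i)
  then show ?case using assms[of "(f ^^ i) x"] by simp
qed simp

lemma funpow_le_funpow:
  fixes f :: "nat \<Rightarrow> nat"
  assumes "\<And>x. x < f x" "mono f" "i \<le> j" "x \<le> y"
  shows "(f ^^ i) x \<le> (f ^^ j) y"
proof -
  have "(f ^^ i) x \<le> (f ^^ i) y" using assms by (simp add: funpow_mono)
  also have "\<dots> \<le> (f ^^ (j - i)) ((f ^^ i) y)"
    using funpow_increasing[OF assms(1)] by (meson add_leD1)
  also have "\<dots> = (f ^^ j) y" using assms(3) by (metis comp_apply funpow_add le_add_diff_inverse2)
  finally show ?thesis .
qed

lemma tarjan_greater: "j < tarjan k j"
proof (induction k arbitrary: j)
  case (Suc k)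
  have "j + Suc j \<le> (tarjan k ^^ Suc j) j" by (rule funpow_increasing) (rule Suc)
  then show ?case by (simp add: tarjan.simps(2) del: funpow.simps)
qed simp

lemma mono_tarjan: "mono (tarjan k)"
proof (induction k)
  case 0
  then show ?case by (simp add: mono_def)
next
  case (Suc k)
  show ?case
    unfolding tarjan.simps(2)
    by (rule monoI, rule funpow_le_funpow) (auto intro: tarjan_greater Suc)
qed

lemma tarjan_le_Suc: "tarjan k j \<le> tarjan (Suc k) j"
  using funpow_le_funpow[OF tarjan_greater mono_tarjan, of 1 "Suc j" j j k]
  by (simp add: tarjan.simps(2))

lemma tarjan_le: "k \<le> l \<Longrightarrow> i \<le> j \<Longrightarrow> tarjan k i \<le> tarjan l j"
proof (induction l rule: dec_induct)
  case base
  then show ?case using mono_tarjan by (simp add: mono_def)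
next
  case (step l)
  then show ?case using tarjan_le_Suc le_trans by blast
qed

section \<open>Comparison with the Ackermann function\<close>

lemma ack_positive: "0 < ack m n"
  by (induction m n rule: ack.induct) auto

lemma ack_greater: "n < ack m n"
proof (induction m n rule: ack.induct)
  case (3 m n)
  then show ?case by simp
qed auto

text \<open>Both families arise by iteration: \<open>ack (Suc m) j\<close> applies
  \<open>ack m\<close> to 1, and \<open>tarjan (Suc k) j\<close> applies \<open>tarjan k\<close> to
  \<open>j\<close>, each \<open>j + 1\<close> times. Only \<open>j = 0\<close> gives the second a
  worse start, and values of \<open>ack\<close> are positive.\<close>

lemma ack_le_tarjan: "ack (Suc k) j \<le> (tarjan k ^^ Suc j) 1"
proof (induction k arbitrary: j)
  case 0
  show ?case by (induction j) auto
next
  case (Suc k)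
  have le: "ack (Suc k) j \<le> tarjan (Suc k) j" if "1 \<le> j" for j
    using Suc[of j] funpow_le_funpow[OF tarjan_greater mono_tarjan, of "Suc j" "Suc j" 1 j k] that
    unfolding tarjan.simps(2) by (meson le_trans order_refl)
  show ?case
  proof (induction j)
    case 0
    then show ?case using le[of 1] by simp
  next
    case (Suc j)
    have "ack (Suc (Suc k)) (Suc j) = ack (Suc k) (ack (Suc (Suc k)) j)" by simp
    also have "\<dots> \<le> tarjan (Suc k) (ack (Suc (Suc k)) j)"
      using le ack_positive[of "Suc (Suc k)" j] by simp
    also have "\<dots> \<le> tarjan (Suc k) ((tarjan (Suc k) ^^ Suc j) 1)"
      using Suc tarjan_le by blast
    finally show ?case by simp
  qed
qed

text \<open>The \<open>LEAST\<close> is attained because the diagonal satisfies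
  \<open>k < ack k k\<close>.\<close>

lemma inverse_ack_positive: "1 \<le> inverse_ack n"
  and le_ack_inverse_ack: "n \<le> ack (inverse_ack n) (inverse_ack n)"
proof -
  have "1 \<le> Suc n \<and> n \<le> ack (Suc n) (Suc n)"
    using ack_greater[of "Suc n" "Suc n"] by simp
  from LeastI[of "\<lambda>k. 1 \<le> k \<and> n \<le> ack k k", OF this]
  show "1 \<le> inverse_ack n" "n \<le> ack (inverse_ack n) (inverse_ack n)"
    by (auto simp: inverse_ack_def)
qed

lemma tarjan_one_greater: "Suc k < tarjan k 1"
proof (induction k)
  case (Suc k)
  have "tarjan k 1 < tarjan k (tarjan k 1)" by (rule tarjan_greater)
  also have "\<dots> = tarjan (Suc k) 1" by (simp add: tarjan.simps(2))
  finally show ?case using Suc by linarith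
qed simp

text \<open>Origin of the \<open>+ 2\<close>. For \<open>k = inverse_ack n\<close> one has
  \<open>n \<le> ack k k \<le> tarjan k k\<close>; two further levels lower the argument from
  \<open>k\<close> to 1, because \<open>tarjan (k + 1) 1\<close> already exceeds \<open>k\<close>.
  The argument 1 is the smallest rank.\<close>

lemma less_tarjan_inverse_ack: "n < tarjan (inverse_ack n + 2) 1"
proof -
  define k where "k = inverse_ack n"
  obtain k' where k': "k = Suc k'" using inverse_ack_positive[of n] by (cases k) (auto simp: k_def)
  have "n \<le> (tarjan k' ^^ Suc k) 1"
    using le_ack_inverse_ack[of n] ack_le_tarjan[of k' k] k' by (simp add: k_def)
  also have "\<dots> \<le> (tarjan k' ^^ Suc k) k"
    by (rule funpow_le_funpow[OF tarjan_greater mono_tarjan]) (auto simp: k')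
  also have "\<dots> = tarjan k k" by (simp add: k' tarjan.simps(2))
  also have "\<dots> \<le> tarjan k (tarjan (Suc k) 1)"
    using tarjan_one_greater[of "Suc k"] by (intro tarjan_le) auto
  also have "\<dots> < (tarjan k ^^ 2) (tarjan (Suc k) 1)"
    by (simp add: numeral_2_eq_2 tarjan_greater)
  also have "\<dots> \<le> (tarjan k ^^ Suc (tarjan (Suc k) 1)) (tarjan (Suc k) 1)"
    using tarjan_one_greater[of "Suc k"]
    by (intro funpow_le_funpow[OF tarjan_greater mono_tarjan]) auto
  also have "\<dots> = tarjan (Suc k) (tarjan (Suc k) 1)" by (simp add: tarjan.simps(2))
  also have "\<dots> = tarjan (Suc (Suc k)) 1" by (simp add: tarjan.simps(2)[of "Suc k"])
  finally show ?thesis by (simp add: k_def)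
qed

text \<open>The potential of an element of rank \<open>r\<close> whose parent has rank \<open>m\<close>; \<open>m = 0\<close> stands for
  a root.\<close>

definition pot :: "nat \<Rightarrow> nat \<Rightarrow> nat \<Rightarrow> nat" where
  "pot K r m = card {(a, i). a < K \<and> i \<le> r \<and> m < (tarjan a ^^ Suc i) r}"

definition potential :: "'v set \<Rightarrow> nat \<Rightarrow> ('v \<Rightarrow> 'v) \<Rightarrow> ('v \<Rightarrow> nat) \<Rightarrow> nat" where
  "potential V K p \<rho> = (\<Sum>x\<in>V. pot K (\<rho> x) (if p x = x then 0 else \<rho> (p x)))"

definition level :: "nat \<Rightarrow> nat \<Rightarrow> nat \<Rightarrow> nat" where
  "level K r m = Max {a. a < K \<and> tarjan a r \<le> m}"

section \<open>Levels and the drop of the potential\<close>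

lemma finite_pot: "finite {(a, i). a < K \<and> i \<le> r \<and> m < (tarjan a ^^ Suc i) (r :: nat)}"
  by (rule finite_subset[of _ "{..<K} \<times> {..r}"]) auto

lemma pot_antimono: "m \<le> m' \<Longrightarrow> pot K r m' \<le> pot K r m"
  unfolding pot_def by (rule card_mono[OF finite_pot]) auto

lemma pot_zero: "pot K r 0 = K * Suc r"
proof -
  have "0 < (tarjan a ^^ Suc i) r" for a i
    using tarjan_greater[of "(tarjan a ^^ i) r" a] by simp
  then have "{(a, i). a < K \<and> i \<le> r \<and> 0 < (tarjan a ^^ Suc i) r} = {..<K} \<times> {..r}" by auto
  then show ?thesis by (simp add: pot_def)
qed

text \<open>Writing the usual potential by level and index as a count of pairs turns a rise of the
  parent's rank into a set inclusion. Passing one more iterate removes the pair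
  \<open>(a, i)\<close>.\<close>

lemma pot_strict:
  assumes "a < K" "i \<le> r" "m < (tarjan a ^^ Suc i) r" "(tarjan a ^^ Suc i) r \<le> m'"
  shows "pot K r m' < pot K r m"
  unfolding pot_def
proof (rule psubset_card_mono[OF finite_pot])
  have "(a, i) \<in> {(a, i). a < K \<and> i \<le> r \<and> m < (tarjan a ^^ Suc i) r}"
    "(a, i) \<notin> {(a, i). a < K \<and> i \<le> r \<and> m' < (tarjan a ^^ Suc i) r}"
    using assms by auto
  moreover have "{(a, i). a < K \<and> i \<le> r \<and> m' < (tarjan a ^^ Suc i) r}
      \<subseteq> {(a, i). a < K \<and> i \<le> r \<and> m < (tarjan a ^^ Suc i) r}"
    using assms by auto
  ultimately show "{(a, i). a < K \<and> i \<le> r \<and> m' < (tarjan a ^^ Suc i) r}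
      \<subset> {(a, i). a < K \<and> i \<le> r \<and> m < (tarjan a ^^ Suc i) r}"
    by blast
qed

text \<open>The level \<open>a\<close> is maximal, so \<open>m\<close> lies below
  \<open>tarjan (Suc a) r\<close>, the \<open>(r + 1)\<close>-fold iterate of
  \<open>tarjan a\<close>; some iterate up to that one is the first to exceed \<open>m\<close>. If
  \<open>Suc a = K\<close>, the bound \<open>m < tarjan K 1\<close> takes over.\<close>

lemma level_iterate:
  assumes "1 \<le> r" "r < m" "m < tarjan K 1"
  shows "level K r m < K" and "tarjan (level K r m) r \<le> m"
    and "\<exists>i\<le>r. (tarjan (level K r m) ^^ i) r \<le> m \<and> m < (tarjan (level K r m) ^^ Suc i) r"
proof -
  let ?a = "level K r m" and ?S = "{a. a < K \<and> tarjan a r \<le> m}"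
  have "0 < K" using assms by (cases K) auto
  then have S: "0 \<in> ?S" "finite ?S" using assms by auto
  then have "?a \<in> ?S" unfolding level_def by (intro Max_in) auto
  then show a: "?a < K" "tarjan ?a r \<le> m" by auto
  have "m < tarjan (Suc ?a) r"
  proof (cases "Suc ?a < K")
    case True
    then have "Suc ?a \<notin> ?S" using Max_ge[OF S(2), of "Suc ?a"] unfolding level_def by linarith
    then show ?thesis using True by auto
  next
    case False
    then have "Suc ?a = K" using a by simp
    then show ?thesis using assms tarjan_le[of K K 1 r] by simp
  qed
  then have ex: "m < (tarjan ?a ^^ Suc r) r" by (simp add: tarjan.simps(2))
  define i where "i = (LEAST i. m < (tarjan ?a ^^ Suc i) r)"
  have "i \<le> r" unfolding i_def by (rule Least_le) (rule ex)
  moreover have "m < (tarjan ?a ^^ Suc i) r" unfolding i_def by (rule LeastI) (rule ex)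
  moreover have "(tarjan ?a ^^ i) r \<le> m"
  proof (cases i)
    case (Suc i')
    then have "\<not> m < (tarjan ?a ^^ Suc i') r"
      using not_less_Least[of i' "\<lambda>i. m < (tarjan ?a ^^ Suc i) r"] by (simp add: i_def)
    then show ?thesis using Suc by simp
  qed (use assms in simp)
  ultimately show "\<exists>i\<le>r. (tarjan ?a ^^ i) r \<le> m \<and> m < (tarjan ?a ^^ Suc i) r" by blast
qed

text \<open>On each level, only the topmost path element may keep its potential.\<close>

lemma compress_potential:
  assumes tr: "trees V p \<rho> R" and x: "x \<in> V" and path: "root_path p x l (R x)"
    and rank: "\<And>z. z \<in> V \<Longrightarrow> 1 \<le> \<rho> z \<and> \<rho> z < tarjan K 1"
  shows "l + potential V K (compress p x l (R x)) \<rho> \<le> potential V K p \<rho> + K"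
proof -
  define p' where "p' = compress p x l (R x)"
  define lev where "lev z = level K (\<rho> z) (\<rho> (p z))" for z
  define P where "P = (\<lambda>i. (p ^^ i) x) ` {..<l}"
  \<comment> \<open>\<open>N\<close> collects the path elements below another one of the same level.
    Each of them will lose potential and so pays for its step; the others have different levels, so
    there are at most \<open>K\<close> of them.\<close>
  define N where "N = {z \<in> P. \<exists>y\<in>P. \<rho> z < \<rho> y \<and> lev z = lev y}"
  let ?f = "\<lambda>z. pot K (\<rho> z) (if p z = z then 0 else \<rho> (p z))"
  let ?f' = "\<lambda>z. pot K (\<rho> z) (if p' z = z then 0 else \<rho> (p' z))"
  have fin: "finite V" using tr by (simp add: trees_def)
  have PV: "P \<subseteq> V" using trees_funpow[OF tr x] by (auto simp: P_def)
  have finP: "finite P" by (simp add: P_def)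
  have cardP: "card P = l"
    unfolding P_def
    by (subst card_image) (auto intro: inj_on_subset[OF trees_path_inj[OF tr x path]])
  have Rx: "R x = (p ^^ l) x" using path by (simp add: root_path_def)
  have up: "p z \<noteq> z \<and> \<rho> z < \<rho> (p z) \<and> \<rho> (p z) \<le> \<rho> (R x) \<and> p z \<in> V" if zP: "z \<in> P" for z
  proof -
    obtain i where i: "i < l" "z = (p ^^ i) x" using zP by (auto simp: P_def)
    then have "p z \<noteq> z" using path by (simp add: root_path_def)
    then show ?thesis
      using i tr PV zP trees_path_rank_le[OF tr x path, of i l] Rx by (auto simp: trees_def)
  qed
  have lev: "lev z < K" "tarjan (lev z) (\<rho> z) \<le> \<rho> (p z)"
    "\<exists>i\<le>\<rho> z. (tarjan (lev z) ^^ i) (\<rho> z) \<le> \<rho> (p z) \<and> \<rho> (p z) < (tarjan (lev z) ^^ Suc i) (\<rho> z)"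
    if "z \<in> P" for z
    using level_iterate[of "\<rho> z" "\<rho> (p z)" K] up[OF that] rank PV that
    unfolding lev_def by blast+
  have "inj_on lev (P - N)"
  proof (rule inj_onI)
    fix y z assume yz: "y \<in> P - N" "z \<in> P - N" "lev y = lev z"
    then have "\<not> \<rho> y < \<rho> z" "\<not> \<rho> z < \<rho> y" by (auto simp: N_def)
    then have "\<rho> y = \<rho> z" by simp
    moreover obtain i j where "i < l" "y = (p ^^ i) x" "j < l" "z = (p ^^ j) x"
      using yz by (auto simp: P_def)
    ultimately show "y = z"
      using trees_path_less[OF tr x path, of i j] trees_path_less[OF tr x path, of j i]
      by (cases i j rule: linorder_cases) auto
  qed
  moreover have "lev ` (P - N) \<subseteq> {..<K}" using lev by auto
  ultimately have "card (P - N) \<le> K" using card_inj_on_le[of lev "P - N" "{..<K}"] by simp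
  moreover have "card P = card N + card (P - N)"
    using card_Diff_subset[of N P] card_mono[of P N] finP finite_subset[of N P]
    by (auto simp: N_def)
  ultimately have l: "l \<le> card N + K" using cardP by simp
  have "?f' z + (if z \<in> N then 1 else 0) \<le> ?f z" if "z \<in> V" for z
  proof (cases "z \<in> P")
    case False
    then have "p' z = p z" "z \<notin> N" by (auto simp: p'_def compress_def P_def N_def)
    then show ?thesis by simp
  next
    case True
    then have p'z: "p' z = R x" by (simp add: p'_def compress_def P_def)
    have "R x \<noteq> z" using up[OF True] by auto
    show ?thesis
    proof (cases "z \<in> N")
      case False
      then show ?thesis using p'z up[OF True] pot_antimono \<open>R x \<noteq> z\<close> by auto
    next
      case zN: True
      then obtain y where y: "y \<in> P" "\<rho> z < \<rho> y" "lev z = lev y" by (auto simp: N_def)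
      obtain i j where ij: "i < l" "z = (p ^^ i) x" "j < l" "y = (p ^^ j) x"
        using True y by (auto simp: P_def)
      have "i < j"
        using y ij trees_path_less[OF tr x path, of j i] by (cases i j rule: linorder_cases) auto
      then have zy: "\<rho> (p z) \<le> \<rho> y" using trees_path_rank_le[OF tr x path, of i j] ij by auto
      obtain t where t: "t \<le> \<rho> z" "(tarjan (lev z) ^^ t) (\<rho> z) \<le> \<rho> (p z)"
        "\<rho> (p z) < (tarjan (lev z) ^^ Suc t) (\<rho> z)" using lev(3)[OF True] by auto
      \<comment> \<open>The parent of \<open>z\<close> ranks at most as high as \<open>y\<close>.
        One more application of the common level's function therefore stays below the rank of the
        parent of \<open>y\<close>, hence below that of the new parent \<open>R x\<close>.\<close>
      have "(tarjan (lev z) ^^ Suc t) (\<rho> z) = tarjan (lev z) ((tarjan (lev z) ^^ t) (\<rho> z))" by simp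
      also have "\<dots> \<le> tarjan (lev y) (\<rho> y)" using t zy y by (intro tarjan_le) auto
      also have "\<dots> \<le> \<rho> (R x)" using lev(2)[OF y(1)] up[OF y(1)] by linarith
      finally have "pot K (\<rho> z) (\<rho> (R x)) < pot K (\<rho> z) (\<rho> (p z))"
        using pot_strict lev(1)[OF True] t by blast
      then show ?thesis using p'z up[OF True] \<open>R x \<noteq> z\<close> by auto
    qed
  qed
  then have "(\<Sum>z\<in>V. ?f' z + (if z \<in> N then 1 else 0)) \<le> (\<Sum>z\<in>V. ?f z)" by (rule sum_mono)
  moreover have "(\<Sum>z\<in>V. if z \<in> N then 1 else 0) = card N"
  proof -
    have "V \<inter> N = N" using PV by (auto simp: N_def)
    then show ?thesis using fin by (simp add: sum.If_cases)
  qed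
  ultimately have "potential V K p' \<rho> + card N \<le> potential V K p \<rho>"
    unfolding potential_def by (simp add: sum.distrib)
  then show ?thesis using l by (simp add: p'_def)
qed

text \<open>Only \<open>b\<close> gains: a root of rank \<open>r\<close> has potential
  \<open>K * Suc r\<close>, so raising the rank by one costs \<open>K\<close>. For all other
  elements the rank of the parent can only grow, a root counting as having a parent of rank
  0.\<close>

lemma link_potential:
  assumes "finite V" "a \<in> V" "b \<in> V" "a \<noteq> b" "p a = a" "p b = b" "\<rho> a \<le> \<rho> b"
  shows "potential V K (p(a := b)) (\<rho>(b := Suc (\<rho> b))) \<le> potential V K p \<rho> + K"
proof -
  let ?p = "p(a := b)" and ?\<rho> = "\<rho>(b := Suc (\<rho> b))"
  have "pot K (?\<rho> z) (if ?p z = z then 0 else ?\<rho> (?p z)) \<le>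
      pot K (\<rho> z) (if p z = z then 0 else \<rho> (p z)) + (if z = b then K else 0)" for z
    using assms by (auto simp: pot_zero[of K "\<rho> b"] pot_zero[of K "Suc (\<rho> b)"] intro: pot_antimono)
  then have "potential V K ?p ?\<rho> \<le>
      (\<Sum>z\<in>V. pot K (\<rho> z) (if p z = z then 0 else \<rho> (p z)) + (if z = b then K else 0))"
    unfolding potential_def by (rule sum_mono)
  then show ?thesis using assms by (simp add: potential_def sum.distrib)
qed

text \<open>The rank of \<open>b\<close> is raised even if it was larger than that of
  \<open>a\<close> before. Ranks are then bounded by the number of links, and a bound below the
  number of vertices is all that the potential requires.\<close>

lemma trees_link:
  assumes "trees V p \<rho> R" "a \<in> V" "b \<in> V" "a \<noteq> b" "p a = a" "p b = b" "\<rho> a \<le> \<rho> b"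
  shows "trees V (p(a := b)) (\<rho>(b := Suc (\<rho> b))) (\<lambda>z. if R z = a then b else R z)"
  unfolding trees_def
proof (intro conjI ballI)
  show "finite V" using assms(1) by (simp add: trees_def)
  fix z assume "z \<in> V"
  then have z: "p z \<in> V" "R (p z) = R z" "p z = z \<Longrightarrow> R z = z" "p z \<noteq> z \<Longrightarrow> \<rho> z < \<rho> (p z)"
    using assms(1) by (auto simp: trees_def)
  have R: "R a = a" "R b = b" using assms by (auto simp: trees_def)
  show "(p(a := b)) z \<in> V" using z assms by simp
  show "(if R ((p(a := b)) z) = a then b else R ((p(a := b)) z)) = (if R z = a then b else R z)"
    using z R assms(4) by auto
  show "(p(a := b)) z = z \<longrightarrow> (if R z = a then b else R z) = z"
    using z assms(4) by auto
  show "(p(a := b)) z \<noteq> z \<longrightarrow> (\<rho>(b := Suc (\<rho> b))) z < (\<rho>(b := Suc (\<rho> b))) ((p(a := b)) z)"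
    using z assms by (auto simp: less_SucI)
qed

section \<open>Forests and minimum spanning trees\<close>

definition conn :: "'v set set \<Rightarrow> ('v \<times> 'v) set" where
  "conn E = {(x, y). {x, y} \<in> E}\<^sup>*"

lemma conn_refl [simp]: "(x, x) \<in> conn E"
  by (simp add: conn_def)

lemma conn_edge: "{x, y} \<in> E \<Longrightarrow> (x, y) \<in> conn E"
  by (auto simp: conn_def)

lemma conn_trans: "(x, y) \<in> conn E \<Longrightarrow> (y, z) \<in> conn E \<Longrightarrow> (x, z) \<in> conn E"
  by (auto simp: conn_def)

lemma conn_sym: "(x, y) \<in> conn E \<Longrightarrow> (y, x) \<in> conn E"
proof -
  have "sym {(x, y). {x, y} \<in> E}"
    by (auto simp: sym_def insert_commute)
  then show "(x, y) \<in> conn E \<Longrightarrow> (y, x) \<in> conn E"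
    unfolding conn_def by (meson sym_rtrancl symD)
qed

lemma conn_mono: "E \<subseteq> F \<Longrightarrow> conn E \<subseteq> conn F"
  unfolding conn_def by (rule rtrancl_mono) auto

lemma conn_subset:
  assumes "(a, b) \<in> conn E" and "\<And>x y. {x, y} \<in> E \<Longrightarrow> (x, y) \<in> conn F"
  shows "(a, b) \<in> conn F"
  using assms(1)[unfolded conn_def]
  by (induction rule: rtrancl_induct) (auto intro: conn_trans assms(2))

lemma conn_insertD:
  assumes "(a, b) \<in> conn (insert {x, y} F)"
  shows "(a, b) \<in> conn F \<or> (a, x) \<in> conn F \<and> (y, b) \<in> conn F \<or> (a, y) \<in> conn F \<and> (x, b) \<in> conn F"
  using assms[unfolded conn_def]
proof (induction rule: rtrancl_induct)
  case base
  then show ?case by simp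
next
  case (step b c)
  show ?case
  proof (cases "{b, c} \<in> F")
    case True
    then show ?thesis using step.IH conn_edge conn_trans by metis
  next
    case False
    then have "{b, c} = {x, y}" using step.hyps by auto
    then have "b = x \<and> c = y \<or> b = y \<and> c = x" by (auto simp: doubleton_eq_iff)
    then show ?thesis using step.IH by (metis conn_refl)
  qed
qed

lemma conn_insert_iff:
  "(a, b) \<in> conn (insert {x, y} F) \<longleftrightarrow>
   (a, b) \<in> conn F \<or> (a, x) \<in> conn F \<and> (y, b) \<in> conn F \<or> (a, y) \<in> conn F \<and> (x, b) \<in> conn F"
proof -
  have "conn F \<subseteq> conn (insert {x, y} F)" by (rule conn_mono) auto
  moreover have "(x, y) \<in> conn (insert {x, y} F)" by (rule conn_edge) simp
  ultimately show ?thesis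
    by (meson conn_insertD conn_sym conn_trans subsetD)
qed

section \<open>Counting connected components\<close>

definition classes :: "'v set \<Rightarrow> 'v set set \<Rightarrow> 'v set set" where
  "classes V E = (\<lambda>x. conn E `` {x}) ` V"

lemma conn_Image_eq_iff: "conn E `` {x} = conn E `` {y} \<longleftrightarrow> (x, y) \<in> conn E"
proof
  assume "conn E `` {x} = conn E `` {y}"
  then show "(x, y) \<in> conn E" using conn_refl by fastforce
next
  assume "(x, y) \<in> conn E"
  then show "conn E `` {x} = conn E `` {y}"
    by (auto intro: conn_trans conn_sym)
qed

lemma card_classes_insert:
  assumes "finite V" "x \<in> V" "y \<in> V"
  shows "(x, y) \<in> conn E \<Longrightarrow> card (classes V (insert {x, y} E)) = card (classes V E)"
    and "(x, y) \<notin> conn E \<Longrightarrow> Suc (card (classes V (insert {x, y} E))) = card (classes V E)"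
proof -
  let ?X = "conn E `` {x}" and ?Y = "conn E `` {y}"
  show "card (classes V (insert {x, y} E)) = card (classes V E)" if "(x, y) \<in> conn E"
  proof -
    have "conn (insert {x, y} E) = conn E"
      using that unfolding set_eq_iff split_paired_All conn_insert_iff
      by (meson conn_trans conn_sym)
    then show ?thesis by (simp add: classes_def)
  qed
  show "Suc (card (classes V (insert {x, y} E))) = card (classes V E)" if n: "(x, y) \<notin> conn E"
  proof -
    have img: "conn (insert {x, y} E) `` {z} =
        (if z \<in> ?X \<union> ?Y then ?X \<union> ?Y else conn E `` {z})" for z
      by (auto simp: conn_insert_iff) (meson conn_trans conn_sym)+
    have "classes V (insert {x, y} E) = insert (?X \<union> ?Y) (classes V E - {?X, ?Y})"
    proof (intro equalityI subsetI)
      fix C assume "C \<in> classes V (insert {x, y} E)"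
      then obtain z where z: "z \<in> V" "C = conn (insert {x, y} E) `` {z}"
        by (auto simp: classes_def)
      show "C \<in> insert (?X \<union> ?Y) (classes V E - {?X, ?Y})"
      proof (cases "z \<in> ?X \<union> ?Y")
        case True
        then show ?thesis using z img by simp
      next
        case False
        then have "C = conn E `` {z}" using z img by simp
        moreover have "conn E `` {z} \<noteq> ?X" "conn E `` {z} \<noteq> ?Y"
          unfolding conn_Image_eq_iff using False by (auto dest: conn_sym)
        ultimately show ?thesis using z by (auto simp: classes_def)
      qed
    next
      fix C assume "C \<in> insert (?X \<union> ?Y) (classes V E - {?X, ?Y})"
      then consider "C = ?X \<union> ?Y" | "C \<in> classes V E" "C \<noteq> ?X" "C \<noteq> ?Y" by auto
      then show "C \<in> classes V (insert {x, y} E)"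
      proof cases
        case 1
        then have "C = conn (insert {x, y} E) `` {x}" unfolding img by simp
        then show ?thesis using assms by (auto simp: classes_def)
      next
        case 2
        then obtain z where z: "z \<in> V" "C = conn E `` {z}" by (auto simp: classes_def)
        then have "z \<notin> ?X \<union> ?Y"
          using 2 unfolding z conn_Image_eq_iff by (auto dest: conn_sym)
        then have "C = conn (insert {x, y} E) `` {z}" using img z by simp
        then show ?thesis using z by (auto simp: classes_def)
      qed
    qed
    moreover have "?X \<union> ?Y \<notin> classes V E"
    proof
      assume "?X \<union> ?Y \<in> classes V E"
      then obtain z where z: "?X \<union> ?Y = conn E `` {z}" by (auto simp: classes_def)
      have "x \<in> ?X \<union> ?Y" "y \<in> ?X \<union> ?Y" by auto
      then have "(z, x) \<in> conn E" "(z, y) \<in> conn E" unfolding z by auto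
      then show False using n conn_sym conn_trans by metis
    qed
    moreover have "finite (classes V E)" "?X \<in> classes V E" "?Y \<in> classes V E" "?X \<noteq> ?Y"
      using assms n by (auto simp: classes_def conn_Image_eq_iff)
    \<comment> \<open>Two classes are removed and one is added; the subtraction of 2 takes place in
      the naturals.\<close>
    moreover have "2 \<le> card (classes V E)"
      using calculation card_mono[of "classes V E" "{?X, ?Y}"] by auto
    ultimately show ?thesis
      by (simp add: card_Diff_subset)
  qed
qed

lemma finite_pairs: "finite X \<Longrightarrow> finite Y \<Longrightarrow> finite (pairs X Y)"
proof -
  have "pairs X Y = (\<lambda>(x, y). {x, y}) ` (X \<times> Y)" by (auto simp: pairs_def)
  then show "finite X \<Longrightarrow> finite Y \<Longrightarrow> finite (pairs X Y)" by simp
qed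

text \<open>Starting from singletons, each edge lowers the number of classes by at most one.\<close>

lemma card_le_card_edges_classes:
  assumes "finite V" "E \<subseteq> pairs V V"
  shows "card V \<le> card E + card (classes V E)"
proof -
  have "finite E" using assms finite_pairs finite_subset by blast
  then show ?thesis using assms(2)
  proof (induction E rule: finite_induct)
    case empty
    have "inj_on (\<lambda>x. conn {} `` {x}) V"
      by (auto simp: inj_on_def conn_Image_eq_iff) (simp add: conn_def)
    then have "card (classes V {}) = card V" unfolding classes_def by (rule card_image)
    then show ?case by simp
  next
    case (insert e E)
    then obtain x y where e: "e = {x, y}" "x \<in> V" "y \<in> V" by (auto simp: pairs_def)
    have "card (classes V E) \<le> Suc (card (classes V (insert e E)))"
      using card_classes_insert[OF assms(1) e(2,3), of E] e(1) by (cases "(x, y) \<in> conn E") auto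
    then show ?case using insert by simp
  qed
qed

text \<open>Every edge is a bridge. This form suits the insertion of edges one at a time; it
  excludes loops because \<open>(x, x)\<close> is always in \<open>conn\<close>.\<close>

definition acyclic_edges :: "'v set set \<Rightarrow> bool" where
  "acyclic_edges F \<longleftrightarrow> (\<forall>x y. {x, y} \<in> F \<longrightarrow> (x, y) \<notin> conn (F - {{x, y}}))"

lemma acyclic_edges_subset:
  assumes "acyclic_edges F" "E \<subseteq> F"
  shows "acyclic_edges E"
proof -
  have "conn (E - {e}) \<subseteq> conn (F - {e})" for e
    by (rule conn_mono) (use assms in auto)
  then show ?thesis using assms unfolding acyclic_edges_def by blast
qed

text \<open>If the ends of an old edge \<open>{a, b}\<close> stayed connected without it by way of
  \<open>{x, y}\<close>, then \<open>x\<close> and \<open>y\<close> would be connected in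
  \<open>F\<close> by way of \<open>{a, b}\<close>.\<close>

lemma acyclic_edges_insert:
  assumes "acyclic_edges F" "(x, y) \<notin> conn F"
  shows "acyclic_edges (insert {x, y} F)"
  unfolding acyclic_edges_def
proof (intro allI impI)
  fix a b assume ab: "{a, b} \<in> insert {x, y} F"
  show "(a, b) \<notin> conn (insert {x, y} F - {{a, b}})"
  proof (cases "{a, b} = {x, y}")
    case True
    have "insert {x, y} F - {{a, b}} \<subseteq> F" using True by auto
    then have "(a, b) \<in> conn (insert {x, y} F - {{a, b}}) \<Longrightarrow> (a, b) \<in> conn F"
      using conn_mono by blast
    moreover have "(a, b) \<notin> conn F"
      using True assms(2) conn_sym by (metis doubleton_eq_iff)
    ultimately show ?thesis by blast
  next
    case False
    then have F: "{a, b} \<in> F" using ab by simp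
    have eq: "insert {x, y} F - {{a, b}} = insert {x, y} (F - {{a, b}})" using False by auto
    have sub: "conn (F - {{a, b}}) \<subseteq> conn F" by (rule conn_mono) auto
    have "(a, b) \<in> conn F" "(a, b) \<notin> conn (F - {{a, b}})"
      using F conn_edge assms(1) by (auto simp: acyclic_edges_def)
    then show ?thesis
      unfolding eq conn_insert_iff using sub assms(2) conn_sym conn_trans by (metis subsetD)
  qed
qed

lemma acyclic_edges_card:
  assumes "finite V" "F \<subseteq> pairs V V" "acyclic_edges F"
  shows "card F + card (classes V F) \<le> card V"
proof -
  have "finite F" using assms finite_pairs finite_subset by blast
  then show ?thesis using assms(2,3)
  proof (induction F rule: finite_induct)
    case empty
    then show ?case by (auto simp: classes_def assms(1) intro: card_image_le)
  next
    case (insert e F)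
    then obtain x y where e: "e = {x, y}" "x \<in> V" "y \<in> V" by (auto simp: pairs_def)
    have "insert e F - {{x, y}} = F" using insert.hyps e by auto
    then have "(x, y) \<notin> conn F" using insert.prems e unfolding acyclic_edges_def by auto
    then have "Suc (card (classes V (insert e F))) = card (classes V F)"
      using card_classes_insert(2)[OF assms(1) e(2,3)] e by simp
    moreover have "acyclic_edges F" by (rule acyclic_edges_subset[OF insert.prems(2)]) auto
    ultimately show ?case using insert by simp
  qed
qed

lemma acyclic_edges_card_less:
  assumes "finite V" "F \<subseteq> pairs V V" "acyclic_edges F" "V \<noteq> {}"
  shows "card F < card V"
proof -
  have "classes V F \<noteq> {}" "finite (classes V F)" using assms by (auto simp: classes_def)
  then have "0 < card (classes V F)" by (simp add: card_gt_0_iff)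
  then show ?thesis using acyclic_edges_card[OF assms(1-3)] by linarith
qed

lemma classes_anti_mono:
  assumes "finite V" "conn F \<subseteq> conn E"
  shows "card (classes V E) \<le> card (classes V F)"
proof -
  have "classes V E = (\<lambda>C. conn E `` C) ` classes V F"
    unfolding classes_def image_image
  proof (rule image_cong[OF refl])
    fix x
    show "conn E `` {x} = conn E `` (conn F `` {x})"
      using assms(2) by (auto intro: conn_trans dest: subsetD)
  qed
  then show ?thesis using assms(1) by (simp add: card_image_le classes_def)
qed

text \<open>With \<open>c\<close> counting classes,
  \<open>|F| \<le> |V| - c(F) \<le> |V| - c(E) \<le> |E|\<close>: an edge of a forest always merges
  two classes, an edge of any graph at most two, and every class of \<open>E\<close> is a union of
  classes of \<open>F\<close>.\<close>

lemma acyclic_edges_card_le: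
  assumes "finite V" "F \<subseteq> pairs V V" "acyclic_edges F" "E \<subseteq> pairs V V"
    and "\<And>x y. {x, y} \<in> F \<Longrightarrow> (x, y) \<in> conn E"
  shows "card F \<le> card E"
proof -
  have "conn F \<subseteq> conn E" using conn_subset[OF _ assms(5)] by auto
  then show ?thesis
    using classes_anti_mono[OF assms(1), of F E] acyclic_edges_card[OF assms(1-3)]
      card_le_card_edges_classes[OF assms(1,4)] by linarith
qed

section \<open>Bridges and cycles\<close>

lemma rtrancl_simple_path:
  assumes "(x, y) \<in> r\<^sup>*"
  obtains vs where "vs \<noteq> []" "hd vs = x" "last vs = y" "distinct vs"
    "successively (\<lambda>a b. (a, b) \<in> r) vs"
proof -
  have "\<exists>vs. vs \<noteq> [] \<and> hd vs = x \<and> last vs = y \<and> distinct vs \<and> successively (\<lambda>a b. (a, b) \<in> r) vs"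
    using assms
  proof (induction rule: converse_rtrancl_induct)
    case base
    show ?case by (rule exI[of _ "[y]"]) simp
  next
    case (step x z)
    then obtain vs where vs: "vs \<noteq> []" "hd vs = z" "last vs = y" "distinct vs"
      "successively (\<lambda>a b. (a, b) \<in> r) vs" by blast
    show ?case
    proof (cases "x \<in> set vs")
      case True
      then obtain as bs where "vs = as @ x # bs" by (meson split_list)
      then show ?thesis using vs
        by (intro exI[of _ "x # bs"]) (auto simp: successively_append_iff)
    next
      case False
      then show ?thesis using vs step.hyps
        by (intro exI[of _ "x # vs"]) (cases vs, auto)
    qed
  qed
  then show ?thesis using that by blast
qed

text \<open>The closing edge of a cycle is no bridge, since the rest of the cycle joins its ends.
  Conversely, a simple path that avoids an edge between its ends is closed to a cycle by this
  edge.\<close>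

lemma acyclic_edges_iff: "acyclic_edges F \<longleftrightarrow> (\<nexists>vs. graph_cycle F vs)"
proof
  assume F: "acyclic_edges F"
  show "\<nexists>vs. graph_cycle F vs"
  proof
    assume "\<exists>vs. graph_cycle F vs"
    then obtain vs where vs: "vs \<noteq> []" "length vs \<noteq> 2" "distinct vs"
      and E: "\<And>i. i < length vs \<Longrightarrow> {vs ! i, vs ! (Suc i mod length vs)} \<in> F"
      by (auto simp: graph_cycle_def)
    let ?l = "length vs" and ?e = "{vs ! 0, vs ! (length vs - 1)}"
    have l: "0 < ?l" using vs by simp
    have e: "?e \<in> F" using E[of "?l - 1"] l by (simp add: insert_commute)
    have "i < ?l \<Longrightarrow> (vs ! 0, vs ! i) \<in> conn (F - {?e})" for i
    proof (induction i)
      case (Suc i)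
      have "{vs ! i, vs ! Suc i} \<in> F" using E[of i] Suc.prems by simp
      \<comment> \<open>Another edge of the cycle can coincide with the closing edge only if the
        list has length two.\<close>
      moreover have "{vs ! i, vs ! Suc i} \<noteq> ?e"
      proof
        assume "{vs ! i, vs ! Suc i} = ?e"
        then have "i = 0 \<and> Suc i = ?l - 1"
          using Suc.prems vs(3) l
          by (auto simp: doubleton_eq_iff nth_eq_iff_index_eq)
        then show False using vs(2) l by linarith
      qed
      ultimately have "(vs ! i, vs ! Suc i) \<in> conn (F - {?e})" by (intro conn_edge) auto
      then show ?case using Suc conn_trans by (metis Suc_lessD)
    qed simp
    from this[of "?l - 1"] show False using F e l unfolding acyclic_edges_def by auto
  qed
next
  assume nc: "\<nexists>vs. graph_cycle F vs"
  show "acyclic_edges F"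
    unfolding acyclic_edges_def
  proof (intro allI impI notI)
    fix x y assume xy: "{x, y} \<in> F" and "(x, y) \<in> conn (F - {{x, y}})"
    then obtain vs where vs: "vs \<noteq> []" "hd vs = x" "last vs = y" "distinct vs"
      and suc: "successively (\<lambda>a b. (a, b) \<in> {(a, b). {a, b} \<in> F - {{x, y}}}) vs"
      unfolding conn_def by (blast elim: rtrancl_simple_path)
    \<comment> \<open>A path on two vertices would consist of the removed edge itself.\<close>
    have "length vs \<noteq> 2"
    proof
      assume "length vs = 2"
      then obtain a b where "vs = [a, b]" by (auto simp: length_Suc_conv numeral_2_eq_2)
      then show False using vs suc by auto
    qed
    moreover have "{vs ! i, vs ! (Suc i mod length vs)} \<in> F" if i: "i < length vs" for i
    proof (cases "Suc i < length vs")
      case True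
      then show ?thesis using suc by (auto simp: successively_conv_nth)
    next
      case False
      then have "i = length vs - 1" "Suc i = length vs" using i by auto
      then have "vs ! i = y" "vs ! (Suc i mod length vs) = x"
        using vs by (auto simp: last_conv_nth hd_conv_nth)
      then show ?thesis using xy by (simp add: insert_commute)
    qed
    ultimately have "graph_cycle F vs" using vs by (auto simp: graph_cycle_def)
    then show False using nc by blast
  qed
qed

text \<open>A weight is the number of thresholds below it; exchanging the sums reduces the
  comparison of total weights to counting heavy edges at each threshold.\<close>

lemma sum_eq_sum_card_less:
  fixes w :: "'a \<Rightarrow> nat"
  assumes "finite T" "\<And>e. e \<in> T \<Longrightarrow> w e \<le> M"
  shows "sum w T = (\<Sum>W<M. card {e \<in> T. W < w e})"
proof -
  have "w e = (\<Sum>W<M. if W < w e then 1 else 0)" if "e \<in> T" for e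
  proof -
    have "{..<M} \<inter> {W. W < w e} = {..<w e}" using assms(2)[OF that] by auto
    then show ?thesis by (simp add: sum.If_cases)
  qed
  then have "sum w T = (\<Sum>e\<in>T. \<Sum>W<M. if W < w e then 1 else 0)" by (simp cong: sum.cong)
  also have "\<dots> = (\<Sum>W<M. \<Sum>e\<in>T. if W < w e then 1 else 0)" by (rule sum.swap)
  also have "\<dots> = (\<Sum>W<M. card {e \<in> T. W < w e})"
    using assms(1) by (simp add: sum.If_cases Int_def)
  finally show ?thesis .
qed

text \<open>Every spanning tree \<open>T'\<close> has at most as many edges of weight at most \<open>W\<close> as \<open>T\<close>, because
  these edges form a forest within the components of the light part of \<open>T\<close>.\<close>

lemma minimum_spanning_tree_if_bottleneck:
  assumes G: "weighted_graph G" and T: "spanning_tree G T"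
    and light: "\<And>x y. {x, y} \<in> edges G \<Longrightarrow>
      (x, y) \<in> conn {e \<in> T. weight G e \<le> weight G {x, y}}"
  shows "minimum_spanning_tree G T"
  unfolding minimum_spanning_tree_def
proof (intro conjI allI impI T)
  fix T' assume T': "spanning_tree G T'"
  let ?V = "verts G" and ?w = "weight G"
  have V: "finite ?V" and EV: "edges G \<subseteq> pairs ?V ?V"
    using G by (auto simp: weighted_graph_def)
  have fE: "finite (edges G)" using V EV finite_pairs finite_subset by blast
  have sub: "T \<subseteq> edges G" "T' \<subseteq> edges G" "acyclic_edges T" "acyclic_edges T'"
    using T T' by (auto simp: spanning_tree_def acyclic_edges_iff)
  have fin: "finite T" "finite T'" using sub fE finite_subset by auto
  have T'conn: "(x, y) \<in> conn T'" if "x \<in> ?V" "y \<in> ?V" for x y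
    using T' that by (auto simp: spanning_tree_def graph_connected_def conn_def)
  have card_eq: "card T \<le> card T'"
  proof (rule acyclic_edges_card_le[OF V])
    show "(x, y) \<in> conn T'" if "{x, y} \<in> T" for x y
    proof -
      have "{x, y} \<in> pairs ?V ?V" using that sub EV by auto
      then show ?thesis using T'conn by (auto simp: pairs_def doubleton_eq_iff)
    qed
  qed (use sub EV in auto)
  have le: "card {e \<in> T'. ?w e \<le> W} \<le> card {e \<in> T. ?w e \<le> W}" for W
  proof (rule acyclic_edges_card_le[OF V])
    show "(x, y) \<in> conn {e \<in> T. ?w e \<le> W}" if "{x, y} \<in> {e \<in> T'. ?w e \<le> W}" for x y
    proof -
      have "(x, y) \<in> conn {e \<in> T. ?w e \<le> ?w {x, y}}" using that sub light by auto
      moreover have "{e \<in> T. ?w e \<le> ?w {x, y}} \<subseteq> {e \<in> T. ?w e \<le> W}" using that by auto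
      ultimately show ?thesis using conn_mono by blast
    qed
    show "acyclic_edges {e \<in> T'. ?w e \<le> W}" by (rule acyclic_edges_subset[OF sub(4)]) auto
  qed (use sub EV in auto)
  have split: "card S = card {e \<in> S. ?w e \<le> W} + card {e \<in> S. W < ?w e}" if "finite S" for S W
  proof -
    have "card ({e \<in> S. ?w e \<le> W} \<union> {e \<in> S. W < ?w e}) =
        card {e \<in> S. ?w e \<le> W} + card {e \<in> S. W < ?w e}"
      using that by (intro card_Un_disjoint) auto
    moreover have "{e \<in> S. ?w e \<le> W} \<union> {e \<in> S. W < ?w e} = S" by auto
    ultimately show ?thesis by simp
  qed
  define M where "M = Max (?w ` edges G)"
  have M: "?w e \<le> M" if "e \<in> edges G" for e
    unfolding M_def using that fE by (intro Max_ge) auto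
  have "sum ?w T = (\<Sum>W<M. card {e \<in> T. W < ?w e})"
    using fin sub M by (intro sum_eq_sum_card_less) auto
  also have "\<dots> \<le> (\<Sum>W<M. card {e \<in> T'. W < ?w e})"
  proof (rule sum_mono)
    fix W
    \<comment> \<open>\<open>T\<close> has no more edges than \<open>T'\<close> and at least as many
      light ones, hence no more heavy ones.\<close>
    show "card {e \<in> T. W < ?w e} \<le> card {e \<in> T'. W < ?w e}"
      using split[OF fin(1), of W] split[OF fin(2), of W] le[of W] card_eq by linarith
  qed
  also have "\<dots> = sum ?w T'"
    using fin sub M by (intro sum_eq_sum_card_less[symmetric]) auto
  finally show "sum ?w T \<le> sum ?w T'" .
qed

section \<open>Programs\<close>

abbreviation var :: "string \<Rightarrow> aexp" where "var x \<equiv> Load x (Num 0)"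

abbreviation assign :: "string \<Rightarrow> aexp \<Rightarrow> com" (\<open>_ ::= _\<close> [1000, 61] 61) where
  "x ::= a \<equiv> Store x (Num 0) a"

abbreviation incr :: "string \<Rightarrow> com" where "incr x \<equiv> x ::= Plus (var x) (Num 1)"

abbreviation neq :: "aexp \<Rightarrow> aexp \<Rightarrow> bexp" where
  "neq a b \<equiv> Not (And (Not (Less a b)) (Not (Less b a)))"

notation Seq (infixr \<open>;;\<close> 60)

lemmas wp_simps = wp_Skip wp_Store wp_Seq wp_If

lemma All_less_Suc_iff: "(\<forall>i<Suc n. P i) \<longleftrightarrow> (\<forall>i<n. P i) \<and> P n"
  by (auto simp: less_Suc_eq)

lemma Ex_less_Suc_iff: "(\<exists>i<Suc n. P i) \<longleftrightarrow> (\<exists>i<n. P i) \<or> P n"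
  by (auto simp: less_Suc_eq)

subsection \<open>Finding a root\<close>

definition find_root :: "string \<Rightarrow> com" where
  "find_root X =
     ''fr'' ::= var ''fx'';;
     While (neq (Load X (var ''fr'')) (var ''fr'')) (''fr'' ::= Load X (var ''fr''));;
     While (neq (var ''fx'') (var ''fr''))
       (''ft'' ::= Load X (var ''fx'');; Store X (var ''fx'') (var ''fr'');; ''fx'' ::= var ''ft'')"

lemma writes_find [simp]: "writes (find_root X) = {''fr'', ''fx'', ''ft'', X}"
  by (auto simp: find_root_def)

lemma compress_0 [simp]: "compress p x 0 r = p"
  by (simp add: compress_def)

lemma compress_Suc: "(compress p x i r)((p ^^ i) x := r) = compress p x (Suc i) r"
  by (auto simp: compress_def lessThan_Suc)

lemma root_path_neq: "root_path p x l r \<Longrightarrow> i < l \<Longrightarrow> (p ^^ i) x \<noteq> r"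
  unfolding root_path_def by metis

text \<open>After a repetition the walk could be shortened and would reach \<open>r\<close> before
  step \<open>l\<close>. The argument needs no ranks, so the program can be specified by its path
  alone.\<close>

lemma root_path_distinct:
  assumes "root_path p x l r" "i < j" "j \<le> l"
  shows "(p ^^ i) x \<noteq> (p ^^ j) x"
proof
  assume eq: "(p ^^ i) x = (p ^^ j) x"
  have "(p ^^ (l - j + i)) x = (p ^^ (l - j)) ((p ^^ i) x)" by (simp add: funpow_add)
  also have "\<dots> = (p ^^ (l - j + j)) x" unfolding eq by (simp add: funpow_add)
  also have "\<dots> = r" using assms by (simp add: root_path_def)
  finally show False using root_path_neq[OF assms(1), of "l - j + i"] assms by linarith
qed

lemma wp_find:
  assumes path: "root_path (s X) (s ''fx'' 0) l r" and X: "X \<notin> {''fr'', ''fx'', ''ft''}"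
  shows "wp (find_root X) (\<lambda>k' s'. k' \<le> k + 60 * l + 60 \<and>
    s' X = compress (s X) (s ''fx'' 0) l r \<and> s' ''fr'' 0 = r) k s"
proof -
  let ?p = "s X" and ?x = "s ''fx'' 0"
  \<comment> \<open>One loop walks to the root and another redirects the path. Each costs at most 30
    per path vertex, whence the factor 60.\<close>
  let ?I = "\<lambda>k' s'. s' X = ?p \<and> s' ''fx'' 0 = ?x \<and>
    (\<exists>i\<le>l. s' ''fr'' 0 = (?p ^^ i) ?x \<and> k' \<le> k + 30 * i + 4)"
  let ?J = "\<lambda>k' s'. s' ''fr'' 0 = r \<and> (\<exists>i\<le>l. s' X = compress ?p ?x i r \<and>
    s' ''fx'' 0 = (?p ^^ i) ?x \<and> k' \<le> k + 30 * l + 30 * i + 30)"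
  have X': "X \<noteq> ''fr''" "X \<noteq> ''fx''" "X \<noteq> ''ft''" using X by auto
  show ?thesis
    unfolding find_root_def wp_Seq wp_Store
  proof (rule wp_While[where I = ?I and B = "k + 30 * l + 4"], goal_cases)
    case 1
    then show ?case using X' by (auto intro!: exI[of _ 0])
  next
    case (2 k2 s2)
    then show ?case by auto
  next
    case (3 k2 s2)
    then have s2: "s2 X = ?p" "s2 ''fx'' 0 = ?x" and b: "?p (s2 ''fr'' 0) \<noteq> s2 ''fr'' 0" by auto
    from 3 obtain i where i: "i \<le> l" "s2 ''fr'' 0 = (?p ^^ i) ?x" "k2 \<le> k + 30 * i + 4" by blast
    then have "i < l" using b path by (cases "i = l") (auto simp: root_path_def)
    then show ?case using i s2 X' by (auto simp: wp_simps intro!: exI[of _ "Suc i"])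
  next
    case (4 k2 s2)
    then have s2: "s2 X = ?p" "s2 ''fx'' 0 = ?x" and b: "?p (s2 ''fr'' 0) = s2 ''fr'' 0" by auto
    from 4 obtain i where i: "i \<le> l" "s2 ''fr'' 0 = (?p ^^ i) ?x" "k2 \<le> k + 30 * i + 4" by blast
    then have [simp]: "i = l" using b path by (cases "i < l") (auto simp: root_path_def)
    show ?case
    proof (rule wp_While[where I = ?J and B = "k + 60 * l + 30"], goal_cases)
      case 1
      then show ?case using i s2 path by (auto simp: root_path_def intro!: exI[of _ 0])
    next
      case (2 k3 s3)
      then show ?case by auto
    next
      case (3 k3 s3)
      then obtain i where i: "i \<le> l" "s3 ''fr'' 0 = r" "s3 X = compress ?p ?x i r"
        "s3 ''fx'' 0 = (?p ^^ i) ?x" "k3 \<le> k + 30 * l + 30 * i + 30" by blast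
      then have "i < l" using 3 path by (cases "i = l") (auto simp: root_path_def)
      \<comment> \<open>The vertex at position \<open>i\<close> still holds its old parent, being
        distinct from the \<open>i\<close> vertices that have been redirected.\<close>
      have "compress ?p ?x i r ((?p ^^ i) ?x) = ?p ((?p ^^ i) ?x)"
        using root_path_distinct[OF path] i(1) by (fastforce simp: compress_def)
      then show ?case using i X' \<open>i < l\<close>
        by (auto simp: wp_simps compress_Suc intro!: exI[of _ "Suc i"])
    next
      case (4 k3 s3)
      then obtain i where i: "i \<le> l" "s3 ''fr'' 0 = r" "s3 X = compress ?p ?x i r"
        "s3 ''fx'' 0 = (?p ^^ i) ?x" "k3 \<le> k + 30 * l + 30 * i + 30" by blast
      then have "i = l" using 4 root_path_neq[OF path, of i] by (cases "i < l") auto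
      then show ?case using i by auto
    qed
  qed
qed

subsection \<open>Linked lists\<close>

text \<open>The pointer \<open>Suc e\<close> refers to the cell \<open>e\<close>, and \<open>0\<close> is the null pointer.\<close>

fun linked :: "(nat \<Rightarrow> nat) \<Rightarrow> nat \<Rightarrow> nat list \<Rightarrow> bool" where
  "linked nx h [] \<longleftrightarrow> h = 0"
| "linked nx h (e # es) \<longleftrightarrow> h = Suc e \<and> linked nx (nx e) es"

lemma linked_fun_upd: "i \<notin> set es \<Longrightarrow> linked (nx(i := y)) h es = linked nx h es"
  by (induction es arbitrary: h) auto

lemma linked_pos:
  assumes "linked nx h es" "0 < h"
  obtains es' where "es = (h - 1) # es'" "linked nx (nx (h - 1)) es'"
  using assms by (cases es) auto

lemma linked_0: "linked nx 0 es \<longleftrightarrow> es = []"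
  by (cases es) auto

text \<open>The order is reversed because \<open>build\<close> prepends.\<close>

definition bucket :: "(nat \<Rightarrow> nat) \<Rightarrow> nat \<Rightarrow> nat \<Rightarrow> nat list" where
  "bucket key n w = rev (filter (\<lambda>i. key i = w) [0..<n])"

lemma set_bucket [simp]: "set (bucket key n w) = {i. i < n \<and> key i = w}"
  by (auto simp: bucket_def)

lemma bucket_0: "bucket key 0 w = []"
  by (simp add: bucket_def)

lemma bucket_Suc: "bucket key (Suc n) w = (if key n = w then n # bucket key n w else bucket key n w)"
  by (simp add: bucket_def)

lemma sum_length_bucket: "finite W \<Longrightarrow> (\<Sum>w\<in>W. length (bucket key n w)) \<le> n"
proof (induction n)
  case (Suc n)
  have "(\<Sum>w\<in>W. length (bucket key (Suc n) w)) =
      (\<Sum>w\<in>W. length (bucket key n w) + (if w = key n then 1 else 0))"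
    by (rule sum.cong) (auto simp: bucket_Suc)
  also have "\<dots> \<le> Suc n" using Suc by (auto simp: sum.distrib sum.delta)
  finally show ?case .
qed (simp add: bucket_def)

text \<open>The key is itself the address of a list head. Keys may be huge, but a cell costs time
  only when touched, and every head holds the null pointer beforehand.\<close>

definition build :: "string \<Rightarrow> string \<Rightarrow> string \<Rightarrow> string \<Rightarrow> com" where
  "build key n first nx =
     ''i'' ::= Num 0;;
     While (Less (var ''i'') (var n))
       (Store nx (var ''i'') (Load first (Load key (var ''i'')));;
        Store first (Load key (var ''i'')) (Plus (var ''i'') (Num 1));;
        incr ''i'')"

lemma wp_build:
  assumes dist: "distinct [''i'', key, n, first, nx]" and empty: "s first = (\<lambda>_. 0)"
  shows "wp (build key n first nx) (\<lambda>k' s'. k' \<le> k + 40 * s n 0 + 40 \<and>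
    (\<forall>w. linked (s' nx) (s' first w) (bucket (s key) (s n 0) w))) k s"
proof -
  let ?I = "\<lambda>k' s'. s' ''i'' 0 \<le> s n 0 \<and> k' \<le> k + 40 * s' ''i'' 0 + 4 \<and> s' key = s key \<and> s' n = s n \<and>
    (\<forall>w. linked (s' nx) (s' first w) (bucket (s key) (s' ''i'' 0) w))"
  show ?thesis
    unfolding build_def wp_Seq wp_Store
    by (rule wp_While[where I = ?I and B = "k + 40 * s n 0 + 4"])
      (use dist empty in \<open>auto simp: wp_simps bucket_Suc bucket_0 linked_fun_upd\<close>)
qed

subsection \<open>Half-edges sorted by weight\<close>

text \<open>Every compression edge occurs in both directions, because the cluster of either end has
  to be attached to the other end.\<close>

definition half_edges ::
  "nat \<Rightarrow> (nat \<Rightarrow> nat) \<Rightarrow> (nat \<Rightarrow> nat) \<Rightarrow> (nat \<Rightarrow> nat) \<Rightarrow> nat \<Rightarrow> (nat \<Rightarrow> nat) \<Rightarrow> (nat \<Rightarrow> nat) \<Rightarrow> (nat \<Rightarrow> nat) \<Rightarrow> bool"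
where
  "half_edges m u v w hn hu hv hw \<longleftrightarrow>
     (\<forall>t<hn. \<forall>t'\<le>t. hw t' \<le> hw t) \<and>
     (\<forall>t<hn. \<exists>e<m. hw t = w e \<and> (hu t = u e \<and> hv t = v e \<or> hu t = v e \<and> hv t = u e)) \<and>
     (\<forall>e<m. (\<exists>t<hn. hu t = u e \<and> hv t = v e \<and> hw t = w e) \<and>
            (\<exists>t<hn. hu t = v e \<and> hv t = u e \<and> hw t = w e))"

definition order_step :: com where
  "order_step =
     ''e'' ::= Minus (Load ''ehead'' (var ''w'')) (Num 1);;
     Store ''ehead'' (var ''w'') (Load ''enext'' (var ''e''));;
     Store ''hu'' (var ''hn'') (Load ''edge_fst'' (var ''e''));;
     Store ''hv'' (var ''hn'') (Load ''edge_snd'' (var ''e''));;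
     Store ''hw'' (var ''hn'') (var ''w'');;
     incr ''hn'';;
     Store ''hu'' (var ''hn'') (Load ''edge_snd'' (var ''e''));;
     Store ''hv'' (var ''hn'') (Load ''edge_fst'' (var ''e''));;
     Store ''hw'' (var ''hn'') (var ''w'');;
     incr ''hn''"

lemma writes_order_step: "writes order_step = {''e'', ''ehead'', ''hu'', ''hv'', ''hw'', ''hn''}"
  by (auto simp: order_step_def)

text \<open>The index \<open>j\<close> advances only when the list of the current weight is empty.
  Later positions with the same weight then find nothing, so there are at most \<open>m\<close> pops
  and \<open>m\<close> advances.\<close>

definition order :: com where
  "order =
     ''j'' ::= Num 0;;
     ''hn'' ::= Num 0;;
     While (Less (var ''j'') (var ''num_edges''))
       (''w'' ::= Load ''$data'' (var ''j'');;
        If (Less (Num 0) (Load ''ehead'' (var ''w''))) order_step (incr ''j''))"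

lemma wp_order_step:
  fixes s :: state
  defines "w \<equiv> s ''w'' 0" and "n \<equiv> s ''hn'' 0"
  defines "e \<equiv> s ''ehead'' w - 1"
  shows "wp order_step (\<lambda>k' s'. k' \<le> k + 80 \<and>
    s' ''ehead'' = (s ''ehead'')(w := s ''enext'' e) \<and> s' ''hn'' 0 = Suc (Suc n) \<and>
    s' ''hu'' = (s ''hu'')(n := s ''edge_fst'' e, Suc n := s ''edge_snd'' e) \<and>
    s' ''hv'' = (s ''hv'')(n := s ''edge_snd'' e, Suc n := s ''edge_fst'' e) \<and>
    s' ''hw'' = (s ''hw'')(n := w, Suc n := w)) k s"
  by (simp add: order_step_def wp_simps w_def n_def e_def)

lemma sum_length_tl:
  assumes "finite W" "w \<in> W" "L w \<noteq> []"
  shows "Suc (\<Sum>x\<in>W. length ((L(w := tl (L w))) x)) = (\<Sum>x\<in>W. length (L x))"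
proof -
  have "(\<Sum>x\<in>W - {w}. length ((L(w := tl (L w))) x)) = (\<Sum>x\<in>W - {w}. length (L x))"
    by (rule sum.cong) auto
  then show ?thesis
    using assms by (cases "L w") (simp_all add: sum.remove[of W w])
qed

lemma wp_order:
  assumes sorted: "\<And>i j. i \<le> j \<Longrightarrow> j < m \<Longrightarrow> s ''$data'' i \<le> s ''$data'' j"
    and data: "\<And>e. e < m \<Longrightarrow> \<exists>j<m. s ''$data'' j = s ''edge_weight'' e"
    and lists: "\<And>w. linked (s ''enext'') (s ''ehead'' w) (bucket (s ''edge_weight'') m w)"
    and m: "m = s ''num_edges'' 0"
  shows "wp order (\<lambda>k' s'. k' \<le> k + 400 * m + 40 \<and> s' ''hn'' 0 \<le> 2 * m \<and>
    half_edges m (s ''edge_fst'') (s ''edge_snd'') (s ''edge_weight'')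
      (s' ''hn'' 0) (s' ''hu'') (s' ''hv'') (s' ''hw'')) k s"
proof -
  let ?W = "s ''$data'' ` {..<m}" and ?data = "s ''$data''"
  let ?u = "s ''edge_fst''" and ?v = "s ''edge_snd''" and ?w = "s ''edge_weight''"
  define Data where "Data s' \<longleftrightarrow> s' ''num_edges'' 0 = m \<and> s' ''$data'' = ?data \<and>
    s' ''enext'' = s ''enext'' \<and> s' ''edge_fst'' = ?u \<and> s' ''edge_snd'' = ?v" for s' :: state
  define Lists where "Lists hd j L \<longleftrightarrow>
    (\<forall>w. linked (s ''enext'') (hd w) (L w) \<and> set (L w) \<subseteq> {e. e < m \<and> ?w e = w}) \<and>
    (\<forall>i<j. L (?data i) = [])" for hd :: "nat \<Rightarrow> nat" and j and L :: "nat \<Rightarrow> nat list"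
  \<comment> \<open>The comparison with all array entries from \<open>j\<close> on is what keeps the
    sequence sorted when the next half-edge is appended.\<close>
  define Half where "Half hn hu hv hw j L \<longleftrightarrow>
    (\<forall>t<hn. (\<forall>t'\<le>t. hw t' \<le> hw t) \<and> (\<forall>i<m. j \<le> i \<longrightarrow> hw t \<le> ?data i)) \<and>
    (\<forall>t<hn. \<exists>e<m. hw t = ?w e \<and> (hu t = ?u e \<and> hv t = ?v e \<or> hu t = ?v e \<and> hv t = ?u e)) \<and>
    (\<forall>e<m. e \<in> set (L (?w e)) \<or>
       (\<exists>t<hn. hu t = ?u e \<and> hv t = ?v e \<and> hw t = ?w e) \<and>
       (\<exists>t<hn. hu t = ?v e \<and> hv t = ?u e \<and> hw t = ?w e))"
    for hn :: nat and hu hv hw :: "nat \<Rightarrow> nat" and j and L :: "nat \<Rightarrow> nat list"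
  \<comment> \<open>A pop adds two half-edges and shortens a list; any other iteration advances
    \<open>j\<close>. The lists are summed over a set of weights, so that a repeated weight
    contributes only once.\<close>
  define Inv where "Inv k' s' L \<longleftrightarrow> Data s' \<and> s' ''j'' 0 \<le> m \<and>
    k' \<le> k + 50 * s' ''j'' 0 + 60 * s' ''hn'' 0 + 8 \<and>
    s' ''hn'' 0 + 2 * (\<Sum>w\<in>?W. length (L w)) \<le> 2 * m \<and>
    Lists (s' ''ehead'') (s' ''j'' 0) L \<and>
    Half (s' ''hn'' 0) (s' ''hu'') (s' ''hv'') (s' ''hw'') (s' ''j'' 0) L"
    for k' :: nat and s' :: state and L :: "nat \<Rightarrow> nat list"
  show ?thesis
    unfolding order_def wp_Seq wp_Store
  proof (rule wp_While[where I = "\<lambda>k s. \<exists>L. Inv k s L" and B = "k + 400 * m + 8"], goal_cases)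
    case 1
    show ?case
      using lists sum_length_bucket[of ?W ?w m] m
      by (intro exI[of _ "bucket ?w m"]) (simp add: Inv_def Data_def Lists_def Half_def)
  next
    case (2 k1 s1)
    then show ?case by (auto simp: Inv_def)
  next
    case (4 k1 s1)
    then obtain L where I: "Inv k1 s1 L" by blast
    then have j: "s1 ''j'' 0 = m" using 4 by (simp add: Inv_def Data_def)
    \<comment> \<open>Each edge weight occurs in the sorted array, and at \<open>j = m\<close> the
      list of every entry is empty.\<close>
    have "e \<notin> set (L (?w e))" if "e < m" for e
      using data[OF that] I j by (auto simp: Inv_def Lists_def)
    then have "half_edges m ?u ?v ?w (s1 ''hn'' 0) (s1 ''hu'') (s1 ''hv'') (s1 ''hw'')"
      using I unfolding Inv_def Half_def half_edges_def by blast
    then show ?case using I j by (simp add: Inv_def)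
  next
    case (3 k1 s1)
    then obtain L where I: "Inv k1 s1 L" by blast
    define j where "j = s1 ''j'' 0"
    define w where "w = ?data j"
    define n where "n = s1 ''hn'' 0"
    have j: "j < m" using 3 I by (simp add: Inv_def Data_def j_def)
    have wW: "w \<in> ?W" using j by (simp add: w_def)
    have D: "Data s1" "s1 ''$data'' j = w" "s1 ''enext'' = s ''enext''" 
      "s1 ''edge_fst'' = ?u" "s1 ''edge_snd'' = ?v" using I by (auto simp: Inv_def Data_def w_def)
    have Ls: "Lists (s1 ''ehead'') j L" and Hs: "Half n (s1 ''hu'') (s1 ''hv'') (s1 ''hw'') j L"
      and k1: "k1 \<le> k + 50 * j + 60 * n + 8"
      and total: "n + 2 * (\<Sum>w\<in>?W. length (L w)) \<le> 2 * m"
      using I by (simp_all add: Inv_def j_def n_def)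
    have lk: "linked (s ''enext'') (s1 ''ehead'' w) (L w)" using Ls unfolding Lists_def by blast
    let ?s = "s1(''w'' := (s1 ''w'')(0 := w))"
    show ?case
    proof (cases "0 < s1 ''ehead'' w")
      case True
      define e where "e = s1 ''ehead'' w - 1"
      obtain es where Lw: "L w = e # es" "linked (s ''enext'') (s ''enext'' e) es"
        using lk True unfolding e_def by (rule linked_pos)
      then have "e \<in> set (L w)" "L w \<noteq> []" by auto
      then have e: "e < m" "?w e = w" using Ls by (auto simp: Lists_def)
      let ?L = "L(w := es)"
      have sum: "Suc (\<Sum>x\<in>?W. length (?L x)) = (\<Sum>x\<in>?W. length (L x))"
        using sum_length_tl[of ?W w L] wW Lw by simp
      have Lset: "set (L w) = insert e (set es)" using Lw(1) by simp
      have L': "Lists ((s1 ''ehead'')(w := s ''enext'' e)) j ?L"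
        unfolding Lists_def
      proof (intro conjI allI impI)
        fix x
        have "linked (s ''enext'') (s1 ''ehead'' x) (L x)" "set (L x) \<subseteq> {e. e < m \<and> ?w e = x}"
          using Ls unfolding Lists_def by blast+
        moreover have "set es \<subseteq> {e. e < m \<and> ?w e = x}" if "x = w"
          using calculation(2) Lset that by blast
        ultimately show "linked (s ''enext'') (((s1 ''ehead'')(w := s ''enext'' e)) x) (?L x)"
          "set (?L x) \<subseteq> {e. e < m \<and> ?w e = x}"
          using Lw(2) unfolding fun_upd_def by (simp_all split: if_split)
      next
        fix i assume "i < j"
        then have "L (?data i) = []" using Ls unfolding Lists_def by blast
        moreover from this have "?data i \<noteq> w" using Lw(1) by force
        ultimately show "?L (?data i) = []" by (metis fun_upd_other)
      qed
      define hu where "hu = (s1 ''hu'')(n := ?u e, Suc n := ?v e)"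
      define hv where "hv = (s1 ''hv'')(n := ?v e, Suc n := ?u e)"
      define hw where "hw = (s1 ''hw'')(n := w, Suc n := w)"
      have old: "hu t = s1 ''hu'' t" "hv t = s1 ''hv'' t" "hw t = s1 ''hw'' t" if "t < n" for t
        using that by (auto simp: hu_def hv_def hw_def)
      have new: "hu n = ?u e" "hu (Suc n) = ?v e" "hv n = ?v e" "hv (Suc n) = ?u e"
        "hw n = w" "hw (Suc n) = w"
        by (auto simp: hu_def hv_def hw_def)
      have H1: "\<And>t t'. t < n \<Longrightarrow> t' \<le> t \<Longrightarrow> s1 ''hw'' t' \<le> s1 ''hw'' t"
        "\<And>t i. t < n \<Longrightarrow> i < m \<Longrightarrow> j \<le> i \<Longrightarrow> s1 ''hw'' t \<le> ?data i"
        using Hs unfolding Half_def by blast+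
      have H2: "\<exists>e<m. s1 ''hw'' t = ?w e \<and>
          (s1 ''hu'' t = ?u e \<and> s1 ''hv'' t = ?v e \<or> s1 ''hu'' t = ?v e \<and> s1 ''hv'' t = ?u e)"
        if "t < n" for t
        using Hs that unfolding Half_def by blast
      have H3: "e' \<in> set (L (?w e')) \<or>
         (\<exists>t<n. s1 ''hu'' t = ?u e' \<and> s1 ''hv'' t = ?v e' \<and> s1 ''hw'' t = ?w e') \<and>
         (\<exists>t<n. s1 ''hu'' t = ?v e' \<and> s1 ''hv'' t = ?u e' \<and> s1 ''hw'' t = ?w e')"
        if "e' < m" for e'
        using Hs that unfolding Half_def by blast
      have cases: "t < n \<or> t = n \<or> t = Suc n" if "t < Suc (Suc n)" for t using that by linarith
      have w_le: "w \<le> ?data i" if "i < m" "j \<le> i" for i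
        using sorted that by (simp add: w_def)
      have le_w: "s1 ''hw'' t \<le> w" if "t < n" for t
        using H1(2)[OF that j] by (simp add: w_def)
      have "Half (Suc (Suc n)) hu hv hw j ?L"
        unfolding Half_def
      proof (intro conjI allI impI)
        fix t t' assume "t < Suc (Suc n)" "t' \<le> t"
        then show "hw t' \<le> hw t"
          using cases[of t] cases[of t'] old(3)[of t] old(3)[of t'] new(5,6) H1(1)[of t t'] le_w[of t']
          by fastforce
      next
        fix t i assume "t < Suc (Suc n)" "i < m" "j \<le> i"
        then show "hw t \<le> ?data i"
          using cases[of t] old(3)[of t] new(5,6) H1(2)[of t i] w_le[of i] by metis
      next
        fix t assume "t < Suc (Suc n)"
        then show "\<exists>e<m. hw t = ?w e \<and> (hu t = ?u e \<and> hv t = ?v e \<or> hu t = ?v e \<and> hv t = ?u e)"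
          using cases[of t] old[of t] new H2[of t] e by metis
      next
        fix e' assume e': "e' < m"
        show "e' \<in> set (?L (?w e')) \<or>
          (\<exists>t<Suc (Suc n). hu t = ?u e' \<and> hv t = ?v e' \<and> hw t = ?w e') \<and>
          (\<exists>t<Suc (Suc n). hu t = ?v e' \<and> hv t = ?u e' \<and> hw t = ?w e')"
        proof (cases "e' = e")
          case True
          then show ?thesis using new e(2) lessI less_SucI by metis
        next
          case False
          have "e' \<in> set (?L (?w e'))" if "e' \<in> set (L (?w e'))"
            using that False Lset by (cases "?w e' = w") auto
          then show ?thesis using H3[OF e'] old less_SucI by metis
        qed
      qed
      then have H': "Half (Suc (Suc n)) ((s1 ''hu'')(n := ?u e, Suc n := ?v e))
          ((s1 ''hv'')(n := ?v e, Suc n := ?u e)) ((s1 ''hw'')(n := w, Suc n := w)) j ?L"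
        by (simp only: hu_def hv_def hw_def)
      have step: "wp order_step (\<lambda>k s. \<exists>L. Inv k s L) k2 ?s" if "k2 \<le> k1 + 20" for k2
proof (rule wp_conseq[OF wp_order_step], goal_cases)
        case (1 k' s')
        have frame: "s' x = s1 x" if "x \<in> {''j'', ''num_edges'', ''$data'', ''enext'', ''edge_fst'', ''edge_snd''}" for x
        proof -
          have "x \<notin> writes order_step" "x \<noteq> ''w''" using that by (auto simp: writes_order_step)
          then show ?thesis using 1(2) by simp
        qed
        have "Data s'" using D(1) frame by (simp add: Data_def)
        moreover have "s' ''j'' 0 = j" using frame by (simp add: j_def)
        moreover have "k' \<le> k2 + 80" "s' ''hn'' 0 = Suc (Suc n)" "s' ''ehead'' = (s1 ''ehead'')(w := s ''enext'' e)"
          "s' ''hu'' = (s1 ''hu'')(n := ?u e, Suc n := ?v e)"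
          "s' ''hv'' = (s1 ''hv'')(n := ?v e, Suc n := ?u e)"
          "s' ''hw'' = (s1 ''hw'')(n := w, Suc n := w)"
          using 1(1) D by (simp_all add: n_def e_def)
        ultimately have "Inv k' s' ?L"
          unfolding Inv_def using L' H' sum total k1 j that by simp
        then show ?case by blast
      qed
      then show ?thesis
        using True D by (simp add: wp_simps j_def[symmetric])
    next
      case False
      then have L: "L w = []" using lk by (simp add: linked_0)
      have "Lists (s1 ''ehead'') (Suc j) L"
        using Ls L unfolding Lists_def w_def by (simp add: All_less_Suc_iff)
      moreover have "Half n (s1 ''hu'') (s1 ''hv'') (s1 ''hw'') (Suc j) L"
        using Hs unfolding Half_def by (meson Suc_leD)
      ultimately have "\<exists>L. Inv k2 (s1(''w'' := (s1 ''w'')(0 := w), ''j'' := (s1 ''j'')(0 := Suc j))) L"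
        if "k2 \<le> k1 + 50" for k2
        using that D(1) total k1 j by (intro exI[of _ L]) (simp add: Inv_def Data_def n_def)
      then show ?thesis using False D by (simp add: wp_simps j_def[symmetric])
    qed
  qed
qed

subsection \<open>Representatives of clusters\<close>

text \<open>Ranks rise strictly up to a fixed point and are at most \<open>N\<close>, so
  \<open>Suc N\<close> steps reach the root from everywhere. This gives the root function in closed
  form.\<close>

lemma trees_funpow_bound:
  assumes "finite V" and p: "\<And>x. x \<in> V \<Longrightarrow> p x \<in> V"
    and \<rho>: "\<And>x. x \<in> V \<Longrightarrow> p x \<noteq> x \<Longrightarrow> \<rho> x < \<rho> (p x)"
    and bound: "\<And>x. x \<in> V \<Longrightarrow> \<rho> x \<le> (N :: nat)"
  shows "trees V p \<rho> (p ^^ Suc N)" and "\<And>x. x \<in> V \<Longrightarrow> p ((p ^^ Suc N) x) = (p ^^ Suc N) x"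
proof -
  have V: "(p ^^ i) x \<in> V" if "x \<in> V" for x i
    using that p by (induction i) auto
  have "p ((p ^^ i) x) = (p ^^ i) x \<or> i \<le> \<rho> ((p ^^ i) x)" if "x \<in> V" for x i
  proof (induction i)
    case (Suc i)
    then show ?case using \<rho>[OF V[OF that, of i]] by fastforce
  qed simp
  then show root: "p ((p ^^ Suc N) x) = (p ^^ Suc N) x" if "x \<in> V" for x
    using bound[OF V[OF that]] that by (meson Suc_n_not_le_n le_trans)
  have fixed: "(p ^^ i) x = x" if "p x = x" for x i
    using that by (induction i) auto
  show "trees V p \<rho> (p ^^ Suc N)"
    unfolding trees_def
  proof (intro conjI ballI impI)
    fix x assume x: "x \<in> V"
    have "(p ^^ Suc N) (p x) = p ((p ^^ Suc N) x)" by (simp add: funpow_swap1)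
    then show "(p ^^ Suc N) (p x) = (p ^^ Suc N) x" using root[OF x] by simp
  qed (use assms fixed in auto)
qed

definition representatives :: "'v wdag \<Rightarrow> ('v \<Rightarrow> 'v) \<Rightarrow> bool" where
  "representatives D f \<longleftrightarrow>
     (\<forall>v\<in>dverts D. f v \<in> cluster D v \<and> (v \<in> sinks D \<or> (\<exists>w. (v, w) \<in> darcs D \<and> f w = f v)))"

text \<open>One outgoing arc for each vertex that is not a sink makes a forest with the sinks as
  roots. The rank counts the vertices that no nonempty path reaches; it grows along arcs by
  acyclicity.\<close>

lemma dag_trees:
  assumes fin: "finite (dverts D)" and A: "darcs D \<subseteq> dverts D \<times> dverts D" "acyclic (darcs D)"
    and sink: "\<And>v. v \<in> sinks D \<Longrightarrow> p v = v"
    and arc: "\<And>v. v \<in> dverts D \<Longrightarrow> v \<notin> sinks D \<Longrightarrow> (v, p v) \<in> darcs D"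
  obtains \<rho> R where "trees (dverts D) p \<rho> R" "representatives D R"
proof -
  let ?V = "dverts D" and ?A = "darcs D"
  define \<rho> where "\<rho> v = card ?V - card (?A\<^sup>+ `` {v})" for v
  have sub: "?A\<^sup>+ `` {v} \<subseteq> ?V" for v
    using trancl_subset_Sigma[OF A(1)] by blast
  have less: "\<rho> v < \<rho> w" if "(v, w) \<in> ?A" for v w
  proof -
    have "?A\<^sup>+ `` {w} \<subset> ?A\<^sup>+ `` {v}"
    proof
      show "?A\<^sup>+ `` {w} \<subseteq> ?A\<^sup>+ `` {v}" using that by (auto intro: trancl_into_trancl2)
      have "w \<in> ?A\<^sup>+ `` {v}" "w \<notin> ?A\<^sup>+ `` {w}" using that A(2) by (auto simp: acyclic_def)
      then show "?A\<^sup>+ `` {w} \<noteq> ?A\<^sup>+ `` {v}" by blast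
    qed
    then have "card (?A\<^sup>+ `` {w}) < card (?A\<^sup>+ `` {v})"
      using sub fin by (meson finite_subset psubset_card_mono)
    moreover have "card (?A\<^sup>+ `` {v}) \<le> card ?V" using sub fin by (intro card_mono)
    ultimately show ?thesis by (simp add: \<rho>_def)
  qed
  have p: "p v \<in> ?V" "p v \<noteq> v \<Longrightarrow> \<rho> v < \<rho> (p v)" if "v \<in> ?V" for v
    using that sink[of v] arc[of v] A(1) less[of v "p v"] by (cases "v \<in> sinks D"; auto)+
  let ?R = "p ^^ Suc (card ?V)"
  have bound: "\<rho> v \<le> card ?V" for v by (simp add: \<rho>_def)
  have tr: "trees ?V p \<rho> ?R" and root: "\<And>v. v \<in> ?V \<Longrightarrow> p (?R v) = ?R v"
    by (rule trees_funpow_bound[where \<rho> = \<rho>]; use fin p bound in blast)+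
  have reach: "(v, (p ^^ i) v) \<in> ?A\<^sup>* \<and> (p ^^ i) v \<in> ?V" if "v \<in> ?V" for v i
  proof (induction i)
    case (Suc i)
    then show ?case
      using p(1)[of "(p ^^ i) v"] sink[of "(p ^^ i) v"] arc[of "(p ^^ i) v"]
      by (cases "(p ^^ i) v \<in> sinks D") (auto intro: rtrancl_into_rtrancl)
  qed (use that in simp)
  have "representatives D ?R"
    unfolding representatives_def
  proof
    fix v assume v: "v \<in> ?V"
    have "?R v \<in> sinks D"
    proof (rule ccontr)
      assume "?R v \<notin> sinks D"
      then have "(?R v, ?R v) \<in> ?A" using arc[of "?R v"] reach[OF v] root[OF v] by metis
      then show False using A(2) by (auto simp: acyclic_def)
    qed
    then have "?R v \<in> cluster D v" using reach[OF v] unfolding cluster_def by blast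
    moreover have "?R (p v) = ?R v" using tr v by (simp add: trees_def)
    ultimately show "?R v \<in> cluster D v \<and>
        (v \<in> sinks D \<or> (\<exists>w. (v, w) \<in> darcs D \<and> ?R w = ?R v))" using arc[OF v] by metis
  qed
  then show thesis using tr that by blast
qed

text \<open>Any outgoing arc may determine the representative, so later arcs simply overwrite
  earlier ones; a sink keeps itself.\<close>

definition init_parents :: com where
  "init_parents =
     ''v'' ::= Num 0;;
     While (Less (var ''v'') (var ''num_verts''))
       (Store ''rep'' (var ''v'') (var ''v'');; Store ''par'' (var ''v'') (var ''v'');; incr ''v'');;
     ''i'' ::= Num 0;;
     While (Less (var ''i'') (var ''num_arcs''))
       (Store ''rep'' (Load ''arc_tail'' (var ''i'')) (Load ''arc_head'' (var ''i''));; incr ''i'')"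

lemma wp_init_parents:
  fixes s :: state
  defines "n \<equiv> s ''num_verts'' 0" and "a \<equiv> s ''num_arcs'' 0"
  shows "wp init_parents (\<lambda>k' s'. k' \<le> k + 40 * n + 40 * a + 40 \<and>
    (\<forall>v<n. s' ''par'' v = v) \<and>
    (\<forall>v<n. s' ''rep'' v = v \<and> (\<forall>i<a. s ''arc_tail'' i \<noteq> v) \<or>
      (\<exists>i<a. s ''arc_tail'' i = v \<and> s ''arc_head'' i = s' ''rep'' v))) k s"
proof -
  define Inv where "Inv k' s' \<longleftrightarrow> s' ''num_verts'' 0 = n \<and> s' ''num_arcs'' 0 = a \<and>
    s' ''arc_tail'' = s ''arc_tail'' \<and> s' ''arc_head'' = s ''arc_head'' \<and> s' ''v'' 0 \<le> n \<and>
    k' \<le> k + 40 * s' ''v'' 0 + 4 \<and> (\<forall>v<s' ''v'' 0. s' ''par'' v = v \<and> s' ''rep'' v = v)"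
    for k' :: nat and s' :: state
  define Inv' where "Inv' k' s' \<longleftrightarrow> s' ''num_arcs'' 0 = a \<and>
    s' ''arc_tail'' = s ''arc_tail'' \<and> s' ''arc_head'' = s ''arc_head'' \<and> s' ''i'' 0 \<le> a \<and>
    k' \<le> k + 40 * n + 40 * s' ''i'' 0 + 20 \<and> (\<forall>v<n. s' ''par'' v = v) \<and>
    (\<forall>v<n. s' ''rep'' v = v \<and> (\<forall>i<s' ''i'' 0. s ''arc_tail'' i \<noteq> v) \<or>
      (\<exists>i<s' ''i'' 0. s ''arc_tail'' i = v \<and> s ''arc_head'' i = s' ''rep'' v))"
    for k' :: nat and s' :: state
  show ?thesis
    unfolding init_parents_def wp_Seq wp_Store
  proof (rule wp_While[where I = Inv and B = "k + 40 * n + 4"], goal_cases)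
    case 1
    then show ?case by (simp add: Inv_def n_def a_def)
  next
    case (2 k1 s1)
    then show ?case by (simp add: Inv_def)
  next
    case (3 k1 s1)
    then show ?case by (simp add: Inv_def wp_simps less_Suc_eq)
  next
    case (4 k1 s1)
    show ?case
      unfolding wp_Seq wp_Store
    proof (rule wp_While[where I = Inv' and B = "k + 40 * n + 40 * a + 20"], goal_cases)
      case 1
      then show ?case using 4 by (simp add: Inv_def Inv'_def)
    next
      case (2 k2 s2)
      then show ?case by (simp add: Inv'_def)
    next
      case (3 k2 s2)
      then show ?case
        by (simp add: Inv'_def wp_simps All_less_Suc_iff Ex_less_Suc_iff)
    next
      case (4 k2 s2)
      then have i: "s2 ''i'' 0 = a" by (simp add: Inv'_def)
      show ?case using 4(1) unfolding Inv'_def i by simp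
    qed
  qed
qed

definition compress_all :: com where
  "compress_all =
     ''v'' ::= Num 0;;
     While (Less (var ''v'') (var ''num_verts''))
       (''fx'' ::= var ''v'';; find_root ''rep'';; incr ''v'')"

lemma compress_eq_root:
  assumes "trees V p \<rho> R" "x \<in> V" "root_path p x l (R x)"
  shows "p z = R z \<Longrightarrow> compress p x l (R x) z = R z" and "compress p x l (R x) x = R x"
proof -
  show "compress p x l (R x) z = R z" if "p z = R z"
    using that trees_funpow[OF assms(1,2)] by (auto simp: compress_def)
  show "compress p x l (R x) x = R x"
  proof (cases l)
    case 0
    then show ?thesis using assms(3) by (auto simp: compress_def root_path_def)
  next
    case (Suc l')
    then have "x \<in> (\<lambda>i. (p ^^ i) x) ` {..<l}" by (auto intro!: image_eqI[of _ _ 0])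
    then show ?thesis by (simp add: compress_def)
  qed
qed

text \<open>No trees are linked during this loop, so the number of deep elements, at most
  \<open>n\<close> at the start, pays for all paths. The representatives cost linear time, without
  the inverse Ackermann factor.\<close>

lemma wp_compress_all:
  assumes tr: "trees {..<n} (s ''rep'') \<rho> R" and n: "n = s ''num_verts'' 0"
  shows "wp compress_all (\<lambda>k' s'. k' \<le> k + 300 * n + 40 \<and> (\<forall>v<n. s' ''rep'' v = R v)) k s"
proof -
  define deep where "deep p = card {z \<in> {..<n}. p (p z) \<noteq> p z}" for p :: "nat \<Rightarrow> nat"
  define Inv where "Inv k' s' \<longleftrightarrow> s' ''num_verts'' 0 = n \<and> s' ''v'' 0 \<le> n \<and>
    k' + 60 * deep (s' ''rep'') \<le> k + 200 * s' ''v'' 0 + 60 * n + 4 \<and>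
    trees {..<n} (s' ''rep'') \<rho> R \<and> (\<forall>v<s' ''v'' 0. s' ''rep'' v = R v)"
    for k' :: nat and s' :: state
  have deep: "deep p \<le> n" for p
    using card_mono[of "{..<n}" "{z \<in> {..<n}. p (p z) \<noteq> p z}"] by (auto simp: deep_def)
  show ?thesis
    unfolding compress_all_def wp_Seq wp_Store
  proof (rule wp_While[where I = Inv and B = "k + 300 * n + 4"], goal_cases)
    case 1
    then show ?case using tr n deep[of "s ''rep''"] by (simp add: Inv_def)
  next
    case (2 k1 s1)
    then show ?case by (simp add: Inv_def)
  next
    case (4 k1 s1)
    then show ?case by (simp add: Inv_def)
  next
    case (3 k1 s1)
    define v where "v = s1 ''v'' 0"
    let ?p = "s1 ''rep''" and ?s = "s1(''fx'' := (s1 ''fx'')(0 := v))"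
    from 3 have tr1: "trees {..<n} ?p \<rho> R" and v: "v < n" and k1: "k1 + 60 * deep ?p \<le> k + 200 * v + 60 * n + 4"
      and R: "\<forall>v'<v. ?p v' = R v'" and n1: "s1 ''num_verts'' 0 = n"
      by (simp_all add: Inv_def v_def)
    obtain l where path: "root_path ?p v l (R v)" using trees_root_path[OF tr1] v by auto
    have l: "l + deep (compress ?p v l (R v)) \<le> deep ?p + 1"
      using compress_deep[OF tr1 _ path] v by (simp add: deep_def)
    have "wp (find_root ''rep'') (\<lambda>k' s'. wp (incr ''v'') Inv k' s') k2 ?s" if "k2 \<le> k1 + 20" for k2
    proof (rule wp_conseq[OF wp_find[where X = "''rep''" and l = l and r = "R v"]], goal_cases)
      case 1
      then show ?case using path by simp
    next
      case (3 k' s')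
      then show ?case
        using l k1 v that n1 R trees_compress[OF tr1 _ path] compress_eq_root[OF tr1 _ path]
        by (simp add: wp_simps Inv_def v_def[symmetric] All_less_Suc_iff)
    qed simp
    then show ?case unfolding wp_Seq by (subst wp_Store) (simp add: v_def[symmetric])
  qed
qed

subsection \<open>The sparse graph of representatives\<close>

definition emitted :: "nat \<Rightarrow> (nat \<Rightarrow> 'v) \<Rightarrow> (nat \<Rightarrow> 'v) \<Rightarrow> 'v set set" where
  "emitted gn gu gv = (\<lambda>k. {gu k, gv k}) ` {..<gn}"

definition emitted_le ::
  "nat \<Rightarrow> (nat \<Rightarrow> 'v) \<Rightarrow> (nat \<Rightarrow> 'v) \<Rightarrow> (nat \<Rightarrow> nat) \<Rightarrow> nat \<Rightarrow> 'v set set" where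
  "emitted_le gn gu gv gw w = (\<lambda>k. {gu k, gv k}) ` {k. k < gn \<and> gw k \<le> w}"

lemma emitted_0 [simp]: "emitted 0 gu gv = {}"
  by (simp add: emitted_def)

lemma emitted_Suc: "emitted (Suc gn) (gu(gn := x)) (gv(gn := y)) = insert {x, y} (emitted gn gu gv)"
  by (auto simp: emitted_def lessThan_Suc)

lemma emitted_le_Suc:
  "emitted_le gn gu gv gw w \<subseteq> emitted_le (Suc gn) (gu(gn := x)) (gv(gn := y)) (gw(gn := z)) w"
proof
  fix e assume "e \<in> emitted_le gn gu gv gw w"
  then obtain k where "k < gn" "gw k \<le> w" "e = {gu k, gv k}" by (auto simp: emitted_le_def)
  then show "e \<in> emitted_le (Suc gn) (gu(gn := x)) (gv(gn := y)) (gw(gn := z)) w"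
    unfolding emitted_le_def by (intro image_eqI[of _ _ k]) auto
qed

lemma representatives_sink: "representatives D f \<Longrightarrow> x \<in> sinks D \<Longrightarrow> f x = x"
proof -
  assume "representatives D f" "x \<in> sinks D"
  then have "(x, f x) \<in> (darcs D)\<^sup>*" "x \<in> sinks D"
    by (auto simp: representatives_def sinks_def cluster_def)
  then show "f x = x" by (auto simp: sinks_def elim: converse_rtranclE)
qed

locale search =
  fixes D :: "nat wdag" and f :: "nat \<Rightarrow> nat" and a :: nat and tail head :: "nat \<Rightarrow> nat"
    and hn :: nat and hu hv hw :: "nat \<Rightarrow> nat"
  assumes arcs: "darcs D = (\<lambda>i. (tail i, head i)) ` {..<a}"
    and arcs_verts: "darcs D \<subseteq> dverts D \<times> dverts D"
    and reps: "representatives D f"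
    and half: "\<And>t. t < hn \<Longrightarrow> hu t \<in> dverts D \<and> hv t \<in> dverts D"
    and sorted: "\<And>t t'. t < hn \<Longrightarrow> t' \<le> t \<Longrightarrow> hw t' \<le> hw t"
begin

text \<open>The half-edges before \<open>h\<close> have been started. The list \<open>L v\<close> contains the arcs out of \<open>v\<close> that
  have not been followed yet, and \<open>P\<close> the arc that is being followed. The flag \<open>b\<close> is unset
  while the end of the current half-edge has not been visited.\<close>

definition inv ::
  "nat set \<Rightarrow> bool \<Rightarrow> nat \<Rightarrow> nat \<Rightarrow> nat \<Rightarrow> nat \<Rightarrow> nat \<Rightarrow> (nat \<Rightarrow> nat) \<Rightarrow> (nat \<Rightarrow> nat) \<Rightarrow>
   nat \<Rightarrow> (nat \<Rightarrow> nat) \<Rightarrow> (nat \<Rightarrow> nat) \<Rightarrow> (nat \<Rightarrow> nat) \<Rightarrow> (nat \<Rightarrow> nat list) \<Rightarrow> bool" where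
  "inv P b h part lab qh qt queue mark gn gu gv gw L \<longleftrightarrow>
     h \<le> hn \<and> (0 < h \<longrightarrow> part = f (hv (h - 1)) \<and> lab = hw (h - 1)) \<and>
     (b \<and> 0 < h \<longrightarrow> mark (hu (h - 1)) \<noteq> 0 \<and> (f (hu (h - 1)), part) \<in> conn (emitted gn gu gv)) \<and>
     qh \<le> qt \<and> inj_on queue {..<qt} \<and> queue ` {..<qt} = {v \<in> dverts D. mark v \<noteq> 0} \<and>
     (\<forall>v. set (L v) \<subseteq> {i. i < a \<and> tail i = v}) \<and> (\<forall>t<qh. L (queue t) = []) \<and>
     (\<forall>i<a. i \<in> set (L (tail i)) \<or> i \<in> P \<or>
        mark (head i) \<noteq> 0 \<and> (f (head i), f (tail i)) \<in> conn (emitted gn gu gv)) \<and>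
     (\<forall>t. qh \<le> t \<and> t < qt \<longrightarrow> 0 < h \<and> (f (queue t), part) \<in> conn (emitted gn gu gv) \<and>
        (hu (h - 1), queue t) \<in> (darcs D)\<^sup>*) \<and>
     (\<forall>k<gn. \<exists>t<h. gw k = hw t \<and> gv k = f (hv t) \<and> gu k \<in> cluster D (hu t)) \<and>
     (\<forall>k<gn. \<forall>k'\<le>k. gw k' \<le> gw k) \<and>
     (\<forall>t. Suc t < h \<longrightarrow> (\<forall>x\<in>cluster D (hu t).
        (x, f (hv t)) \<in> conn (emitted_le gn gu gv gw (hw t))))"

lemma invD:
  assumes "inv P b h part lab qh qt queue mark gn gu gv gw L"
  shows "h \<le> hn"
    and "0 < h \<longrightarrow> part = f (hv (h - 1)) \<and> lab = hw (h - 1)"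
    and "b \<and> 0 < h \<longrightarrow> mark (hu (h - 1)) \<noteq> 0 \<and> (f (hu (h - 1)), part) \<in> conn (emitted gn gu gv)"
    and "qh \<le> qt"
    and "inj_on queue {..<qt}"
    and "queue ` {..<qt} = {v \<in> dverts D. mark v \<noteq> 0}"
    and "\<forall>v. set (L v) \<subseteq> {i. i < a \<and> tail i = v}"
    and "\<forall>t<qh. L (queue t) = []"
    and "\<forall>i<a. i \<in> set (L (tail i)) \<or> i \<in> P \<or>
        mark (head i) \<noteq> 0 \<and> (f (head i), f (tail i)) \<in> conn (emitted gn gu gv)"
    and "\<forall>t. qh \<le> t \<and> t < qt \<longrightarrow> 0 < h \<and> (f (queue t), part) \<in> conn (emitted gn gu gv) \<and>
        (hu (h - 1), queue t) \<in> (darcs D)\<^sup>*"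
    and "\<forall>k<gn. \<exists>t<h. gw k = hw t \<and> gv k = f (hv t) \<and> gu k \<in> cluster D (hu t)"
    and "\<forall>k<gn. \<forall>k'\<le>k. gw k' \<le> gw k"
    and "\<forall>t. Suc t < h \<longrightarrow> (\<forall>x\<in>cluster D (hu t).
        (x, f (hv t)) \<in> conn (emitted_le gn gu gv gw (hw t)))"
  using assms[unfolded inv_def] by - (elim conjE, assumption)+

lemma inv_label_le:
  assumes "inv P b h part lab qh qt queue mark gn gu gv gw L" "k < gn"
  shows "0 < h" "gw k \<le> lab"
proof -
  obtain t where t: "t < h" "gw k = hw t" using invD(11)[OF assms(1)] assms(2) by blast
  then show "0 < h" by simp
  then have "lab = hw (h - 1)" "h \<le> hn" using invD(1,2)[OF assms(1)] by blast+
  then show "gw k \<le> lab" using t sorted[of "h - 1" t] by simp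
qed

lemma inv_queue_le:
  assumes "inv P b h part lab qh qt queue mark gn gu gv gw L" "finite (dverts D)"
  shows "qt \<le> card (dverts D)"
proof -
  have "card (queue ` {..<qt}) = qt" using invD(5)[OF assms(1)] by (simp add: card_image)
  moreover have "queue ` {..<qt} \<subseteq> dverts D" unfolding invD(6)[OF assms(1)] by auto
  ultimately show ?thesis using card_mono[OF assms(2), of "queue ` {..<qt}"] by simp
qed

text \<open>With the queue empty, all arcs of marked vertices have been followed. By induction along
  arcs every vertex reachable from the latest \<open>hu t\<close> is marked and its representative
  is joined to \<open>part\<close>; a sink is its own representative.\<close>

lemma inv_drained:
  assumes inv: "inv {} True h part lab qh qt queue mark gn gu gv gw L"
    and qh: "qh = qt" and t: "t < h" and x: "x \<in> cluster D (hu t)"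
  shows "(x, f (hv t)) \<in> conn (emitted_le gn gu gv gw (hw t))"
proof (cases "Suc t < h")
  case True
  then show ?thesis using invD(13)[OF inv] x by blast
next
  case False
  let ?E = "emitted gn gu gv"
  have h: "0 < h" "h - 1 = t" using t False by auto
  then have cur: "part = f (hv t)" "lab = hw t" "mark (hu t) \<noteq> 0" "(f (hu t), part) \<in> conn ?E"
    using invD(2,3)[OF inv] by auto
  have "y \<in> dverts D \<and> mark y \<noteq> 0 \<and> (f y, part) \<in> conn ?E" if "(hu t, y) \<in> (darcs D)\<^sup>*" for y
    using that
  proof (induction rule: rtrancl_induct)
    case base
    have "t < hn" using t invD(1)[OF inv] by linarith
    then show ?case using cur half[of t] by simp
  next
    case (step y z)
    have "(y, z) \<in> (\<lambda>i. (tail i, head i)) ` {..<a}" using step.hyps(2) unfolding arcs .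
    then obtain i where i: "i < a" "tail i = y" "head i = z" by auto
    have "y \<in> queue ` {..<qt}" unfolding invD(6)[OF inv] using step.IH by simp
    then obtain u where "u < qh" "queue u = y" using qh by auto
    then have "L y = []" using invD(8)[OF inv] by metis
    moreover have "i \<in> set (L (tail i)) \<or> i \<in> {} \<or>
        mark (head i) \<noteq> 0 \<and> (f (head i), f (tail i)) \<in> conn ?E"
      using invD(9)[OF inv] i(1) by blast
    ultimately have "mark z \<noteq> 0 \<and> (f z, f y) \<in> conn ?E" using i by simp
    moreover have "z \<in> dverts D" using step.hyps(2) arcs_verts by auto
    ultimately show ?case using step.IH conn_trans[of "f z" "f y" ?E part] by simp
  qed
  moreover have xs: "(hu t, x) \<in> (darcs D)\<^sup>*" "x \<in> sinks D" using x by (auto simp: cluster_def)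
  ultimately have "(x, part) \<in> conn ?E" using representatives_sink[OF reps xs(2)] by metis
  \<comment> \<open>No label exceeds that of the current half-edge, so all edges emitted so far pass
    its threshold.\<close>
  moreover have "?E = emitted_le gn gu gv gw (hw t)"
    using inv_label_le[OF inv] cur(2) by (auto simp: emitted_def emitted_le_def)
  ultimately show ?thesis using cur by simp
qed

text \<open>Serves both kinds of arrival: along an arc, with \<open>P = {i}\<close>, and at the end
  of a new half-edge, with \<open>b\<close> unset. An edge is emitted even if \<open>x\<close> is
  already marked, because the component around \<open>f x\<close> may not yet contain
  \<open>part\<close>; its arcs need no second visit.\<close>

lemma inv_arrive:
  assumes inv: "inv P b h part lab qh qt queue mark gn gu gv gw L"
    and P: "\<And>i. i \<in> P \<Longrightarrow> head i = x \<and> (f (tail i), part) \<in> conn (emitted gn gu gv)"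
    and x: "x \<in> dverts D" "0 < h" "(hu (h - 1), x) \<in> (darcs D)\<^sup>*" "b \<or> x = hu (h - 1)"
    and new: "mark x = 0 \<Longrightarrow> mark' = mark(x := 1) \<and> queue' = queue(qt := x) \<and> qt' = Suc qt"
    and seen: "mark x \<noteq> 0 \<Longrightarrow> mark' = mark \<and> queue' = queue \<and> qt' = qt"
  shows "inv {} True h part lab qh qt' queue' mark' (Suc gn)
    (gu(gn := f x)) (gv(gn := part)) (gw(gn := lab)) L"
proof -
  let ?E = "emitted gn gu gv" and ?E' = "insert {f x, part} (emitted gn gu gv)"
  have sub: "(y, z) \<in> conn ?E \<Longrightarrow> (y, z) \<in> conn ?E'" for y z
    using conn_mono[of ?E ?E'] by blast
  have xp: "(f x, part) \<in> conn ?E'" by (rule conn_edge) simp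
  have mark: "mark' x \<noteq> 0" "\<And>y. mark y \<noteq> 0 \<Longrightarrow> mark' y \<noteq> 0"
    using new seen by (cases "mark x = 0"; auto)+
  have queue: "inj_on queue {..<qt}" "queue ` {..<qt} = {v \<in> dverts D. mark v \<noteq> 0}" "qh \<le> qt"
    using invD(4-6)[OF inv] by blast+
  have qt: "qt \<le> qt'" "\<And>t. t < qt \<Longrightarrow> queue' t = queue t"
    "\<And>t. qt \<le> t \<Longrightarrow> t < qt' \<Longrightarrow> queue' t = x"
    using new seen by (cases "mark x = 0"; auto)+
  have queue': "inj_on queue' {..<qt'} \<and> queue' ` {..<qt'} = {v \<in> dverts D. mark' v \<noteq> 0}"
  proof (cases "mark x = 0")
    case True
    then have eq: "queue' = queue(qt := x)" "qt' = Suc qt" "mark' = mark(x := 1)" using new by auto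
    have "x \<notin> queue ` {..<qt}" using queue(2) True by blast
    then have "inj_on queue' {..<qt'}"
      using queue(1) unfolding eq lessThan_Suc by (auto simp: inj_on_def)
    moreover have "queue' ` {..<qt'} = insert x (queue ` {..<qt})"
      unfolding eq lessThan_Suc by auto
    ultimately show ?thesis using queue(2) x(1) unfolding eq by auto
  qed (use seen queue in auto)
  have cur: "h \<le> hn" "part = f (hv (h - 1))" "lab = hw (h - 1)"
    "b \<Longrightarrow> mark (hu (h - 1)) \<noteq> 0 \<and> (f (hu (h - 1)), part) \<in> conn ?E"
    using invD(1-3)[OF inv] x(2) by blast+
  show ?thesis
    unfolding inv_def emitted_Suc
  proof (intro conjI allI impI)
    show "h \<le> hn" "part = f (hv (h - 1))" "lab = hw (h - 1)" by (fact cur)+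
    show "mark' (hu (h - 1)) \<noteq> 0" "(f (hu (h - 1)), part) \<in> conn ?E'"
      by (cases b; use x(4) cur(4) mark sub xp in blast)+
    show "qh \<le> qt'" using queue qt by simp
    show "inj_on queue' {..<qt'}" "queue' ` {..<qt'} = {v \<in> dverts D. mark' v \<noteq> 0}"
      using queue' by auto
    show "set (L v) \<subseteq> {i. i < a \<and> tail i = v}" for v using invD(7)[OF inv] by blast
    show "L (queue' t) = []" if "t < qh" for t
    proof -
      have "L (queue t) = []" using invD(8)[OF inv] that by blast
      then show ?thesis using qt(2)[of t] that queue(3) by simp
    qed
    show "i \<in> set (L (tail i)) \<or> i \<in> {} \<or>
        mark' (head i) \<noteq> 0 \<and> (f (head i), f (tail i)) \<in> conn ?E'" if "i < a" for i
    proof -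
      have "i \<in> set (L (tail i)) \<or> i \<in> P \<or>
          mark (head i) \<noteq> 0 \<and> (f (head i), f (tail i)) \<in> conn ?E"
        using invD(9)[OF inv] that by blast
      then consider "i \<in> set (L (tail i))" | "i \<in> P"
        | "mark (head i) \<noteq> 0" "(f (head i), f (tail i)) \<in> conn ?E" by blast
      then show ?thesis
      proof cases
        case 2
        \<comment> \<open>The tail's representative is joined to \<open>part\<close> already, so the
          new edge joins it to the head's representative as well.\<close>
        then have "head i = x" "(f (tail i), part) \<in> conn ?E'" using P sub by blast+
        moreover from this have "(f x, f (tail i)) \<in> conn ?E'" using xp conn_sym conn_trans by metis
        ultimately show ?thesis using mark(1) by simp
      next
        case 3
        then show ?thesis using mark(2) sub by blast
      qed simp
    qed
    show "0 < h" by (fact x)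
    show "(f (queue' t), part) \<in> conn ?E'" "(hu (h - 1), queue' t) \<in> (darcs D)\<^sup>*"
      if t: "qh \<le> t \<and> t < qt'" for t
    proof -
      have "t < qt \<Longrightarrow> (f (queue t), part) \<in> conn ?E \<and> (hu (h - 1), queue t) \<in> (darcs D)\<^sup>*"
        using invD(10)[OF inv] t by blast
      then show "(f (queue' t), part) \<in> conn ?E'" "(hu (h - 1), queue' t) \<in> (darcs D)\<^sup>*"
        using qt(2,3)[of t] t xp x(3) sub by (cases "t < qt"; simp)+
    qed
    show "\<exists>t<h. (gw(gn := lab)) k = hw t \<and> (gv(gn := part)) k = f (hv t) \<and>
        (gu(gn := f x)) k \<in> cluster D (hu t)" if "k < Suc gn" for k
    proof (cases "k = gn")
      case True
      have "f x \<in> cluster D x" using reps x(1) by (auto simp: representatives_def)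
      then have "f x \<in> cluster D (hu (h - 1))" using x(3) by (auto simp: cluster_def)
      then show ?thesis using True cur x(2) by (intro exI[of _ "h - 1"]) auto
    next
      case False
      then have "k < gn" using that by simp
      then have "\<exists>t<h. gw k = hw t \<and> gv k = f (hv t) \<and> gu k \<in> cluster D (hu t)"
        using invD(11)[OF inv] by blast
      then show ?thesis using False by simp
    qed
    show "(gw(gn := lab)) k' \<le> (gw(gn := lab)) k" if "k < Suc gn" "k' \<le> k" for k k'
    proof (cases "k = gn")
      case True
      then show ?thesis using inv_label_le(2)[OF inv, of k'] that by auto
    next
      case False
      then have "k < gn" using that by simp
      moreover from this have "gw k' \<le> gw k" using invD(12)[OF inv] that(2) by blast
      ultimately show ?thesis using that(2) by simp
    qed
    show "\<forall>y\<in>cluster D (hu t). (y, f (hv t)) \<in>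
        conn (emitted_le (Suc gn) (gu(gn := f x)) (gv(gn := part)) (gw(gn := lab)) (hw t))"
      if "Suc t < h" for t
    proof
      fix y assume "y \<in> cluster D (hu t)"
      then have "(y, f (hv t)) \<in> conn (emitted_le gn gu gv gw (hw t))"
        using invD(13)[OF inv] that by blast
      then show "(y, f (hv t)) \<in>
          conn (emitted_le (Suc gn) (gu(gn := f x)) (gv(gn := part)) (gw(gn := lab)) (hw t))"
        by (rule conn_mono[OF emitted_le_Suc, THEN subsetD])
    qed
  qed
qed

lemma inv_pop_arc:
  assumes inv: "inv {} True h part lab qh qt queue mark gn gu gv gw L"
    and "qh < qt" and L: "L (queue qh) = i # js"
  shows "inv {i} True h part lab qh qt queue mark gn gu gv gw (L(queue qh := js))"
    and "0 < h" "head i \<in> dverts D" "(f (tail i), part) \<in> conn (emitted gn gu gv)"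
    and "(hu (h - 1), head i) \<in> (darcs D)\<^sup>*"
proof -
  have *: "0 < h \<and> (f (queue qh), part) \<in> conn (emitted gn gu gv) \<and>
      (hu (h - 1), queue qh) \<in> (darcs D)\<^sup>*"
    using invD(10)[OF inv] assms(2) by blast
  have "set (L (queue qh)) \<subseteq> {i. i < a \<and> tail i = queue qh}" using invD(7)[OF inv] by blast
  then have i: "i < a" "tail i = queue qh" and js: "set js \<subseteq> {i. i < a \<and> tail i = queue qh}"
    unfolding L by auto
  then have arc: "(queue qh, head i) \<in> darcs D" unfolding arcs by (auto intro!: image_eqI[of _ _ i])
  show "0 < h" "(f (tail i), part) \<in> conn (emitted gn gu gv)" using * i by auto
  show "(hu (h - 1), head i) \<in> (darcs D)\<^sup>*" using * arc by (blast intro: rtrancl_into_rtrancl)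
  show "head i \<in> dverts D" using arc arcs_verts by auto
  have "set (L v) \<subseteq> {i. i < a \<and> tail i = v}" for v using invD(7)[OF inv] by blast
  then have L1: "set ((L(queue qh := js)) v) \<subseteq> {i. i < a \<and> tail i = v}" for v
    using js by simp
  have L2: "(L(queue qh := js)) (queue t) = []" if "t < qh" for t
  proof -
    have "L (queue t) = []" using invD(8)[OF inv] that by blast
    moreover from this have "queue t \<noteq> queue qh" using L by (metis list.distinct(1))
    ultimately show ?thesis by simp
  qed
  have L3: "j \<in> set ((L(queue qh := js)) (tail j)) \<or> j \<in> {i} \<or>
        mark (head j) \<noteq> 0 \<and> (f (head j), f (tail j)) \<in> conn (emitted gn gu gv)" if "j < a" for j
  proof -
    have "j \<in> set (L (tail j)) \<or> mark (head j) \<noteq> 0 \<and> (f (head j), f (tail j)) \<in> conn (emitted gn gu gv)"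
      using invD(9)[OF inv] that by blast
    moreover have "j \<in> set js \<or> j = i" if "j \<in> set (L (tail j))" "tail j = queue qh"
      using that(1) unfolding that(2) L by auto
    moreover have "tail j = queue qh \<Longrightarrow> (L(queue qh := js)) (tail j) = js"
      "tail j \<noteq> queue qh \<Longrightarrow> (L(queue qh := js)) (tail j) = L (tail j)"
      by simp_all
    ultimately show ?thesis by (metis singletonI)
  qed
  have L: "\<forall>v. set ((L(queue qh := js)) v) \<subseteq> {i. i < a \<and> tail i = v}"
    "\<forall>t<qh. (L(queue qh := js)) (queue t) = []"
    "\<forall>j<a. j \<in> set ((L(queue qh := js)) (tail j)) \<or> j \<in> {i} \<or>
        mark (head j) \<noteq> 0 \<and> (f (head j), f (tail j)) \<in> conn (emitted gn gu gv)"
    by (intro allI impI L1 L2 L3; assumption)+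
  show "inv {i} True h part lab qh qt queue mark gn gu gv gw (L(queue qh := js))"
    unfolding inv_def by (intro conjI; (rule invD[OF inv] | rule L(1) | rule L(2) | rule L(3)))
qed

lemma inv_pop_vertex:
  assumes inv: "inv {} True h part lab qh qt queue mark gn gu gv gw L"
    and "qh < qt" and L: "L (queue qh) = []"
  shows "inv {} True h part lab (Suc qh) qt queue mark gn gu gv gw L"
proof -
  have 1: "\<forall>t<Suc qh. L (queue t) = []"
    using invD(8)[OF inv] L by (metis less_Suc_eq)
  have 2: "Suc qh \<le> qt" using assms(2) by simp
  have 3: "\<forall>t. Suc qh \<le> t \<and> t < qt \<longrightarrow> 0 < h \<and>
      (f (queue t), part) \<in> conn (emitted gn gu gv) \<and> (hu (h - 1), queue t) \<in> (darcs D)\<^sup>*"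
    using invD(10)[OF inv] by (meson Suc_leD)
  show ?thesis
    unfolding inv_def by (intro conjI; (rule invD[OF inv] | rule 1 | rule 2 | rule 3))
qed

text \<open>The label \<open>part\<close> may change only while the queue is empty: the clause on
  queued vertices is then vacuous, and the clause on the half-edge just finished is
  \<open>inv_drained\<close>.\<close>

lemma inv_next:
  assumes inv: "inv {} True h part lab qh qt queue mark gn gu gv gw L"
    and qh: "qh = qt" and "h < hn"
  shows "inv {} False (Suc h) (f (hv h)) (hw h) qh qt queue mark gn gu gv gw L"
proof -
  have 1: "\<forall>t. Suc t < Suc h \<longrightarrow> (\<forall>x\<in>cluster D (hu t).
        (x, f (hv t)) \<in> conn (emitted_le gn gu gv gw (hw t)))"
    using inv_drained[OF inv qh] by simp
  have 2: "\<forall>t. qh \<le> t \<and> t < qt \<longrightarrow> 0 < Suc h \<and>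
      (f (queue t), f (hv h)) \<in> conn (emitted gn gu gv) \<and> (hu (Suc h - 1), queue t) \<in> (darcs D)\<^sup>*"
  proof (intro allI impI)
    fix t assume "qh \<le> t \<and> t < qt"
    then have False using qh by linarith
    then show "0 < Suc h \<and> (f (queue t), f (hv h)) \<in> conn (emitted gn gu gv) \<and>
      (hu (Suc h - 1), queue t) \<in> (darcs D)\<^sup>*" ..
  qed
  have 3: "\<forall>k<gn. \<exists>t<Suc h. gw k = hw t \<and> gv k = f (hv t) \<and> gu k \<in> cluster D (hu t)"
    using invD(11)[OF inv] by (meson less_SucI)
  have 4: "Suc h \<le> hn" using assms(3) by simp
  show ?thesis
    unfolding inv_def
    by (intro conjI; (rule invD[OF inv] | rule 1 | rule 2 | rule 3 | rule 4 | simp))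
qed

end

section \<open>The search as a program\<close>

definition arrive :: com where
  "arrive =
     Store ''gu'' (var ''gn'') (Load ''rep'' (var ''x''));;
     Store ''gv'' (var ''gn'') (var ''part'');;
     Store ''gw'' (var ''gn'') (var ''lab'');;
     incr ''gn'';;
     If (Less (Load ''mark'' (var ''x'')) (Num 1))
       (Store ''mark'' (var ''x'') (Num 1);; Store ''queue'' (var ''qt'') (var ''x'');; incr ''qt'')
       Skip"

definition pop_arc :: com where
  "pop_arc =
     ''i'' ::= Minus (Load ''afirst'' (var ''y'')) (Num 1);;
     Store ''afirst'' (var ''y'') (Load ''anext'' (var ''i''));;
     ''x'' ::= Load ''arc_head'' (var ''i'')"

definition next_half :: com where
  "next_half =
     ''x'' ::= Load ''hu'' (var ''h'');;
     ''part'' ::= Load ''rep'' (Load ''hv'' (var ''h''));;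
     ''lab'' ::= Load ''hw'' (var ''h'');;
     incr ''h''"

definition search_prog :: com where
  "search_prog =
     While (Not (And (Not (Less (var ''qh'') (var ''qt''))) (Not (Less (var ''h'') (var ''hn'')))))
       (If (Less (var ''qh'') (var ''qt''))
         (''y'' ::= Load ''queue'' (var ''qh'');;
          If (Less (Num 0) (Load ''afirst'' (var ''y''))) (pop_arc;; arrive) (incr ''qh''))
         (next_half;; arrive))"

lemma wp_arrive:
  fixes s :: state
  defines "n \<equiv> s ''gn'' 0" and "x \<equiv> s ''x'' 0"
  shows "wp arrive (\<lambda>k' s'. k' \<le> k + 60 \<and> s' ''gn'' 0 = Suc n \<and>
    s' ''gu'' = (s ''gu'')(n := s ''rep'' x) \<and> s' ''gv'' = (s ''gv'')(n := s ''part'' 0) \<and>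
    s' ''gw'' = (s ''gw'')(n := s ''lab'' 0) \<and>
    (s ''mark'' x = 0 \<longrightarrow> s' ''mark'' = (s ''mark'')(x := 1) \<and>
       s' ''queue'' = (s ''queue'')(s ''qt'' 0 := x) \<and> s' ''qt'' 0 = Suc (s ''qt'' 0)) \<and>
    (s ''mark'' x \<noteq> 0 \<longrightarrow> s' ''mark'' = s ''mark'' \<and> s' ''queue'' = s ''queue'' \<and>
       s' ''qt'' 0 = s ''qt'' 0)) k s"
  by (simp add: arrive_def wp_simps n_def x_def)

lemma writes_arrive: "writes arrive = {''gu'', ''gv'', ''gw'', ''gn'', ''mark'', ''queue'', ''qt''}"
  by (auto simp: arrive_def)

lemma wp_pop_arc:
  fixes s :: state
  defines "y \<equiv> s ''y'' 0"
  defines "i \<equiv> s ''afirst'' y - 1"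
  shows "wp pop_arc (\<lambda>k' s'. k' \<le> k + 30 \<and>
    s' ''afirst'' = (s ''afirst'')(y := s ''anext'' i) \<and> s' ''x'' 0 = s ''arc_head'' i) k s"
  by (simp add: pop_arc_def wp_simps y_def i_def)

lemma writes_pop_arc: "writes pop_arc = {''i'', ''afirst'', ''x''}"
  by (auto simp: pop_arc_def)

lemma wp_next_half:
  fixes s :: state
  defines "h \<equiv> s ''h'' 0"
  shows "wp next_half (\<lambda>k' s'. k' \<le> k + 40 \<and> s' ''x'' 0 = s ''hu'' h \<and>
    s' ''part'' 0 = s ''rep'' (s ''hv'' h) \<and> s' ''lab'' 0 = s ''hw'' h \<and> s' ''h'' 0 = Suc h) k s"
  by (simp add: next_half_def wp_simps h_def)

lemma writes_next_half: "writes next_half = {''x'', ''part'', ''lab'', ''h''}"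
  by (auto simp: next_half_def)

section \<open>Invariant and running time of the search\<close>

context search
begin

definition constant_banks :: "nat \<Rightarrow> (nat \<Rightarrow> nat) \<Rightarrow> state \<Rightarrow> bool" where
  "constant_banks n nx s \<longleftrightarrow> (\<forall>v<n. s ''rep'' v = f v) \<and> s ''anext'' = nx \<and>
     s ''arc_head'' = head \<and> s ''hn'' 0 = hn \<and> s ''hu'' = hu \<and> s ''hv'' = hv \<and> s ''hw'' = hw"

definition state_inv where
  "state_inv P b s L \<longleftrightarrow> inv P b (s ''h'' 0) (s ''part'' 0) (s ''lab'' 0) (s ''qh'' 0) (s ''qt'' 0)
     (s ''queue'') (s ''mark'') (s ''gn'' 0) (s ''gu'') (s ''gv'') (s ''gw'') L"

text \<open>Each emission is paid for by a started half-edge or a consumed arc; this bounds the size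
  of the sparse graph.\<close>

definition lists_inv where
  "lists_inv n nx s L \<longleftrightarrow> (\<forall>v. linked nx (s ''afirst'' v) (L v)) \<and>
     s ''gn'' 0 + (\<Sum>v<n. length (L v)) \<le> s ''h'' 0 + a"

text \<open>Every iteration starts a half-edge, consumes an arc or finishes a queued vertex, and
  each of these events may cost 200.\<close>

definition clock where
  "clock n k0 k s L \<longleftrightarrow> k + 200 * (\<Sum>v<n. length (L v)) \<le> k0 + 200 * s ''h'' 0 + 200 * s ''qh'' 0 + 200 * a"

definition prog_inv where
  "prog_inv n nx k0 k s L \<longleftrightarrow> constant_banks n nx s \<and> state_inv {} True s L \<and> lists_inv n nx s L \<and>
     clock n k0 k s L"

lemma wp_arrive_inv:
  assumes verts: "dverts D = {..<n}" and banks: "constant_banks n nx s"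
    and inv: "state_inv P b s L"
    and P: "\<And>i. i \<in> P \<Longrightarrow> head i = s ''x'' 0 \<and>
      (f (tail i), s ''part'' 0) \<in> conn (emitted (s ''gn'' 0) (s ''gu'') (s ''gv''))"
    and x: "s ''x'' 0 < n" "0 < s ''h'' 0" "(hu (s ''h'' 0 - 1), s ''x'' 0) \<in> (darcs D)\<^sup>*"
      "b \<or> s ''x'' 0 = hu (s ''h'' 0 - 1)"
    and lists: "\<forall>v. linked nx (s ''afirst'' v) (L v)"
      "Suc (s ''gn'' 0) + (\<Sum>v<n. length (L v)) \<le> s ''h'' 0 + a"
    and clock: "clock n k0 (k + 60) s L"
  shows "wp arrive (\<lambda>k s. \<exists>L. prog_inv n nx k0 k s L) k s"
proof (rule wp_conseq[OF wp_arrive], goal_cases)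
  case (1 k' s')
  have frame: "s' x = s x" if "x \<in> {''rep'', ''anext'', ''arc_head'', ''hn'', ''hu'', ''hv'', ''hw'',
      ''h'', ''part'', ''lab'', ''qh'', ''afirst''}" for x
  proof -
    have "x \<notin> writes arrive" using that by (auto simp: writes_arrive)
    then show ?thesis using 1(2) by simp
  qed
  have eq: "s' ''rep'' = s ''rep''" "s' ''anext'' = s ''anext''" "s' ''arc_head'' = s ''arc_head''"
    "s' ''hn'' = s ''hn''" "s' ''hu'' = s ''hu''" "s' ''hv'' = s ''hv''" "s' ''hw'' = s ''hw''"
    "s' ''h'' = s ''h''" "s' ''part'' = s ''part''" "s' ''lab'' = s ''lab''" "s' ''qh'' = s ''qh''"
    "s' ''afirst'' = s ''afirst''"
    by (rule frame, simp)+
  have "constant_banks n nx s'" using banks by (simp add: constant_banks_def eq)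
  moreover have "f (s ''x'' 0) = s ''rep'' (s ''x'' 0)" using banks x(1) by (simp add: constant_banks_def)
  then have "state_inv {} True s' L"
    unfolding state_inv_def eq
    using inv_arrive[OF inv[unfolded state_inv_def] P _ x(2-4), of "s' ''mark''" "s' ''queue''" "s' ''qt'' 0"]
      1(1) x(1) verts by simp
  moreover have "lists_inv n nx s' L"
    unfolding lists_inv_def eq using lists 1(1) by simp
  moreover have "clock n k0 k' s' L"
    using clock 1(1) unfolding clock_def eq by linarith
  ultimately show ?case unfolding prog_inv_def by blast
qed


text \<open>The result of the search. Its last clause attaches a cluster to one sink only; the
  reverse half-edge supplies the rest in \<open>sparse_connects\<close>.\<close>

definition sparse :: "nat \<Rightarrow> (nat \<Rightarrow> nat) \<Rightarrow> (nat \<Rightarrow> nat) \<Rightarrow> (nat \<Rightarrow> nat) \<Rightarrow> bool" where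
  "sparse K gu gv gw \<longleftrightarrow>
     (\<forall>k<K. \<exists>t<hn. gw k = hw t \<and> gv k = f (hv t) \<and> gu k \<in> cluster D (hu t)) \<and>
     (\<forall>k<K. \<forall>k'\<le>k. gw k' \<le> gw k) \<and>
     (\<forall>t<hn. \<forall>x\<in>cluster D (hu t). (x, f (hv t)) \<in> conn (emitted_le K gu gv gw (hw t)))"

lemma inv_sparse:
  assumes inv: "inv {} True h part lab qh qt queue mark gn gu gv gw L" and "qh = qt" "h = hn"
  shows "sparse gn gu gv gw"
  using inv_drained[OF inv assms(2)] invD(11,12)[OF inv] assms(3) unfolding sparse_def by blast

lemma wp_search_prog:
  assumes verts: "dverts D = {..<n}" and banks: "constant_banks n nx s"
    and lists: "\<And>v. linked nx (s ''afirst'' v) (bucket tail a v)"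
    and zero: "s ''h'' 0 = 0" "s ''qh'' 0 = 0" "s ''qt'' 0 = 0" "s ''gn'' 0 = 0" "s ''mark'' = (\<lambda>_. 0)"
  shows "wp search_prog (\<lambda>k' s'. k' \<le> k + 200 * hn + 200 * n + 200 * a + 40 \<and> s' ''gn'' 0 \<le> hn + a \<and>
    sparse (s' ''gn'' 0) (s' ''gu'') (s' ''gv'') (s' ''gw'')) k s"
  unfolding search_prog_def
proof (rule wp_While[where I = "\<lambda>k' s'. \<exists>L. prog_inv n nx k k' s' L" and
      B = "k + 200 * hn + 200 * n + 200 * a"], goal_cases)
  case 1
  have "state_inv {} True s (bucket tail a)"
    unfolding state_inv_def inv_def using zero by simp
  moreover have "(\<Sum>v<n. length (bucket tail a v)) \<le> a" by (rule sum_length_bucket) simp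
  ultimately have "prog_inv n nx k k s (bucket tail a)"
    using banks lists zero by (simp add: prog_inv_def lists_inv_def clock_def)
  then show ?case by blast
next
  case (2 k1 s1)
  then obtain L where I: "prog_inv n nx k k1 s1 L" by blast
  then have inv: "state_inv {} True s1 L" and clk: "clock n k k1 s1 L" by (simp_all add: prog_inv_def)
  \<comment> \<open>The clock is bounded because a vertex enters the queue only once, so
    \<open>qh\<close> never exceeds \<open>n\<close>.\<close>
  have "s1 ''h'' 0 \<le> hn" "s1 ''qh'' 0 \<le> s1 ''qt'' 0"
    using invD(1,4)[OF inv[unfolded state_inv_def]] .
  moreover have "s1 ''qt'' 0 \<le> n"
    using inv_queue_le[OF inv[unfolded state_inv_def]] verts by simp
  moreover have "k1 \<le> k + 200 * s1 ''h'' 0 + 200 * s1 ''qh'' 0 + 200 * a"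
    using clk unfolding clock_def by (meson add_leD1)
  ultimately show ?case by linarith
next
  case (4 k1 s1)
  then obtain L where I: "prog_inv n nx k k1 s1 L" by blast
  then have inv: "state_inv {} True s1 L" and clk: "clock n k k1 s1 L" and
    hn: "s1 ''hn'' 0 = hn" and "lists_inv n nx s1 L"
    by (simp_all add: prog_inv_def constant_banks_def)
  have le: "s1 ''h'' 0 \<le> hn" "s1 ''qh'' 0 \<le> s1 ''qt'' 0"
    using invD(1,4)[OF inv[unfolded state_inv_def]] .
  moreover have "s1 ''qt'' 0 \<le> n"
    using inv_queue_le[OF inv[unfolded state_inv_def]] verts by simp
  moreover have "s1 ''qh'' 0 = s1 ''qt'' 0" "s1 ''h'' 0 = hn"
    using 4 hn le by simp_all
  moreover have "sparse (s1 ''gn'' 0) (s1 ''gu'') (s1 ''gv'') (s1 ''gw'')"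
    using inv_sparse[OF inv[unfolded state_inv_def]] calculation by simp
  moreover have "k1 \<le> k + 200 * s1 ''h'' 0 + 200 * s1 ''qh'' 0 + 200 * a"
    using clk unfolding clock_def by (meson add_leD1)
  moreover have "s1 ''gn'' 0 \<le> s1 ''h'' 0 + a"
    using \<open>lists_inv n nx s1 L\<close> unfolding lists_inv_def by (meson add_leD1)
  ultimately show ?case by simp
next
  case (3 k1 s1)
  then obtain L where I: "prog_inv n nx k k1 s1 L" by blast
  define h where "h = s1 ''h'' 0"
  define qh where "qh = s1 ''qh'' 0"
  define y where "y = s1 ''queue'' qh"
  have banks1: "constant_banks n nx s1" and inv: "state_inv {} True s1 L"
    and lists1: "lists_inv n nx s1 L" and clk: "clock n k k1 s1 L"
    using I by (simp_all add: prog_inv_def)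
  have hn: "s1 ''hn'' 0 = hn" "s1 ''hu'' = hu" "s1 ''hv'' = hv" "s1 ''hw'' = hw" "s1 ''arc_head'' = head"
    "s1 ''anext'' = nx" and rep: "\<And>v. v < n \<Longrightarrow> s1 ''rep'' v = f v"
    using banks1 by (auto simp: constant_banks_def)
  have linked: "\<And>v. linked nx (s1 ''afirst'' v) (L v)"
    and gn: "s1 ''gn'' 0 + (\<Sum>v<n. length (L v)) \<le> h + a"
    using lists1 by (auto simp: lists_inv_def h_def)
  show ?case
  proof (cases "qh < s1 ''qt'' 0")
    case True
    have "y \<in> s1 ''queue'' ` {..<s1 ''qt'' 0}" using True by (simp add: y_def)
    then have y: "y < n" unfolding invD(6)[OF inv[unfolded state_inv_def]] verts by simp
    let ?s = "s1(''y'' := (s1 ''y'')(0 := y))"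
    show ?thesis
    proof (cases "0 < s1 ''afirst'' y")
      case pos: True
      define i where "i = s1 ''afirst'' y - 1"
      obtain js where Ly: "L y = i # js" and js: "linked nx (nx i) js"
        using linked[of y] pos unfolding i_def by (rule linked_pos)
      note pop = inv_pop_arc[OF inv[unfolded state_inv_def], folded qh_def, folded y_def, OF True Ly]
      have sum: "Suc (\<Sum>v<n. length ((L(y := js)) v)) = (\<Sum>v<n. length (L v))"
        using sum_length_tl[of "{..<n}" y L] y Ly by simp
      have step: "wp (pop_arc;; arrive) (\<lambda>k' s'. \<exists>L. prog_inv n nx k k' s' L) k2 ?s"
        if k2: "k2 \<le> k1 + 40" for k2
        unfolding wp_Seq
      proof (rule wp_conseq[OF wp_pop_arc], goal_cases)
        case (1 k3 s3)
        have frame: "s3 x = s1 x" if "x \<in> {''rep'', ''anext'', ''arc_head'', ''hn'', ''hu'', ''hv'', ''hw'',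
          ''h'', ''part'', ''lab'', ''qh'', ''qt'', ''queue'', ''mark'', ''gn'', ''gu'', ''gv'', ''gw''}" for x
        proof -
          have "x \<notin> writes pop_arc" "x \<noteq> ''y''" using that by (auto simp: writes_pop_arc)
          then show ?thesis using 1(2) by simp
        qed
        have eq: "s3 ''rep'' = s1 ''rep''" "s3 ''anext'' = s1 ''anext''" "s3 ''arc_head'' = s1 ''arc_head''"
          "s3 ''hn'' = s1 ''hn''" "s3 ''hu'' = s1 ''hu''" "s3 ''hv'' = s1 ''hv''" "s3 ''hw'' = s1 ''hw''"
          "s3 ''h'' = s1 ''h''" "s3 ''part'' = s1 ''part''" "s3 ''lab'' = s1 ''lab''"
          "s3 ''qh'' = s1 ''qh''" "s3 ''qt'' = s1 ''qt''" "s3 ''queue'' = s1 ''queue''"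
          "s3 ''mark'' = s1 ''mark''" "s3 ''gn'' = s1 ''gn''" "s3 ''gu'' = s1 ''gu''"
          "s3 ''gv'' = s1 ''gv''" "s3 ''gw'' = s1 ''gw''"
          by (rule frame, simp)+
        have s3: "k3 \<le> k2 + 30" "s3 ''afirst'' = (s1 ''afirst'')(y := nx i)" "s3 ''x'' 0 = head i"
          using 1(1) hn by (simp_all add: i_def)
        show ?case
        proof (rule wp_arrive_inv[where P = "{i}" and b = True and L = "L(y := js)", OF verts], goal_cases)
          case 1
          then show ?case using banks1 by (simp add: constant_banks_def eq)
        next
          case 2
          then show ?case using pop(1) by (simp add: state_inv_def eq qh_def)
        next
          case (3 j)
          then show ?case using pop(4) s3 by (simp add: eq)
        next
          case 4
          then show ?case using pop(3) s3 verts by simp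
        next
          case 5
          then show ?case using pop(2) by (simp add: eq)
        next
          case 6
          then show ?case using pop(5) s3 by (simp add: eq)
        next
          case 8
          then show ?case using linked js unfolding s3 by simp
        next
          case 9
          then show ?case using gn sum unfolding eq h_def by linarith
        next
          case 10
          then show ?case using clk sum s3(1) k2 unfolding clock_def eq by linarith
        qed simp
      qed
      show ?thesis
        unfolding wp_If wp_Seq[of "''y'' ::= Load ''queue'' (var ''qh'')"]
          wp_Store[of "''y''"]
        using True pos step by (simp add: qh_def[symmetric] y_def[symmetric])
    next
      case False
      then have Ly: "L y = []" using linked[of y] by (simp add: linked_0)
      note pop = inv_pop_vertex[OF inv[unfolded state_inv_def], folded qh_def, folded y_def, OF True Ly]
      have "prog_inv n nx k k2 (s1(''y'' := (s1 ''y'')(0 := y), ''qh'' := (s1 ''qh'')(0 := Suc qh))) L"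
        if "k2 \<le> k1 + 60" for k2
        unfolding prog_inv_def constant_banks_def state_inv_def lists_inv_def clock_def
        using banks1 pop lists1 clk that
        by (simp add: constant_banks_def lists_inv_def clock_def qh_def)
      then have "\<exists>L. prog_inv n nx k k2 (s1(''y'' := (s1 ''y'')(0 := y), ''qh'' := (s1 ''qh'')(0 := Suc qh))) L"
        if "k2 \<le> k1 + 60" for k2 using that by blast
      then show ?thesis using True False by (simp add: wp_simps qh_def[symmetric] y_def[symmetric])
    qed
  next
    case False
    have qq: "s1 ''qh'' 0 = s1 ''qt'' 0"
      using False invD(4)[OF inv[unfolded state_inv_def]] by (simp add: qh_def)
    have h: "h < hn" using 3(2) False hn by (simp add: qh_def h_def)
    have hv: "hu h < n" "hv h < n" using half[OF h] verts by auto
    have step: "wp (next_half;; arrive) (\<lambda>k' s'. \<exists>L. prog_inv n nx k k' s' L) k2 s1"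
      if k2: "k2 \<le> k1 + 40" for k2
      unfolding wp_Seq
    proof (rule wp_conseq[OF wp_next_half], goal_cases)
      case (1 k3 s3)
      have frame: "s3 x = s1 x" if "x \<in> {''rep'', ''anext'', ''arc_head'', ''hn'', ''hu'', ''hv'', ''hw'',
        ''qh'', ''qt'', ''queue'', ''mark'', ''gn'', ''gu'', ''gv'', ''gw'', ''afirst''}" for x
      proof -
        have "x \<notin> writes next_half" using that by (auto simp: writes_next_half)
        then show ?thesis using 1(2) by simp
      qed
      have eq: "s3 ''rep'' = s1 ''rep''" "s3 ''anext'' = s1 ''anext''" "s3 ''arc_head'' = s1 ''arc_head''"
        "s3 ''hn'' = s1 ''hn''" "s3 ''hu'' = s1 ''hu''" "s3 ''hv'' = s1 ''hv''" "s3 ''hw'' = s1 ''hw''"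
        "s3 ''qh'' = s1 ''qh''" "s3 ''qt'' = s1 ''qt''" "s3 ''queue'' = s1 ''queue''"
        "s3 ''mark'' = s1 ''mark''" "s3 ''gn'' = s1 ''gn''" "s3 ''gu'' = s1 ''gu''"
        "s3 ''gv'' = s1 ''gv''" "s3 ''gw'' = s1 ''gw''" "s3 ''afirst'' = s1 ''afirst''"
        by (rule frame, simp)+
      have s3: "k3 \<le> k2 + 40" "s3 ''x'' 0 = hu h" "s3 ''part'' 0 = f (hv h)" "s3 ''lab'' 0 = hw h"
        "s3 ''h'' 0 = Suc h"
        using 1(1) hn rep[OF hv(2)] by (simp_all add: h_def)
      show ?case
      proof (rule wp_arrive_inv[where P = "{}" and b = False and L = L, OF verts], goal_cases)
        case 1
        then show ?case using banks1 by (simp add: constant_banks_def eq)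
      next
        case 2
        then show ?case
          using inv_next[OF inv[unfolded state_inv_def] qq, folded h_def, OF h]
          by (simp add: state_inv_def eq s3)
      next
        case 8
        then show ?case using linked by (simp add: eq)
      next
        case 9
        then show ?case using gn unfolding eq s3 by linarith
      next
        case 10
        then show ?case using clk s3(1) k2 unfolding clock_def eq s3(5) h_def mult_Suc_right by linarith
      qed (simp_all add: s3 hv)
    qed
    show ?thesis
      unfolding wp_If using False step by (simp add: qh_def[symmetric])
  qed
qed

end

subsection \<open>Kruskal's algorithm\<close>

lemma merge_eq_iff:
  "(if x = a then b else x) = (if y = a then b else y) \<longleftrightarrow> x = y \<or> x = a \<and> b = y \<or> x = b \<and> a = y"
  by auto

text \<open>The edges are ordered by the labels \<open>gw\<close>, which only bound the weights from
  above: several compression edges of different weights may cover the same pair.\<close>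

locale kruskal =
  fixes V :: "nat set" and wt :: "nat set \<Rightarrow> nat" and n :: nat and gu gv gw :: "nat \<Rightarrow> nat"
  assumes V: "finite V" "V \<noteq> {}"
    and ends: "\<And>k. k < n \<Longrightarrow> gu k \<in> V \<and> gv k \<in> V"
    and weight: "\<And>k. k < n \<Longrightarrow> wt {gu k, gv k} \<le> gw k"
    and sorted: "\<And>k k'. k < n \<Longrightarrow> k' \<le> k \<Longrightarrow> gw k' \<le> gw k"
begin

text \<open>The number of levels in the potential, chosen by \<open>less_tarjan_inverse_ack\<close>
  so that all ranks lie below \<open>tarjan depth 1\<close>.\<close>

definition depth :: nat where "depth = inverse_ack (card V) + 2"

text \<open>Ranks are stored decremented by one.\<close>

definition inv :: "nat \<Rightarrow> (nat \<Rightarrow> nat) \<Rightarrow> (nat \<Rightarrow> nat) \<Rightarrow> (nat \<Rightarrow> nat) \<Rightarrow> nat set set \<Rightarrow> bool" where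
  "inv i p rk R T \<longleftrightarrow> i \<le> n \<and> trees V p (\<lambda>x. Suc (rk x)) R \<and>
     (\<forall>x\<in>V. \<forall>y\<in>V. R x = R y \<longleftrightarrow> (x, y) \<in> conn T) \<and>
     (\<forall>x\<in>V. rk x \<le> card T) \<and> acyclic_edges T \<and> T \<subseteq> (\<lambda>k. {gu k, gv k}) ` {..<i} \<and>
     (\<forall>k<i. (gu k, gv k) \<in> conn {e \<in> T. wt e \<le> gw k})"

lemma invD:
  assumes "inv i p rk R T"
  shows "i \<le> n" "trees V p (\<lambda>x. Suc (rk x)) R" "\<forall>x\<in>V. \<forall>y\<in>V. R x = R y \<longleftrightarrow> (x, y) \<in> conn T"
    "\<forall>x\<in>V. rk x \<le> card T" "acyclic_edges T" "T \<subseteq> (\<lambda>k. {gu k, gv k}) ` {..<i}"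
    "\<forall>k<i. (gu k, gv k) \<in> conn {e \<in> T. wt e \<le> gw k}"
  using assms[unfolded inv_def] by - (elim conjE, assumption)+

lemma inv_finite: "inv i p rk R T \<Longrightarrow> finite T"
  by (rule finite_subset[OF invD(6)]) simp_all

lemma inv_pairs:
  assumes "inv i p rk R T"
  shows "T \<subseteq> pairs V V"
proof
  fix e assume "e \<in> T"
  then obtain k where "k < i" "e = {gu k, gv k}" using invD(6)[OF assms] by auto
  then show "e \<in> pairs V V" using ends[of k] invD(1)[OF assms] by (auto simp: pairs_def)
qed

text \<open>Ranks grow only with links, and each link adds an edge to a forest on \<open>V\<close>,
  which has fewer than \<open>|V|\<close> edges.\<close>

lemma inv_rank:
  assumes "inv i p rk R T" "x \<in> V"
  shows "1 \<le> Suc (rk x) \<and> Suc (rk x) < tarjan depth 1"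
proof -
  have "card T < card V"
    using acyclic_edges_card_less[OF V(1) inv_pairs[OF assms(1)] invD(5)[OF assms(1)] V(2)] .
  moreover have "rk x \<le> card T" using invD(4)[OF assms(1)] assms(2) by blast
  ultimately show ?thesis using less_tarjan_inverse_ack[of "card V"] by (simp add: depth_def)
qed

definition energy :: "(nat \<Rightarrow> nat) \<Rightarrow> (nat \<Rightarrow> nat) \<Rightarrow> nat" where
  "energy p rk = potential V depth p (\<lambda>x. Suc (rk x))"

lemma inv_compress:
  assumes inv: "inv i p rk R T" and x: "x \<in> V" and path: "root_path p x l (R x)"
  shows "inv i (compress p x l (R x)) rk R T"
    and "l + energy (compress p x l (R x)) rk \<le> energy p rk + depth"
proof -
  show "inv i (compress p x l (R x)) rk R T"
    using inv trees_compress[OF invD(2)[OF inv] x path] unfolding inv_def by simp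
  show "l + energy (compress p x l (R x)) rk \<le> energy p rk + depth"
    unfolding energy_def
    by (rule compress_potential[OF invD(2)[OF inv] x path]) (rule inv_rank[OF inv])
qed

text \<open>The potential needs ranks of at least 1, whereas memory starts at 0. An initial root of
  rank 1 has potential \<open>2 * depth\<close>.\<close>

lemma inv_init:
  assumes "\<And>v. v \<in> V \<Longrightarrow> p v = v"
  shows "inv 0 p (\<lambda>_. 0) id {}" and "energy p (\<lambda>_. 0) = 2 * depth * card V"
proof -
  show "inv 0 p (\<lambda>_. 0) id {}"
    using assms V unfolding inv_def trees_def
    by (auto simp: conn_def acyclic_edges_def)
  have "energy p (\<lambda>_. 0) = (\<Sum>x\<in>V. pot depth (Suc 0) 0)"
    unfolding energy_def potential_def using assms by (intro sum.cong) auto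
  then show "energy p (\<lambda>_. 0) = 2 * depth * card V" by (simp add: pot_zero)
qed

lemma inv_le_weight:
  assumes inv: "inv i p rk R T" and i: "i < n"
  shows "{e \<in> T. wt e \<le> gw i} = T"
proof -
  have "wt e \<le> gw i" if e: "e \<in> T" for e
  proof -
    have "e \<in> (\<lambda>k. {gu k, gv k}) ` {..<i}" using e invD(6)[OF inv] by (rule subsetD[rotated])
    then obtain k where "k < i" "e = {gu k, gv k}" by auto
    then show ?thesis using weight[of k] sorted[of i k] i by simp
  qed
  then show ?thesis by blast
qed

lemma inv_skip:
  assumes inv: "inv i p rk R T" and i: "i < n" and R: "R (gu i) = R (gv i)"
  shows "inv (Suc i) p rk R T"
proof -
  have "(gu i, gv i) \<in> conn {e \<in> T. wt e \<le> gw i}"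
    using invD(3)[OF inv] ends[OF i] R inv_le_weight[OF inv i] by simp
  then have "\<forall>k<Suc i. (gu k, gv k) \<in> conn {e \<in> T. wt e \<le> gw k}"
    using invD(7)[OF inv] by (simp add: All_less_Suc_iff)
  moreover have "T \<subseteq> (\<lambda>k. {gu k, gv k}) ` {..<Suc i}" using invD(6)[OF inv] by (auto simp: lessThan_Suc)
  ultimately show ?thesis using invD(2-5)[OF inv] i unfolding inv_def by simp
qed

text \<open>The two roots form an unordered pair, because their ranks, and not the direction of the
  edge, decide which becomes the child.\<close>

lemma inv_link:
  assumes inv: "inv i p rk R T" and i: "i < n"
    and ab: "{R (gu i), R (gv i)} = {a, b}" "a \<noteq> b" and rk: "rk a \<le> rk b"
  shows "inv (Suc i) (p(a := b)) (rk(b := Suc (rk b))) (\<lambda>z. if R z = a then b else R z)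
      (insert {gu i, gv i} T)"
    and "energy (p(a := b)) (rk(b := Suc (rk b))) \<le> energy p rk + depth"
    and "{gu i, gv i} \<notin> T"
proof -
  let ?R = "\<lambda>z. if R z = a then b else R z" and ?T = "insert {gu i, gv i} T"
  note tr = invD(2)[OF inv]
  have uv: "gu i \<in> V" "gv i \<in> V" using ends[OF i] by auto
  have "a \<in> {R (gu i), R (gv i)}" "b \<in> {R (gu i), R (gv i)}" unfolding ab by auto
  then have a: "a \<in> V" "p a = a" and b: "b \<in> V" "p b = b"
    using trees_root[OF tr uv(1)] trees_root[OF tr uv(2)] by auto
  have rk_eq: "(\<lambda>x. Suc ((rk(b := Suc (rk b))) x)) = (\<lambda>x. Suc (rk x))(b := Suc (Suc (rk b)))"
    by (rule ext) simp
  have trees': "trees V (p(a := b)) (\<lambda>x. Suc ((rk(b := Suc (rk b))) x)) ?R"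
    unfolding rk_eq using trees_link[OF tr a(1) b(1) ab(2) a(2) b(2)] rk by simp
  show "energy (p(a := b)) (rk(b := Suc (rk b))) \<le> energy p rk + depth"
    unfolding energy_def rk_eq
    using link_potential[OF V(1) a(1) b(1) ab(2) a(2) b(2), of "\<lambda>x. Suc (rk x)"] rk by simp
  have cases: "R (gu i) = a \<and> R (gv i) = b \<or> R (gu i) = b \<and> R (gv i) = a"
    using ab(1) unfolding doubleton_eq_iff .
  then have ends_neq: "R (gu i) \<noteq> R (gv i)" using ab(2) by metis
  have Req: "R x = R y \<longleftrightarrow> (x, y) \<in> conn T" if "x \<in> V" "y \<in> V" for x y
    using invD(3)[OF inv, rule_format, OF that] .
  have notin: "(gu i, gv i) \<notin> conn T" using Req[OF uv] ends_neq by simp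
  show new: "{gu i, gv i} \<notin> T" using notin conn_edge[of "gu i" "gv i" T] by blast
  have R': "?R x = ?R y \<longleftrightarrow> (x, y) \<in> conn ?T" if "x \<in> V" "y \<in> V" for x y
  proof -
    have *: "(x, y) \<in> conn ?T \<longleftrightarrow>
        R x = R y \<or> R x = R (gu i) \<and> R (gv i) = R y \<or> R x = R (gv i) \<and> R (gu i) = R y"
      unfolding conn_insert_iff by (simp only: Req that uv)
    have "(x, y) \<in> conn ?T \<longleftrightarrow> R x = R y \<or> R x = a \<and> b = R y \<or> R x = b \<and> a = R y"
      using cases
    proof
      assume "R (gu i) = a \<and> R (gv i) = b"
      then show ?thesis using * by simp
    next
      assume "R (gu i) = b \<and> R (gv i) = a"
      then show ?thesis using * by (simp add: disj_commute)
    qed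
    then show ?thesis unfolding merge_eq_iff by (rule sym)
  qed
  have card: "card ?T = Suc (card T)" using new inv_finite[OF inv] by simp
  have 1: "(rk(b := Suc (rk b))) x \<le> card ?T" if "x \<in> V" for x
  proof -
    have "rk x \<le> card T" "rk b \<le> card T" using invD(4)[OF inv] that b(1) by blast+
    then show ?thesis unfolding card by simp
  qed
  have 2: "acyclic_edges ?T" by (rule acyclic_edges_insert[OF invD(5)[OF inv] notin])
  have 3: "?T \<subseteq> (\<lambda>k. {gu k, gv k}) ` {..<Suc i}" using invD(6)[OF inv] by (auto simp: lessThan_Suc)
  have 4: "(gu k, gv k) \<in> conn {e \<in> ?T. wt e \<le> gw k}" if "k < Suc i" for k
  proof (cases "k = i")
    case True
    then show ?thesis using weight[OF i] by (intro conn_edge) auto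
  next
    case False
    then have "(gu k, gv k) \<in> conn {e \<in> T. wt e \<le> gw k}" using that invD(7)[OF inv] by simp
    moreover have "{e \<in> T. wt e \<le> gw k} \<subseteq> {e \<in> ?T. wt e \<le> gw k}" by auto
    ultimately show ?thesis using conn_mono by blast
  qed
  show "inv (Suc i) (p(a := b)) (rk(b := Suc (rk b))) ?R ?T"
    unfolding inv_def
  proof (intro conjI ballI allI impI)
    show "Suc i \<le> n" using i by simp
    show "trees V (p(a := b)) (\<lambda>x. Suc ((rk(b := Suc (rk b))) x)) ?R" by (rule trees')
  qed (rule R' 1 2 3 4; assumption)+
qed

end

definition link :: com where
  "link =
     If (Less (Load ''rank'' (var ''fr'')) (Load ''rank'' (var ''rx'')))
       (Store ''par'' (var ''fr'') (var ''rx'');;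
        Store ''rank'' (var ''rx'') (Plus (Load ''rank'' (var ''rx'')) (Num 1)))
       (Store ''par'' (var ''rx'') (var ''fr'');;
        Store ''rank'' (var ''fr'') (Plus (Load ''rank'' (var ''fr'')) (Num 1)));;
     Store ''out_fst'' (var ''out_len'') (Load ''gu'' (var ''k''));;
     Store ''out_snd'' (var ''out_len'') (Load ''gv'' (var ''k''));;
     incr ''out_len''"

definition find_ends :: com where
  "find_ends =
     ''fx'' ::= Load ''gu'' (var ''k'');;
     find_root ''par'';;
     ''rx'' ::= var ''fr'';;
     ''fx'' ::= Load ''gv'' (var ''k'');;
     find_root ''par''"

definition kruskal_prog :: com where
  "kruskal_prog =
     ''k'' ::= Num 0;;
     While (Less (var ''k'') (var ''gn''))
       (find_ends;;
        If (neq (var ''rx'') (var ''fr'')) link Skip;;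
        incr ''k'')"

lemma output_edges_Suc:
  "s' ''out_fst'' = (s ''out_fst'')(s ''out_len'' 0 := x) \<Longrightarrow>
   s' ''out_snd'' = (s ''out_snd'')(s ''out_len'' 0 := y) \<Longrightarrow>
   s' ''out_len'' 0 = Suc (s ''out_len'' 0) \<Longrightarrow> output_edges s' = output_edges s @ [{x, y}]"
  by (simp add: output_edges_def)

lemma wp_link:
  fixes s :: state
  defines "x \<equiv> s ''rx'' 0" and "y \<equiv> s ''fr'' 0" and "rk \<equiv> s ''rank''"
  defines "a \<equiv> if rk y < rk x then y else x" and "b \<equiv> if rk y < rk x then x else y"
  shows "wp link (\<lambda>k' s'. k' \<le> k + 80 \<and> s' ''par'' = (s ''par'')(a := b) \<and>
    s' ''rank'' = rk(b := Suc (rk b)) \<and>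
    output_edges s' = output_edges s @ [{s ''gu'' (s ''k'' 0), s ''gv'' (s ''k'' 0)}]) k s"
proof -
  have "wp link (\<lambda>k' s'. k' \<le> k + 80 \<and> s' ''par'' = (s ''par'')(a := b) \<and>
    s' ''rank'' = rk(b := Suc (rk b)) \<and>
    s' ''out_fst'' = (s ''out_fst'')(s ''out_len'' 0 := s ''gu'' (s ''k'' 0)) \<and>
    s' ''out_snd'' = (s ''out_snd'')(s ''out_len'' 0 := s ''gv'' (s ''k'' 0)) \<and>
    s' ''out_len'' 0 = Suc (s ''out_len'' 0)) k s"
    by (simp add: link_def wp_simps a_def b_def x_def y_def rk_def)
  then show ?thesis
    by (rule wp_conseq) (use output_edges_Suc in blast)
qed

lemma writes_link: "writes link = {''par'', ''rank'', ''out_fst'', ''out_snd'', ''out_len''}"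
  by (auto simp: link_def)

lemma writes_find_ends: "writes find_ends = {''fx'', ''fr'', ''ft'', ''par'', ''rx''}"
  by (auto simp: find_ends_def)

section \<open>Running time of the union-find loop\<close>

context kruskal
begin

text \<open>The second search runs in the forest compressed by the first. Compression preserves
  \<open>R\<close>, so the stored root of the first end remains valid.\<close>

lemma wp_find_ends:
  assumes inv: "inv (s ''k'' 0) (s ''par'') (s ''rank'') R T"
    and i: "i = s ''k'' 0" "i < n" and g: "s ''gu'' = gu" "s ''gv'' = gv"
  shows "wp find_ends (\<lambda>k' s'.
    k' + 60 * energy (s' ''par'') (s ''rank'') \<le> k + 60 * energy (s ''par'') (s ''rank'') + 120 * depth + 200 \<and>
    inv i (s' ''par'') (s ''rank'') R T \<and> s' ''rx'' 0 = R (gu i) \<and> s' ''fr'' 0 = R (gv i)) k s"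
proof -
  have uv: "gu i \<in> V" "gv i \<in> V" using ends[OF i(2)] by auto
  note inv0 = inv[folded i(1)]
  let ?p = "s ''par''" and ?rk = "s ''rank''"
  obtain l where path: "root_path ?p (gu i) l (R (gu i))"
    using trees_root_path[OF invD(2)[OF inv0] uv(1)] by blast
  let ?p1 = "compress ?p (gu i) l (R (gu i))"
  note c1 = inv_compress[OF inv0 uv(1) path]
  obtain l' where path': "root_path ?p1 (gv i) l' (R (gv i))"
    using trees_root_path[OF invD(2)[OF c1(1)] uv(2)] by blast
  let ?p2 = "compress ?p1 (gv i) l' (R (gv i))"
  note c2 = inv_compress[OF c1(1) uv(2) path']
  let ?s = "s(''fx'' := (s ''fx'')(0 := gu i))"
  have "wp (find_root ''par'')
      (\<lambda>k' s'. wp (''rx'' ::= var ''fr'';; ''fx'' ::= Load ''gv'' (var ''k'');; find_root ''par'')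
        (\<lambda>k' s'. k' \<le> k + 60 * l + 60 * l' + 200 \<and> s' ''par'' = ?p2 \<and>
          s' ''rx'' 0 = R (gu i) \<and> s' ''fr'' 0 = R (gv i)) k' s') k1 ?s"
    if k1: "k1 \<le> k + 20" for k1
  proof (rule wp_conseq[OF wp_find[where l = l and r = "R (gu i)"]], goal_cases)
    case 1
    then show ?case using path by simp
  next
    case (3 k2 s2)
    then have s2: "k2 \<le> k1 + 60 * l + 60" "s2 ''par'' = ?p1" "s2 ''fr'' 0 = R (gu i)"
      "s2 ''k'' = s ''k''" "s2 ''gv'' = gv"
      using g by simp_all
    let ?s2 = "s2(''rx'' := (s2 ''rx'')(0 := R (gu i)), ''fx'' := (s2 ''fx'')(0 := gv i))"
    have "wp (find_root ''par'') (\<lambda>k' s'. k' \<le> k + 60 * l + 60 * l' + 200 \<and> s' ''par'' = ?p2 \<and>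
          s' ''rx'' 0 = R (gu i) \<and> s' ''fr'' 0 = R (gv i)) k3 ?s2"
      if k3: "k3 \<le> k2 + 20" for k3
    proof (rule wp_conseq[OF wp_find[where l = l' and r = "R (gv i)"]], goal_cases)
      case 1
      then show ?case using path' s2 by simp
    next
      case (3 k4 s4)
      then show ?case using s2 k1 k3 by simp
    qed simp
    then show ?case using s2 i by (simp add: wp_simps)
  qed simp
  then have "wp find_ends
        (\<lambda>k' s'. k' \<le> k + 60 * l + 60 * l' + 200 \<and> s' ''par'' = ?p2 \<and>
          s' ''rx'' 0 = R (gu i) \<and> s' ''fr'' 0 = R (gv i)) k s"
    unfolding find_ends_def using g i by (subst wp_Seq, subst wp_Store, subst wp_Seq) simp
  then show ?thesis
  proof (rule wp_conseq, goal_cases)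
    case (1 k' s')
    then show ?case using c1(2) c2 by auto
  qed
qed

text \<open>The clock is coupled with 60 times the potential. Two searches and a link raise the sum
  by \<open>60 * depth\<close> each, apart from constants, which makes \<open>180 * depth\<close>
  per edge; \<open>120 * depth * card V\<close> is 60 times the initial potential.\<close>

lemma wp_kruskal_prog:
  assumes g: "s ''gn'' 0 = n" "s ''gu'' = gu" "s ''gv'' = gv"
    and par: "\<And>v. v \<in> V \<Longrightarrow> s ''par'' v = v"
    and zero: "s ''rank'' = (\<lambda>_. 0)" "s ''out_len'' 0 = 0"
  shows "wp kruskal_prog (\<lambda>k' s'.
    k' \<le> k + (180 * depth + 500) * n + 120 * depth * card V + 40 \<and> distinct (output_edges s') \<and>
    (\<exists>p rk R. inv n p rk R (set (output_edges s')))) k s"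
proof -
  define Inv where "Inv k' s' \<longleftrightarrow> s' ''gn'' 0 = n \<and> s' ''gu'' = gu \<and> s' ''gv'' = gv \<and>
    distinct (output_edges s') \<and>
    (\<exists>R. inv (s' ''k'' 0) (s' ''par'') (s' ''rank'') R (set (output_edges s'))) \<and>
    k' + 60 * energy (s' ''par'') (s' ''rank'') \<le>
      k + (180 * depth + 500) * s' ''k'' 0 + 120 * depth * card V + 4"
    for k' :: nat and s' :: state
  have out_cong: "output_edges s' = output_edges s''"
    if "s' ''out_fst'' = s'' ''out_fst''" "s' ''out_snd'' = s'' ''out_snd''" "s' ''out_len'' = s'' ''out_len''"
    for s' s'' :: state using that by (simp add: output_edges_def)
  have le: "Inv k' s' \<Longrightarrow> s' ''k'' 0 \<le> n" for k' s'
    unfolding Inv_def by (elim conjE exE) (rule invD(1))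
  show ?thesis
    unfolding kruskal_prog_def wp_Seq[of "''k'' ::= Num 0"] wp_Store
  proof (rule wp_While[where I = Inv and B = "k + (180 * depth + 500) * n + 120 * depth * card V + 4"],
      goal_cases)
    case 1
    have "output_edges s = []" using zero by (simp add: output_edges_def)
    moreover have "output_edges (s(''k'' := (s ''k'')(0 := 0))) = output_edges s"
      by (rule out_cong) simp_all
    ultimately show ?case
      using g zero inv_init[OF par] by (auto simp: Inv_def)
  next
    case (2 k1 s1)
    have "k1 \<le> k + (180 * depth + 500) * s1 ''k'' 0 + 120 * depth * card V + 4"
      using 2 unfolding Inv_def by (meson add_leD1)
    also have "\<dots> \<le> k + (180 * depth + 500) * n + 120 * depth * card V + 4"
      by (intro add_mono mult_le_mono order.refl le[OF 2])
    finally show ?case .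
  next
    case (4 k1 s1)
    then have "s1 ''k'' 0 = n" using le[OF 4(1)] by (simp add: Inv_def)
    then show ?case using 4(1) unfolding Inv_def by auto
  next
    case (3 k1 s1)
    define i where "i = s1 ''k'' 0"
    define T where "T = set (output_edges s1)"
    let ?rk = "s1 ''rank''"
    obtain R where inv: "inv i (s1 ''par'') ?rk R T" using 3(1) unfolding Inv_def i_def T_def by (elim conjE exE)
    have g1: "s1 ''gn'' 0 = n" "s1 ''gu'' = gu" "s1 ''gv'' = gv" and dist: "distinct (output_edges s1)"
      and clk: "k1 + 60 * energy (s1 ''par'') ?rk \<le>
        k + (180 * depth + 500) * i + 120 * depth * card V + 4"
      using 3(1) by (simp_all add: Inv_def i_def)
    have i: "i < n" using 3(2) g1 by (simp add: i_def)
    have uv: "gu i \<in> V" "gv i \<in> V" using ends[OF i] by auto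
    show ?case
      unfolding wp_Seq[of find_ends]
    proof (rule wp_conseq[OF wp_find_ends[OF inv[unfolded i_def], of i]], goal_cases)
      case (5 k2 s2)
      have s2: "k2 + 60 * energy (s2 ''par'') ?rk \<le> k1 + 60 * energy (s1 ''par'') ?rk + 120 * depth + 300"
        "inv i (s2 ''par'') ?rk R T" "s2 ''rx'' 0 = R (gu i)" "s2 ''fr'' 0 = R (gv i)"
        using 5(1) by auto
      have frame: "s2 ''gn'' = s1 ''gn''" "s2 ''gu'' = gu" "s2 ''gv'' = gv" "s2 ''k'' = s1 ''k''"
        "s2 ''rank'' = ?rk" "s2 ''out_fst'' = s1 ''out_fst''" "s2 ''out_snd'' = s1 ''out_snd''"
        "s2 ''out_len'' = s1 ''out_len''"
        using 5(2) g1 by (simp_all add: writes_find_ends)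
      have out: "output_edges s2 = output_edges s1" by (rule out_cong) (simp_all add: frame)
      show ?case
      proof (cases "R (gu i) = R (gv i)")
        case True
        have "Inv k3 (s2(''k'' := (s2 ''k'')(0 := Suc i)))" if "k3 \<le> k2 + 60" for k3
        proof -
          have "output_edges (s2(''k'' := (s2 ''k'')(0 := Suc i))) = output_edges s1"
            by (rule out_cong) (simp_all add: frame)
          then show ?thesis
            using inv_skip[OF s2(2) i True] dist g1 frame s2(1) clk that
            unfolding Inv_def T_def by auto
        qed
        then show ?thesis using True s2(3,4) frame by (simp add: wp_simps i_def)
      next
        case False
        let ?a = "if ?rk (R (gv i)) < ?rk (R (gu i)) then R (gv i) else R (gu i)"
        let ?b = "if ?rk (R (gv i)) < ?rk (R (gu i)) then R (gu i) else R (gv i)"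
        have "wp link (\<lambda>k' s'. wp (incr ''k'') Inv k' s') k3 s2" if k3: "k3 \<le> k2 + 60" for k3
        proof (rule wp_conseq[OF wp_link], goal_cases)
          case (1 k4 s4)
          have s4: "k4 \<le> k3 + 80" "s4 ''par'' = (s2 ''par'')(?a := ?b)"
            "s4 ''rank'' = ?rk(?b := Suc (?rk ?b))"
            "output_edges s4 = output_edges s1 @ [{gu i, gv i}]"
            using 1(1) s2(3,4) frame out by (simp_all add: i_def)
          have frame4: "s4 ''gn'' = s1 ''gn''" "s4 ''gu'' = gu" "s4 ''gv'' = gv" "s4 ''k'' = s1 ''k''"
            using 1(2) frame by (simp_all add: writes_link)
          have ab: "{R (gu i), R (gv i)} = {?a, ?b}" "?a \<noteq> ?b" "?rk ?a \<le> ?rk ?b"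
            using False by auto
          note L = inv_link[OF s2(2) i ab]
          have "Inv k5 (s4(''k'' := (s4 ''k'')(0 := Suc i)))" if "k5 \<le> k4 + 60" for k5
          proof -
            have "output_edges (s4(''k'' := (s4 ''k'')(0 := Suc i))) = output_edges s4"
              by (rule out_cong) simp_all
            then have o: "output_edges (s4(''k'' := (s4 ''k'')(0 := Suc i))) =
                output_edges s1 @ [{gu i, gv i}]" using s4(4) by simp
            have "set (output_edges s1 @ [{gu i, gv i}]) = insert {gu i, gv i} T" by (simp add: T_def)
            moreover have "distinct (output_edges s1 @ [{gu i, gv i}])"
              using dist L(3) by (simp add: T_def)
            moreover have "k5 + 60 * energy ((s2 ''par'')(?a := ?b)) (?rk(?b := Suc (?rk ?b))) \<le>
               k + (180 * depth + 500) * Suc i + 120 * depth * card V + 4"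
              using L(2) s2(1) clk that s4(1) k3 by simp
            ultimately show ?thesis
              unfolding Inv_def o using L(1) frame4 g1 s4(2,3) by auto
          qed
          then show ?case using frame4 by (simp add: wp_Store i_def)
        qed
        then show ?thesis
          unfolding wp_Seq wp_If using False s2(3,4) by (simp add: linorder_neq_iff)
      qed
    qed (use i g1 i_def in simp_all)
  qed
qed

end

section \<open>Correctness of the sparse graph\<close>

lemma graph_connected_conn: "graph_connected V E \<longleftrightarrow> V \<noteq> {} \<and> (\<forall>u\<in>V. \<forall>v\<in>V. (u, v) \<in> conn E)"
  by (simp add: graph_connected_def conn_def)

lemma half_edgesD:
  assumes "half_edges m u v w hn hu hv hw"
  shows "\<forall>t<hn. \<forall>t'\<le>t. hw t' \<le> hw t"
    and "\<forall>t<hn. \<exists>e<m. hw t = w e \<and> (hu t = u e \<and> hv t = v e \<or> hu t = v e \<and> hv t = u e)"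
    and "\<forall>e<m. (\<exists>t<hn. hu t = u e \<and> hv t = v e \<and> hw t = w e) \<and>
      (\<exists>t<hn. hu t = v e \<and> hv t = u e \<and> hw t = w e)"
  using assms[unfolded half_edges_def] by - (elim conjE, assumption)+

locale compressed_graph = search +
  fixes G :: "nat wgraph" and m :: nat and u v w :: "nat \<Rightarrow> nat"
  assumes G: "weighted_graph G" "graph_connected (verts G) (edges G)"
    and D: "weighted_dag_compression D G"
    and edge: "\<And>e. e < m \<Longrightarrow> {u e, v e} \<in> dedges D \<and> dweight D {u e, v e} = w e"
    and edges: "\<And>e. e \<in> dedges D \<Longrightarrow> \<exists>i<m. e = {u i, v i}"
    and halves: "half_edges m u v w hn hu hv hw"
begin

lemma comp: "undirected_dag_compression D G"
  using D by (simp add: weighted_dag_compression_def)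

lemma finite_dedges: "finite (dedges D)"
  and sinks: "sinks D = verts G"
  and edges_G: "edges G = \<Union> {pairs (cluster D u) (cluster D v) | u v. {u, v} \<in> dedges D}"
proof -
  have fin: "finite (dverts D)"
    using comp by (simp add: undirected_dag_compression_def)
  show "sinks D = verts G" and "edges G = \<Union> {pairs (cluster D u) (cluster D v) | u v. {u, v} \<in> dedges D}"
    using comp by (simp_all add: undirected_dag_compression_def)
  have "dedges D \<subseteq> pairs (dverts D) (dverts D)"
    using comp by (simp add: undirected_dag_compression_def)
  then show "finite (dedges D)" by (rule finite_subset) (intro finite_pairs fin)
qed

section \<open>Edges of the graph and the compression edges that cover them\<close>

lemma cluster_verts: "x \<in> cluster D y \<Longrightarrow> x \<in> verts G"
  using sinks by (auto simp: cluster_def)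

definition covering :: "nat \<Rightarrow> nat \<Rightarrow> nat set" where
  "covering x y = {dweight D {u, v} | u v. {u, v} \<in> dedges D \<and> x \<in> cluster D u \<and> y \<in> cluster D v}"

lemma finite_covering: "finite (covering x y)"
  by (rule finite_subset[of _ "dweight D ` dedges D"]) (auto simp: covering_def finite_dedges)

lemma weight_eq: "{x, y} \<in> edges G \<Longrightarrow> weight G {x, y} = Min (covering x y)"
  using D by (simp add: weighted_dag_compression_def covering_def)

lemma covered_edge:
  assumes "{p, q} \<in> dedges D" "x \<in> cluster D p" "y \<in> cluster D q"
  shows "{x, y} \<in> edges G" and "weight G {x, y} \<le> dweight D {p, q}"
proof -
  have "{x, y} \<in> pairs (cluster D p) (cluster D q)" using assms by (auto simp: pairs_def)
  then show e: "{x, y} \<in> edges G" unfolding edges_G using assms(1) by (intro UnionI) auto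
  have "dweight D {p, q} \<in> covering x y" using assms by (auto simp: covering_def)
  then show "weight G {x, y} \<le> dweight D {p, q}"
    unfolding weight_eq[OF e] by (rule Min_le[OF finite_covering])
qed

text \<open>The pair may be covered with its ends exchanged, but compression edges are unordered, so
  \<open>covering x y\<close> is nonempty in either case and its minimum is attained.\<close>

lemma edge_covered:
  assumes "{x, y} \<in> edges G"
  obtains p q where "{p, q} \<in> dedges D" "x \<in> cluster D p" "y \<in> cluster D q"
    "weight G {x, y} = dweight D {p, q}"
proof -
  obtain p q where ab: "{p, q} \<in> dedges D" "{x, y} \<in> pairs (cluster D p) (cluster D q)"
    using assms unfolding edges_G by blast
  have "x \<in> cluster D p \<and> y \<in> cluster D q \<or> y \<in> cluster D p \<and> x \<in> cluster D q"
    using ab(2) by (auto simp: pairs_def doubleton_eq_iff)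
  moreover have "{q, p} \<in> dedges D" using ab(1) by (simp add: insert_commute)
  ultimately have "\<exists>w. w \<in> covering x y" using ab(1) unfolding covering_def mem_Collect_eq by blast
  then have "covering x y \<noteq> {}" by blast
  then have "weight G {x, y} \<in> covering x y"
    unfolding weight_eq[OF assms] by (rule Min_in[OF finite_covering])
  then obtain p' q' where "weight G {x, y} = dweight D {p', q'}" "{p', q'} \<in> dedges D"
    "x \<in> cluster D p'" "y \<in> cluster D q'" unfolding covering_def mem_Collect_eq by (elim exE conjE)
  then show thesis by (intro that)
qed

lemma sparseD:
  assumes "sparse K gu gv gw"
  shows "\<forall>k<K. \<exists>t<hn. gw k = hw t \<and> gv k = f (hv t) \<and> gu k \<in> cluster D (hu t)"
    and "\<forall>k<K. \<forall>k'\<le>k. gw k' \<le> gw k"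
    and "\<forall>t<hn. \<forall>x\<in>cluster D (hu t). (x, f (hv t)) \<in> conn (emitted_le K gu gv gw (hw t))"
  using assms[unfolded sparse_def] by - (elim conjE, assumption)+

lemma sparse_edge:
  assumes "sparse K gu gv gw" "k < K"
  shows "gu k \<in> verts G" "gv k \<in> verts G" "{gu k, gv k} \<in> edges G" "weight G {gu k, gv k} \<le> gw k"
proof -
  obtain t where t: "t < hn" "gw k = hw t" "gv k = f (hv t)" "gu k \<in> cluster D (hu t)"
    using sparseD(1)[OF assms(1)] assms(2) by blast
  have "\<exists>e<m. hw t = w e \<and> (hu t = u e \<and> hv t = v e \<or> hu t = v e \<and> hv t = u e)"
    using half_edgesD(2)[OF halves] t(1) by blast
  then obtain e where e: "e < m" "hw t = w e" "{hu t, hv t} = {u e, v e}"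
    by (auto simp: insert_commute)
  have gv: "gv k \<in> cluster D (hv t)"
    using reps half[OF t(1)] t(3) unfolding representatives_def by simp
  show "gu k \<in> verts G" "gv k \<in> verts G" using cluster_verts t(4) gv by auto
  show "{gu k, gv k} \<in> edges G" "weight G {gu k, gv k} \<le> gw k"
    using covered_edge[OF _ t(4) gv] edge[OF e(1)] e t(2) by auto
qed

lemma half_edge:
  assumes "{p, q} \<in> dedges D"
  obtains t where "t < hn" "hu t = p" "hv t = q" "hw t = dweight D {p, q}"
proof -
  obtain e where e: "e < m" "{p, q} = {u e, v e}" using edges[OF assms] by blast
  then have w: "w e = dweight D {p, q}" using edge by simp
  have "(\<exists>t<hn. hu t = u e \<and> hv t = v e \<and> hw t = w e) \<and> (\<exists>t<hn. hu t = v e \<and> hv t = u e \<and> hw t = w e)"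
    using half_edgesD(3)[OF halves] e(1) by blast
  moreover have "p = u e \<and> q = v e \<or> p = v e \<and> q = u e" using e(2) by (simp add: doubleton_eq_iff)
  ultimately show thesis using that w by metis
qed

text \<open>For a covering edge \<open>{p, q}\<close> of minimum weight, the half-edge from
  \<open>p\<close> joins both \<open>x\<close> and \<open>f p\<close> to \<open>f q\<close>, and the
  reverse one joins \<open>y\<close> to \<open>f p\<close>.\<close>

lemma sparse_connects:
  assumes sparse: "sparse K gu gv gw" and e: "{x, y} \<in> edges G"
  shows "(x, y) \<in> conn (emitted_le K gu gv gw (weight G {x, y}))"
proof -
  obtain p q where ab: "{p, q} \<in> dedges D" "x \<in> cluster D p" "y \<in> cluster D q"
    "weight G {x, y} = dweight D {p, q}" using edge_covered[OF e] .
  let ?C = "conn (emitted_le K gu gv gw (weight G {x, y}))"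
  obtain t where t: "t < hn" "hu t = p" "hv t = q" "hw t = dweight D {p, q}" using half_edge[OF ab(1)] .
  have "{q, p} \<in> dedges D" "dweight D {q, p} = dweight D {p, q}" using ab(1) by (simp_all add: insert_commute)
  then obtain t' where t': "t' < hn" "hu t' = q" "hv t' = p" "hw t' = dweight D {p, q}"
    using half_edge by metis
  have sp: "(z, f (hv i)) \<in> conn (emitted_le K gu gv gw (hw i))" if "i < hn" "z \<in> cluster D (hu i)" for i z
    using sparseD(3)[OF sparse] that by blast
  have fa: "f p \<in> cluster D p" using reps half[OF t(1)] t(2) by (simp add: representatives_def)
  have "(x, f q) \<in> ?C" "(f p, f q) \<in> ?C" "(y, f p) \<in> ?C"
    using sp[OF t(1), of x] sp[OF t(1), of "f p"] sp[OF t'(1), of y] t t' ab fa by simp_all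
  then show ?thesis by (meson conn_sym conn_trans)
qed

lemma kruskal_sparse:
  assumes sparse: "sparse K gu gv gw"
  shows "kruskal (verts G) (weight G) K gu gv gw"
proof
  show "finite (verts G)" using G by (simp add: weighted_graph_def)
  show "verts G \<noteq> {}" using G by (simp add: graph_connected_def)
  show "gu k \<in> verts G \<and> gv k \<in> verts G" "weight G {gu k, gv k} \<le> gw k" if "k < K" for k
    using sparse_edge[OF sparse that] by auto
  show "gw k' \<le> gw k" if "k < K" "k' \<le> k" for k k'
    using sparseD(2)[OF sparse] that by blast
qed

text \<open>An edge of \<open>G\<close> is connected by sparse edges with labels up to its weight,
  and each of these by edges of \<open>T\<close> with weights up to its label. Composing the two
  gives the bottleneck condition.\<close>

lemma kruskal_mst:
  assumes sparse: "sparse K gu gv gw"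
    and inv: "kruskal.inv (verts G) (weight G) K gu gv gw K par rk R T"
  shows "minimum_spanning_tree G T"
proof -
  interpret K: kruskal "verts G" "weight G" K gu gv gw by (rule kruskal_sparse[OF sparse])
  have T: "T \<subseteq> edges G"
  proof
    fix e assume "e \<in> T"
    then have "e \<in> (\<lambda>k. {gu k, gv k}) ` {..<K}" using K.invD(6)[OF inv] by blast
    then show "e \<in> edges G" using sparse_edge(3)[OF sparse] by auto
  qed
  have light: "(x, y) \<in> conn {e \<in> T. weight G e \<le> weight G {x, y}}" if "{x, y} \<in> edges G" for x y
  proof (rule conn_subset[OF sparse_connects[OF sparse that]])
    fix p q assume "{p, q} \<in> emitted_le K gu gv gw (weight G {x, y})"
    then obtain k where k: "k < K" "gw k \<le> weight G {x, y}" "{p, q} = {gu k, gv k}"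
      by (auto simp: emitted_le_def)
    have "(gu k, gv k) \<in> conn {e \<in> T. weight G e \<le> gw k}" using K.invD(7)[OF inv] k(1) by blast
    moreover have "{e \<in> T. weight G e \<le> gw k} \<subseteq> {e \<in> T. weight G e \<le> weight G {x, y}}"
      using k(2) by auto
    ultimately have "(gu k, gv k) \<in> conn {e \<in> T. weight G e \<le> weight G {x, y}}"
      using conn_mono[THEN subsetD] by blast
    then show "(p, q) \<in> conn {e \<in> T. weight G e \<le> weight G {x, y}}"
      using k(3) conn_sym[of "gu k" "gv k"] by (auto simp: doubleton_eq_iff)
  qed
  have "(p, q) \<in> conn T" if "p \<in> verts G" "q \<in> verts G" for p q
  proof (rule conn_subset)
    show "(p, q) \<in> conn (edges G)" using G(2) that by (simp add: graph_connected_conn)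
    show "(x, y) \<in> conn T" if "{x, y} \<in> edges G" for x y
      using light[OF that] conn_mono[of "{e \<in> T. weight G e \<le> weight G {x, y}}" T] by blast
  qed
  then have "spanning_tree G T"
    using T K.V(2) K.invD(5)[OF inv]
    by (simp add: spanning_tree_def graph_connected_conn acyclic_edges_iff)
  then show ?thesis using light by (rule minimum_spanning_tree_if_bottleneck[OF G(1)])
qed

text \<open>With two or more vertices, each lies on an edge, hence in the cluster of an end of a
  compression edge. It is this end itself or the head of an arc. The \<open>+ 1\<close> is for a
  single vertex.\<close>

lemma card_verts_le: "card (verts G) \<le> a + 2 * m + 1"
proof (cases "\<exists>x. verts G \<subseteq> {x}")
  case True
  then obtain x where "verts G \<subseteq> {x}" ..
  then have "card (verts G) \<le> card {x}" by (intro card_mono) auto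
  then show ?thesis by simp
next
  case False
  let ?S = "head ` {..<a} \<union> (u ` {..<m} \<union> v ` {..<m})"
  have "verts G \<subseteq> ?S"
  proof
    fix x assume x: "x \<in> verts G"
    obtain y where y: "y \<in> verts G" "y \<noteq> x" using False by blast
    then have "(x, y) \<in> conn (edges G)" using G(2) x by (simp add: graph_connected_conn)
    then obtain z where "{x, z} \<in> edges G"
      using y(2) unfolding conn_def by (auto elim: converse_rtranclE)
    then obtain b c where bc: "{b, c} \<in> dedges D" "x \<in> cluster D b" by (rule edge_covered)
    then have "(b, x) \<in> (darcs D)\<^sup>*" by (simp add: cluster_def)
    then show "x \<in> ?S"
    proof (cases rule: rtranclE)
      case base
      obtain i where "i < m" "{b, c} = {u i, v i}" using edges[OF bc(1)] by blast
      then show ?thesis using base by (auto simp: doubleton_eq_iff)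
    next
      case (step y)
      then show ?thesis using arcs by auto
    qed
  qed
  then have "card (verts G) \<le> card ?S" by (intro card_mono) auto
  also have "\<dots> \<le> card (head ` {..<a}) + (card (u ` {..<m}) + card (v ` {..<m}))"
    by (meson add_left_mono card_Un_le le_trans)
  also have "\<dots> \<le> a + (m + m)"
    using card_image_le[of "{..<a}" head] card_image_le[of "{..<m}" u] card_image_le[of "{..<m}" v] by simp
  finally show ?thesis by simp
qed

text \<open>A vertex of the DAG is a sink or the tail of an arc.\<close>

lemma card_dverts_le: "card (dverts D) \<le> card (verts G) + a"
proof -
  have "dverts D \<subseteq> verts G \<union> tail ` {..<a}"
  proof
    fix x assume "x \<in> dverts D"
    then have "x \<in> sinks D \<or> (\<exists>y. (x, y) \<in> darcs D)" by (auto simp: sinks_def)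
    then show "x \<in> verts G \<union> tail ` {..<a}" using sinks arcs by auto
  qed
  then have "card (dverts D) \<le> card (verts G \<union> tail ` {..<a})"
    using G by (intro card_mono) (auto simp: weighted_graph_def)
  also have "\<dots> \<le> card (verts G) + card (tail ` {..<a})" by (rule card_Un_le)
  also have "\<dots> \<le> card (verts G) + a" using card_image_le[of "{..<a}" tail] by simp
  finally show ?thesis .
qed

end

text \<open>For the input with neither arcs nor edges.\<close>

lemma inverse_ack_1: "inverse_ack (Suc 0) = Suc 0"
  unfolding inverse_ack_def by (rule Least_equality) (auto simp: numeral_eq_Suc)

section \<open>The complete program\<close>

text \<open>Sorting happens in place, so it gets a copy; the original weights still address the
  lists of edges.\<close>

definition copy_weights :: com where
  "copy_weights =
     ''i'' ::= Num 0;;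
     While (Less (var ''i'') (var ''num_edges''))
       (Store ''$data'' (var ''i'') (Load ''edge_weight'' (var ''i''));; incr ''i'');;
     ''$len'' ::= var ''num_edges''"

lemma wp_copy_weights:
  fixes s :: state
  defines "m \<equiv> s ''num_edges'' 0"
  shows "wp copy_weights (\<lambda>k' s'. k' \<le> k + 40 * m + 40 \<and>
    s' ''$data'' = (\<lambda>i. if i < m then s ''edge_weight'' i else s ''$data'' i) \<and>
    s' ''$len'' = (s ''$len'')(0 := m)) k s"
proof -
  define Inv where "Inv k' s' \<longleftrightarrow> s' ''num_edges'' 0 = m \<and> s' ''edge_weight'' = s ''edge_weight'' \<and>
    s' ''$len'' = s ''$len'' \<and> s' ''i'' 0 \<le> m \<and> k' \<le> k + 40 * s' ''i'' 0 + 4 \<and>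
    s' ''$data'' = (\<lambda>i. if i < s' ''i'' 0 then s ''edge_weight'' i else s ''$data'' i)"
    for k' :: nat and s' :: state
  show ?thesis
    unfolding copy_weights_def wp_Seq wp_Store
  proof (rule wp_While[where I = Inv and B = "k + 40 * m + 4"], goal_cases)
    case 1
    then show ?case by (simp add: Inv_def m_def)
  next
    case (2 k1 s1)
    then show ?case by (simp add: Inv_def)
  next
    case (3 k1 s1)
    then show ?case by (auto simp: Inv_def wp_simps fun_eq_iff less_Suc_eq)
  next
    case (4 k1 s1)
    then have i: "s1 ''i'' 0 = m" by (simp add: Inv_def)
    show ?case using 4(1) unfolding Inv_def i by simp
  qed
qed

lemma wp_sort:
  assumes "sorts_in_time S t" and s: "(\<lambda>x. s (CHR ''$'' # x)) = sort_input xs"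
  shows "wp (rename ((#) CHR ''$'') S) (\<lambda>k' s'. k' \<le> k + t (length xs) \<and>
    map (s' ''$data'') [0..<length xs] = sort xs) k s"
proof -
  obtain j s' where S: "exec S (sort_input xs) j s'" "j \<le> t (length xs)"
    "map (s' ''data'') [0..<length xs] = sort xs"
    using assms(1) unfolding sorts_in_time_def by blast
  obtain r where r: "exec (rename ((#) CHR ''$'') S) s j r" "(\<lambda>x. r (CHR ''$'' # x)) = s'"
    using exec_rename[where f = "(#) CHR ''$''" and r = s, OF _ S(1) s] by (auto simp: inj_def)
  have "r ''$data'' = s' ''data''" using r(2) by (rule fun_cong)
  then have "map (r ''$data'') [0..<length xs] = sort xs" using S(3) by simp
  then show ?thesis unfolding wp_def using r(1) S(2) add_left_mono[OF S(2), of k] by blast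
qed

definition mst_prog :: "com \<Rightarrow> com" where
  "mst_prog S =
     copy_weights;;
     rename ((#) CHR ''$'') S;;
     build ''edge_weight'' ''num_edges'' ''ehead'' ''enext'';;
     order;;
     build ''arc_tail'' ''num_arcs'' ''afirst'' ''anext'';;
     init_parents;;
     compress_all;;
     search_prog;;
     kruskal_prog"

lemma writes_copy_weights: "writes copy_weights = {''i'', ''$data'', ''$len''}"
  by (auto simp: copy_weights_def)

lemma writes_build: "writes (build key n first nx) = {''i'', nx, first}"
  by (auto simp: build_def)

lemma writes_order: "writes order = {''j'', ''w'', ''e'', ''ehead'', ''hu'', ''hv'', ''hw'', ''hn''}"
  by (auto simp: order_def writes_order_step)

lemma writes_init_parents: "writes init_parents = {''v'', ''rep'', ''par'', ''i''}"
  by (auto simp: init_parents_def)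

lemma writes_compress_all: "writes compress_all = {''v'', ''fx'', ''fr'', ''ft'', ''rep''}"
  by (auto simp: compress_all_def)

lemma writes_search_prog:
  "writes search_prog = {''y'', ''i'', ''afirst'', ''x'', ''gu'', ''gv'', ''gw'', ''gn'', ''mark'', ''queue'',
     ''qt'', ''qh'', ''part'', ''lab'', ''h''}"
  by (auto simp: search_prog_def writes_arrive writes_pop_arc writes_next_half)

lemma wp_execE:
  assumes "wp c Q 0 s"
  obtains k s' where "exec c s k s'" "Q k s'" "\<forall>x. x \<notin> writes c \<longrightarrow> s' x = s x"
  using assms exec_unwritten unfolding wp_def by (metis add_0)

lemma bank_nth: "i < length xs \<Longrightarrow> bank xs i = xs ! i"
  by (simp add: bank_def)

text \<open>The coefficients add up the bounds of the stages, with \<open>hn \<le> 2 * m\<close>: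
  for \<open>m\<close> they give 40 + 40 + 400 + 400, for \<open>a\<close> 40 + 40 + 200, for
  \<open>n\<close> 40 + 300 + 200.\<close>

lemma mst_prog_correct:
  assumes S: "sorts_in_time S t"
    and G: "weighted_graph G" "graph_connected (verts G) (edges G)"
    and D: "weighted_dag_compression D G" and rep: "represents n as es D"
  defines "a \<equiv> length as" and "m \<equiv> length es" and "d \<equiv> inverse_ack (card (verts G)) + 2"
  obtains k s where "exec (mst_prog S) (dag_input n as es) k s"
    "k \<le> t m + 880 * m + 280 * a + 540 * n + 400 + (180 * d + 500) * (2 * m + a) + 120 * d * card (verts G)"
    "distinct (output_edges s)" "minimum_spanning_tree G (set (output_edges s))"
    "n \<le> card (verts G) + a" "card (verts G) \<le> a + 2 * m + 1"
proof -
  define tail where "tail = bank (map fst as)"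
  define head where "head = bank (map snd as)"
  define u where "u = bank (map (\<lambda>(u, v, k). u) es)"
  define v where "v = bank (map (\<lambda>(u, v, k). v) es)"
  define w where "w = bank (map (\<lambda>(u, v, k). k) es)"
  define ws where "ws = map (\<lambda>(u, v, k). k) es"
  let ?s = "dag_input n as es"
  have s: "?s ''num_verts'' 0 = n" "?s ''num_arcs'' 0 = a" "?s ''num_edges'' 0 = m"
    "?s ''arc_tail'' = tail" "?s ''arc_head'' = head"
    "?s ''edge_fst'' = u" "?s ''edge_snd'' = v" "?s ''edge_weight'' = w"
    by (simp_all add: dag_input_def bank_def a_def m_def tail_def head_def u_def v_def w_def)
  have verts: "dverts D = {..<n}" and arcs: "set as = darcs D"
    and edges: "set (map (\<lambda>(u, v, k). {u, v}) es) = dedges D"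
    and weights: "\<forall>(u, v, k) \<in> set es. dweight D {u, v} = k"
    using rep by (auto simp: represents_def)
  have dag: "darcs D \<subseteq> dverts D \<times> dverts D" "acyclic (darcs D)" "dedges D \<subseteq> pairs (dverts D) (dverts D)"
    using D by (auto simp: weighted_dag_compression_def undirected_dag_compression_def)
  have darcs: "darcs D = (\<lambda>i. (tail i, head i)) ` {..<a}"
  proof -
    have "(\<lambda>i. (tail i, head i)) ` {..<a} = (\<lambda>i. as ! i) ` {..<length as}"
      by (rule image_cong) (auto simp: a_def tail_def head_def bank_nth)
    also have "\<dots> = set as" by (auto simp: set_conv_nth)
    finally show ?thesis using arcs by simp
  qed
  have edge: "{u e, v e} \<in> dedges D \<and> dweight D {u e, v e} = w e" if "e < m" for e
  proof -
    obtain p q k where pqk: "es ! e = (p, q, k)" by (cases "es ! e")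
    have "(p, q, k) \<in> set es" using that pqk m_def by (metis nth_mem)
    then have "{p, q} \<in> dedges D" "dweight D {p, q} = k" using weights unfolding edges[symmetric] by force+
    then show ?thesis using that pqk by (simp add: u_def v_def w_def bank_nth m_def)
  qed
  have edges': "\<exists>i<m. e = {u i, v i}" if e: "e \<in> dedges D" for e
  proof -
    have "e \<in> set (map (\<lambda>(u, v, k). {u, v}) es)" using e edges by simp
    then obtain i where i: "i < m" "e = map (\<lambda>(u, v, k). {u, v}) es ! i" unfolding in_set_conv_nth m_def by auto
    then have "e = {u i, v i}" by (cases "es ! i") (simp add: u_def v_def bank_nth m_def)
    then show ?thesis using i(1) by blast
  qed

  obtain k1 s1 where e1: "exec copy_weights ?s k1 s1" and p1: "k1 \<le> 0 + 40 * m + 40 \<and>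
      s1 ''$data'' = (\<lambda>i. if i < m then w i else ?s ''$data'' i) \<and> s1 ''$len'' = (?s ''$len'')(0 := m)"
    and g1: "\<forall>x. x \<notin> writes copy_weights \<longrightarrow> s1 x = ?s x"
    using wp_copy_weights[of 0 ?s] unfolding s by (rule wp_execE) (rule that)
  note f1 = g1[rule_format]
  from p1 have s1: "k1 \<le> 40 * m + 40" "s1 ''$data'' = w" "s1 ''$len'' = bank [m]"
    by (auto simp: dag_input_def w_def bank_def m_def fun_eq_iff)
  have fr1: "s1 x = ?s x" if "x \<notin> {''i'', ''$data'', ''$len''}" for x
    using f1 that by (simp add: writes_copy_weights)

  \<comment> \<open>No input bank has a name starting with \<open>$\<close>, and only
    \<open>$data\<close> and \<open>$len\<close> have been written, so the sorting program meets its
    exact input.\<close>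
  have "s1 (CHR ''$'' # x) = sort_input ws x" for x
  proof (cases "x = ''data'' \<or> x = ''len''")
    case True
    then show ?thesis using s1 by (auto simp: sort_input_def ws_def w_def m_def)
  next
    case False
    then have "s1 (CHR ''$'' # x) = ?s (CHR ''$'' # x)" by (intro fr1) auto
    then show ?thesis using False by (simp add: sort_input_def dag_input_def)
  qed
  then have sorting: "(\<lambda>x. s1 (CHR ''$'' # x)) = sort_input ws" by (rule ext)
  obtain k2 s2 where e2: "exec (rename ((#) CHR ''$'') S) s1 k2 s2" and
    p2: "k2 \<le> 0 + t (length ws) \<and> map (s2 ''$data'') [0..<length ws] = sort ws"
    and g2: "\<forall>x. x \<notin> writes (rename ((#) CHR ''$'') S) \<longrightarrow> s2 x = s1 x"
    using wp_sort[OF S sorting, of 0] by (rule wp_execE) (rule that)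
  note f2 = g2[rule_format]
  have lws: "length ws = m" by (simp add: ws_def m_def)
  have fr2: "s2 x = ?s x" if "x \<noteq> ''i''" "\<And>y. x \<noteq> CHR ''$'' # y" for x
  proof -
    have "s2 x = s1 x" by (rule f2) (use that(2) in \<open>auto simp: writes_rename\<close>)
    then show ?thesis using fr1[of x] that(1) that(2)[of "''data''"] that(2)[of "''len''"] by simp
  qed
  have data: "s2 ''$data'' j = sort ws ! j" if "j < m" for j
  proof -
    have "map (s2 ''$data'') [0..<m] ! j = sort ws ! j" using p2 unfolding lws by simp
    then show ?thesis using that by simp
  qed

  have z2: "s2 ''ehead'' = (\<lambda>_. 0)" "s2 ''edge_weight'' = w" "s2 ''num_edges'' 0 = m"
    using fr2[of "''ehead''"] fr2[of "''edge_weight''"] fr2[of "''num_edges''"] s by (simp_all add: dag_input_def)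
  have "wp (build ''edge_weight'' ''num_edges'' ''ehead'' ''enext'') (\<lambda>k' s'. k' \<le> 0 + 40 * s2 ''num_edges'' 0 + 40 \<and>
    (\<forall>x. linked (s' ''enext'') (s' ''ehead'' x) (bucket (s2 ''edge_weight'') (s2 ''num_edges'' 0) x))) 0 s2"
    by (rule wp_build) (use z2 in auto)
  then obtain k3 s3 where
    e3: "exec (build ''edge_weight'' ''num_edges'' ''ehead'' ''enext'') s2 k3 s3" and
    p3: "k3 \<le> 0 + 40 * m + 40 \<and> (\<forall>x. linked (s3 ''enext'') (s3 ''ehead'' x) (bucket w m x))"
    and g3: "\<forall>x. x \<notin> writes (build ''edge_weight'' ''num_edges'' ''ehead'' ''enext'') \<longrightarrow> s3 x = s2 x"
    unfolding z2 by (rule wp_execE) (rule that)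
  note f3 = g3[unfolded writes_build, rule_format]

  have z3: "s3 ''num_edges'' 0 = m" "s3 ''edge_weight'' = w" "s3 ''edge_fst'' = u" "s3 ''edge_snd'' = v"
    "s3 ''$data'' = s2 ''$data''"
    using z2 f3 fr2 s by simp_all
  have "wp order (\<lambda>k' s'. k' \<le> 0 + 400 * m + 40 \<and> s' ''hn'' 0 \<le> 2 * m \<and>
    half_edges m (s3 ''edge_fst'') (s3 ''edge_snd'') (s3 ''edge_weight'')
      (s' ''hn'' 0) (s' ''hu'') (s' ''hv'') (s' ''hw'')) 0 s3"
  proof (rule wp_order)
    show "s3 ''$data'' i \<le> s3 ''$data'' j" if "i \<le> j" "j < m" for i j
      using that data[of i] data[of j] z3(5) lws by (simp add: sorted_nth_mono)
    show "\<exists>j<m. s3 ''$data'' j = s3 ''edge_weight'' e" if "e < m" for e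
    proof -
      have "w e \<in> set (sort ws)" using that by (simp add: w_def ws_def bank_nth m_def)
      then obtain j where "j < m" "sort ws ! j = w e" unfolding in_set_conv_nth using lws by auto
      then show ?thesis using data z3 by auto
    qed
    show "linked (s3 ''enext'') (s3 ''ehead'' x) (bucket (s3 ''edge_weight'') m x)" for x
      using p3 z3 by simp
  qed (use z3 in simp)
  then obtain k4 s4 where e4: "exec order s3 k4 s4" and p4: "k4 \<le> 0 + 400 * m + 40 \<and> s4 ''hn'' 0 \<le> 2 * m \<and>
    half_edges m u v w (s4 ''hn'' 0) (s4 ''hu'') (s4 ''hv'') (s4 ''hw'')"
    and g4: "\<forall>x. x \<notin> writes (order) \<longrightarrow> s4 x = s3 x"
    unfolding z3 by (rule wp_execE) (rule that)
  note f4 = g4[unfolded writes_order, rule_format]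
  define hn where "hn = s4 ''hn'' 0"
  define hu where "hu = s4 ''hu''"
  define hv where "hv = s4 ''hv''"
  define hw where "hw = s4 ''hw''"
  have halves: "half_edges m u v w hn hu hv hw" and hn: "hn \<le> 2 * m"
    using p4 by (simp_all add: hn_def hu_def hv_def hw_def)
  have fr4: "s4 x = ?s x" if "x \<in> {''afirst'', ''arc_tail'', ''arc_head'', ''num_arcs'', ''num_verts'',
      ''h'', ''qh'', ''qt'', ''gn'', ''mark'', ''rank'', ''out_len''}" for x
    using that f4[of x] f3[of x] fr2[of x] by auto

  have z4: "s4 ''afirst'' = (\<lambda>_. 0)" "s4 ''arc_tail'' = tail" "s4 ''num_arcs'' 0 = a"
    using fr4[of "''afirst''"] fr4[of "''arc_tail''"] fr4[of "''num_arcs''"] s by (simp_all add: dag_input_def)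
  have "wp (build ''arc_tail'' ''num_arcs'' ''afirst'' ''anext'') (\<lambda>k' s'. k' \<le> 0 + 40 * s4 ''num_arcs'' 0 + 40 \<and>
    (\<forall>x. linked (s' ''anext'') (s' ''afirst'' x) (bucket (s4 ''arc_tail'') (s4 ''num_arcs'' 0) x))) 0 s4"
    by (rule wp_build) (use z4 in auto)
  then obtain k5 s5 where
    e5: "exec (build ''arc_tail'' ''num_arcs'' ''afirst'' ''anext'') s4 k5 s5" and
    p5: "k5 \<le> 0 + 40 * a + 40 \<and> (\<forall>x. linked (s5 ''anext'') (s5 ''afirst'' x) (bucket tail a x))"
    and g5: "\<forall>x. x \<notin> writes (build ''arc_tail'' ''num_arcs'' ''afirst'' ''anext'') \<longrightarrow> s5 x = s4 x"
    unfolding z4 by (rule wp_execE) (rule that)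
  note f5 = g5[unfolded writes_build, rule_format]
  have fr5: "s5 x = ?s x" if "x \<in> {''arc_tail'', ''arc_head'', ''num_arcs'', ''num_verts'',
      ''h'', ''qh'', ''qt'', ''gn'', ''mark'', ''rank'', ''out_len''}" for x
    using that f5[of x] fr4[of x] by auto

  have z5: "s5 ''num_verts'' 0 = n" "s5 ''num_arcs'' 0 = a" "s5 ''arc_tail'' = tail" "s5 ''arc_head'' = head"
    using fr5[of "''num_verts''"] fr5[of "''num_arcs''"] fr5[of "''arc_tail''"] fr5[of "''arc_head''"] s
    by simp_all
  obtain k6 s6 where e6: "exec init_parents s5 k6 s6" and
    p6: "k6 \<le> 0 + 40 * n + 40 * a + 40 \<and> (\<forall>x<n. s6 ''par'' x = x) \<and>
      (\<forall>x<n. s6 ''rep'' x = x \<and> (\<forall>i<a. tail i \<noteq> x) \<or> (\<exists>i<a. tail i = x \<and> head i = s6 ''rep'' x))"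
    and g6: "\<forall>x. x \<notin> writes (init_parents) \<longrightarrow> s6 x = s5 x"
    using wp_init_parents[of 0 s5] unfolding z5 by (rule wp_execE) (rule that)
  note f6 = g6[unfolded writes_init_parents, rule_format]
  have fin: "finite (dverts D)" using verts by simp
  have rep_arc: "(x, s6 ''rep'' x) \<in> darcs D" if x: "x \<in> dverts D" "x \<notin> sinks D" for x
  proof -
    obtain y where "(x, y) \<in> darcs D" using x by (auto simp: sinks_def)
    then obtain i where "i < a" "tail i = x" unfolding darcs by auto
    then obtain i where "i < a" "tail i = x" "head i = s6 ''rep'' x" using p6 x(1) verts by blast
    then show ?thesis unfolding darcs by auto
  qed
  have rep_sink: "s6 ''rep'' x = x" if x: "x \<in> sinks D" for x
  proof -
    have "tail i \<noteq> x" if "i < a" for i using x that darcs by (auto simp: sinks_def)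
    moreover have "x < n" using x verts by (auto simp: sinks_def)
    ultimately show ?thesis using p6 by blast
  qed
  \<comment> \<open>The representatives depend on which arc each vertex happened to keep, so
    \<open>f\<close> is fixed only at this point of the execution.\<close>
  obtain \<rho> f where trees: "trees (dverts D) (s6 ''rep'') \<rho> f" and reps: "representatives D f"
    using dag_trees[OF fin dag(1,2) rep_sink rep_arc] by blast

  have z6: "s6 ''num_verts'' 0 = n" using f6[of "''num_verts''"] z5 by simp
  obtain k7 s7 where e7: "exec compress_all s6 k7 s7" and p7: "k7 \<le> 0 + 300 * n + 40 \<and> (\<forall>x<n. s7 ''rep'' x = f x)"
    and g7: "\<forall>x. x \<notin> writes (compress_all) \<longrightarrow> s7 x = s6 x"
    using wp_compress_all[OF trees[unfolded verts] z6[symmetric], of 0]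
    by (rule wp_execE) (rule that)
  note f7 = g7[unfolded writes_compress_all, rule_format]

  interpret compressed_graph D f a tail head hn hu hv hw G m u v w
  proof
    show "hu i \<in> dverts D \<and> hv i \<in> dverts D" if "i < hn" for i
    proof -
      have "\<exists>e<m. hw i = w e \<and> (hu i = u e \<and> hv i = v e \<or> hu i = v e \<and> hv i = u e)"
        using half_edgesD(2)[OF halves] that by blast
      then obtain e where "e < m" "hu i = u e \<and> hv i = v e \<or> hu i = v e \<and> hv i = u e" by blast
      moreover from this have "{u e, v e} \<in> pairs (dverts D) (dverts D)" using edge dag(3) by blast
      ultimately show ?thesis by (auto simp: pairs_def doubleton_eq_iff)
    qed
    show "hw i' \<le> hw i" if "i < hn" "i' \<le> i" for i i'
      using half_edgesD(1)[OF halves] that by blast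
  qed (fact darcs dag reps G D edge edges' halves)+

  have fr7: "s7 x = ?s x" if "x \<in> {''h'', ''qh'', ''qt'', ''gn'', ''mark'', ''rank'', ''out_len''}" for x
    using that f7[of x] f6[of x] fr5[of x] by auto
  have b7: "s7 ''arc_head'' = head" "s7 ''hn'' 0 = hn" "s7 ''hu'' = hu" "s7 ''hv'' = hv" "s7 ''hw'' = hw"
    using z5 f7 f6 f5 by (simp_all add: hn_def hu_def hv_def hw_def)
  have z7: "s7 ''h'' 0 = 0" "s7 ''qh'' 0 = 0" "s7 ''qt'' 0 = 0" "s7 ''gn'' 0 = 0" "s7 ''mark'' = (\<lambda>_. 0)"
    using fr7[of "''h''"] fr7[of "''qh''"] fr7[of "''qt''"] fr7[of "''gn''"] fr7[of "''mark''"]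
    by (simp_all add: dag_input_def)
  have "wp search_prog (\<lambda>k' s'. k' \<le> 0 + 200 * hn + 200 * n + 200 * a + 40 \<and> s' ''gn'' 0 \<le> hn + a \<and>
    sparse (s' ''gn'' 0) (s' ''gu'') (s' ''gv'') (s' ''gw'')) 0 s7"
  proof (rule wp_search_prog[OF verts])
    show "constant_banks n (s7 ''anext'') s7" using b7 p7 by (simp add: constant_banks_def)
    show "linked (s7 ''anext'') (s7 ''afirst'' x) (bucket tail a x)" for x
      using p5 f7[of "''anext''"] f6[of "''anext''"] f7[of "''afirst''"] f6[of "''afirst''"] by simp
  qed (fact z7)+
  then obtain k8 s8 where e8: "exec search_prog s7 k8 s8" and
    p8: "k8 \<le> 0 + 200 * hn + 200 * n + 200 * a + 40 \<and> s8 ''gn'' 0 \<le> hn + a \<and>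
      sparse (s8 ''gn'' 0) (s8 ''gu'') (s8 ''gv'') (s8 ''gw'')"
    and g8: "\<forall>x. x \<notin> writes search_prog \<longrightarrow> s8 x = s7 x"
    by (rule wp_execE) (rule that)
  note f8 = g8[rule_format]
  define K where "K = s8 ''gn'' 0"
  define gu where "gu = s8 ''gu''"
  define gv where "gv = s8 ''gv''"
  define gw where "gw = s8 ''gw''"
  have sparse: "sparse K gu gv gw" and K: "K \<le> hn + a" using p8 by (simp_all add: K_def gu_def gv_def gw_def)
  interpret kr: kruskal "verts G" "weight G" K gu gv gw by (rule kruskal_sparse[OF sparse])

  have par: "s8 ''par'' x = x" if "x \<in> verts G" for x
  proof -
    have "x < n" using that sinks verts by (auto simp: sinks_def)
    then show ?thesis using p6 f8[of "''par''"] f7[of "''par''"] by (simp add: writes_search_prog)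
  qed
  have z8: "s8 ''rank'' = (\<lambda>_. 0)" "s8 ''out_len'' 0 = 0"
    using fr7[of "''rank''"] fr7[of "''out_len''"] f8[of "''rank''"] f8[of "''out_len''"]
    by (simp_all add: writes_search_prog dag_input_def)
  obtain k9 s9 where e9: "exec kruskal_prog s8 k9 s9" and
    p9: "k9 \<le> 0 + (180 * kr.depth + 500) * K + 120 * kr.depth * card (verts G) + 40 \<and>
      distinct (output_edges s9) \<and> (\<exists>p rk R. kr.inv K p rk R (set (output_edges s9)))"
    using kr.wp_kruskal_prog[OF K_def[symmetric] gu_def[symmetric] gv_def[symmetric] par z8, of 0]
    by (rule wp_execE)

  have "exec (mst_prog S) ?s (k1 + (k2 + (k3 + (k4 + (k5 + (k6 + (k7 + (k8 + k9)))))))) s9"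
    unfolding mst_prog_def by (intro exec.Seq) (fact e1 e2 e3 e4 e5 e6 e7 e8 e9)+
  moreover have "k1 + (k2 + (k3 + (k4 + (k5 + (k6 + (k7 + (k8 + k9))))))) \<le>
      t m + 880 * m + 280 * a + 540 * n + 400 + (180 * d + 500) * (2 * m + a) + 120 * d * card (verts G)"
  proof -
    have "(180 * d + 500) * K \<le> (180 * d + 500) * (2 * m + a)"
      using K hn by (intro mult_le_mono2) simp
    moreover have "k9 \<le> (180 * d + 500) * K + 120 * d * card (verts G) + 40"
      using p9 by (simp add: kr.depth_def d_def)
    moreover have "k2 \<le> t m" using p2 by (simp add: lws)
    moreover have "k3 \<le> 40 * m + 40" "k4 \<le> 400 * m + 40" "k5 \<le> 40 * a + 40" "k6 \<le> 40 * n + 40 * a + 40"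
      "k7 \<le> 300 * n + 40" "k8 \<le> 200 * hn + 200 * n + 200 * a + 40" using p3 p4 p5 p6 p7 p8 by auto
    ultimately show ?thesis using s1(1) hn by linarith
  qed
  moreover have "distinct (output_edges s9)" using p9 by blast
  moreover have "minimum_spanning_tree G (set (output_edges s9))" using p9 kruskal_mst[OF sparse] by blast
  moreover have "n \<le> card (verts G) + a" using card_dverts_le verts by simp
  ultimately show thesis using card_verts_le by (rule that)
qed

theorem theorem1:
  fixes S :: com and t_sort :: "nat \<Rightarrow> nat"
  assumes "sorts_in_time S t_sort"
  shows "\<exists>(P :: com) (c :: nat). \<forall>(G :: nat wgraph) (D :: nat wdag) n as es.
     weighted_graph G \<and> graph_connected (verts G) (edges G) \<and>
     weighted_dag_compression D G \<and> represents n as es D \<longrightarrow>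
     (\<exists>k s. exec P (dag_input n as es) k s \<and>
        k \<le> c * ((card (darcs D) + card (dedges D)) * inverse_ack (card (verts G))
                 + t_sort (card (dedges D))) \<and>
        distinct (output_edges s) \<and> minimum_spanning_tree G (set (output_edges s)))"
proof (rule exI[of _ "mst_prog S"], rule exI[of _ 10000], intro allI impI, elim conjE)
  fix G :: "nat wgraph" and D :: "nat wdag" and n as es
  assume G: "weighted_graph G" "graph_connected (verts G) (edges G)"
    and D: "weighted_dag_compression D G" and rep: "represents n as es D"
  define a where "a = length as"
  define m where "m = length es"
  define \<alpha> where "\<alpha> = inverse_ack (card (verts G))"
  define X where "X = (a + m) * \<alpha>"
  obtain k s where e: "exec (mst_prog S) (dag_input n as es) k s"
    and k: "k \<le> t_sort m + 880 * m + 280 * a + 540 * n + 400 +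
      (180 * (\<alpha> + 2) + 500) * (2 * m + a) + 120 * (\<alpha> + 2) * card (verts G)"
    and res: "distinct (output_edges s)" "minimum_spanning_tree G (set (output_edges s))"
    and n: "n \<le> card (verts G) + a" and V: "card (verts G) \<le> a + 2 * m + 1"
    using mst_prog_correct[OF assms G D rep] unfolding a_def m_def \<alpha>_def by blast
  have a: "card (darcs D) = a" and m: "card (dedges D) = m"
    using rep unfolding represents_def a_def m_def
    by (metis distinct_card, metis distinct_card length_map)
  \<comment> \<open>Every execution takes at least one step, so \<open>t_sort\<close> can absorb
    additive constants.\<close>
  have t: "1 \<le> t_sort m"
  proof -
    obtain j s' where "exec S (sort_input (replicate m 0)) j s'" "j \<le> t_sort (length (replicate m (0 :: nat)))"
      using assms unfolding sorts_in_time_def by blast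
    then show ?thesis using exec_positive by fastforce
  qed
  have \<alpha>: "1 \<le> \<alpha>" unfolding \<alpha>_def by (rule inverse_ack_positive)
  \<comment> \<open>The \<open>+ 1\<close> in the bound on the vertices leaves a lone summand
    \<open>\<alpha>\<close>. It is at most \<open>X\<close> unless there are no arcs and edges, and
    then it equals 1.\<close>
  have "\<alpha> \<le> X + t_sort m"
  proof (cases "a + m = 0")
    case True
    have "verts G \<noteq> {}" "finite (verts G)" using G by (auto simp: graph_connected_def weighted_graph_def)
    then have "card (verts G) = 1" using V True by (simp add: card_gt_0_iff le_Suc_eq)
    then have "\<alpha> = 1" by (simp add: \<alpha>_def inverse_ack_1)
    then show ?thesis using t by simp
  next
    case False
    then have "1 * \<alpha> \<le> X" unfolding X_def by (intro mult_le_mono1) linarith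
    then show ?thesis by simp
  qed
  moreover have "a \<le> X" "m \<le> X" "a * \<alpha> \<le> X" "m * \<alpha> \<le> X"
    using \<alpha> unfolding X_def by (auto intro: order.trans[OF _ mult_le_mono2[OF \<alpha>]])
  moreover have "(180 * (\<alpha> + 2) + 500) * (2 * m + a) = 360 * (m * \<alpha>) + 180 * (a * \<alpha>) + 1720 * m + 860 * a"
    by (simp add: algebra_simps)
  moreover have "120 * (\<alpha> + 2) * card (verts G) \<le> 120 * (\<alpha> + 2) * (a + 2 * m + 1)"
    using V by (rule mult_le_mono2)
  moreover have "120 * (\<alpha> + 2) * (a + 2 * m + 1) =
      120 * (a * \<alpha>) + 240 * (m * \<alpha>) + 120 * \<alpha> + 240 * a + 480 * m + 240"
    by (simp add: algebra_simps)
  \<comment> \<open>With \<open>m\<close>, \<open>a\<close>, \<open>m * \<alpha>\<close> and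
    \<open>a * \<alpha>\<close> each at most \<open>X\<close>, the coefficient of \<open>X\<close>
    stays below 8000; 10000 is rounded up.\<close>
  ultimately have "k \<le> 10000 * X + 10000 * t_sort m" using k n V t by linarith
  then have "k \<le> 10000 * (X + t_sort m)" by simp
  then show "\<exists>k s. exec (mst_prog S) (dag_input n as es) k s \<and>
        k \<le> 10000 * ((card (darcs D) + card (dedges D)) * inverse_ack (card (verts G))
                 + t_sort (card (dedges D))) \<and>
        distinct (output_edges s) \<and> minimum_spanning_tree G (set (output_edges s))"
    using e res unfolding a m X_def \<alpha>_def by blast
qed

end
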